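(* Let $m\geq 1$ be an integer. Let $X$ be a real or complex Banach space having the bounded compact approximation property, and let $T\in B(X)$ satisfy $\frac{\|T^{n}\|_{e}}{n}\to 0$ as $n\to\infty$. Then the following conditions are equivalent. (1) The sequence $(M_{n}(\dot{T}))_{n\ge 1}$, where $M_{n}(\dot{T})=\frac{\dot{I}+\dot{T}+\dots+\dot{T}^{n}}{n+1}$, converges in norm to an element of $B(X)/K(X)$. (2) There is an essentially maximal subspace of $X$ on which $(I-T)^{m}$ is compact.
   Context: For a Banach space $X$, $B(X)$ is the algebra of all bounded linear operators on $X$ and $K(X)$ is its closed ideal of compact operators. For $T\in B(X)$, $\dot{T}$ denotes the image of $T$ in the Calkin algebra $B(X)/K(X)$ (with the quotient norm), and the essential norm $\|T\|_{e}$ is the norm of $\dot{T}$ in $B(X)/K(X)$. A Banach space $Z$ has the bounded compact approximation property if there is a uniformly bounded net $(S_{\alpha})_{\alpha\in\Lambda}$ in $K(Z)$ converging strongly (i.e. pointwise in norm on $Z$) to the identity operator $I\in B(Z)$. An operator $S\in B(X)$ is compact on a subspace $M\subset X$ if the restriction $S|_{M}:M\to X$ is compact. Given a property $(P)$ that a subspace of $X$ may or may not have, a subspace $M\subset X$ is an essentially maximal subspace of $X$ satisfying $(P)$ if $M$ has $(P)$ and every subspace $M_{0}\supset M$ of $X$ having property $(P)$ satisfies $\dim M_{0}/M<\infty$. In (2), the property $(P)$ of a subspace $M$ is "$(I-T)^{m}$ is compact on $M$". *)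

theory Defs
  imports "HOL-Analysis.Analysis" "HOL-Algebra.QuotRing"
begin

section \<open>Real and complex Banach spaces\<close>

text \<open>
  Normed fields that are, up to an isometric isomorphism \<open>f\<close> of real algebras, the field of real
  numbers or the field of complex numbers.
\<close>

class real_or_complex = real_normed_field +
  assumes real_or_complex:
    "\<exists>f :: 'a \<Rightarrow> complex.
       f 1 = 1 \<and> (\<forall>r x. f (r *\<^sub>R x) = complex_of_real r * f x) \<and>
       (\<forall>x y. f (x + y) = f x + f y) \<and> (\<forall>x y. f (x * y) = f x * f y) \<and>
       (\<forall>x. cmod (f x) = norm x) \<and> (range f = \<real> \<or> range f = UNIV)"

instance real :: real_or_complex
  by standard (rule exI[of _ complex_of_real], auto simp: Reals_def scaleR_conv_of_real)

instance complex :: real_or_complex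
  by standard (rule exI[of _ "\<lambda>x. x"], auto simp: scaleR_conv_of_real)

text \<open>
  The class \<^class>\<open>banach\<close> only provides real scalars.  A Banach space over \<open>'k\<close> (real or complex) is
  such a space with a multiplication \<open>smul\<close> by elements of \<open>'k\<close> that extends \<^const>\<open>scaleR\<close> and is
  compatible with the norm.
\<close>

locale banach_over = vector_space smul
  for smul :: "'k::real_or_complex \<Rightarrow> 'a::banach \<Rightarrow> 'a" +
  assumes smul_of_real: "smul (of_real r) x = r *\<^sub>R x"
    and norm_smul: "norm (smul c x) = norm c * norm x"

lemma banach_over_real: "banach_over (scaleR :: real \<Rightarrow> 'a::banach \<Rightarrow> 'a)"
  by unfold_locales (simp_all add: scaleR_add_right scaleR_add_left)

lemma banach_over_complex: "banach_over ((*) :: complex \<Rightarrow> complex \<Rightarrow> complex)"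
  by unfold_locales (simp_all add: algebra_simps norm_mult scaleR_conv_of_real)


section \<open>Compact operators and the Calkin algebra\<close>

text \<open>
  \<open>compact_on f M\<close> says that the restriction of \<open>f\<close> to \<open>M\<close> is compact; closures are taken in the
  codomain of \<open>f\<close>.
\<close>

definition compact_on :: "('a::real_normed_vector \<Rightarrow> 'b::real_normed_vector) \<Rightarrow> 'a set \<Rightarrow> bool"
  where "compact_on f M \<longleftrightarrow> (\<forall>B\<subseteq>M. bounded B \<longrightarrow> compact (closure (f ` B)))"

text \<open>
  The ring \<open>B(X)\<close>.  The elements of \<open>'a \<Rightarrow>\<^sub>L 'a\<close> are only real-linear, hence the carrier.
\<close>

definition bounded_operators ::
    "('k::real_or_complex \<Rightarrow> 'a::banach \<Rightarrow> 'a) \<Rightarrow> ('a \<Rightarrow>\<^sub>L 'a) ring"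
  where "bounded_operators smul =
    \<lparr>carrier = {T. Vector_Spaces.linear smul smul (blinfun_apply T)},
     mult = (o\<^sub>L), one = id_blinfun, zero = 0, add = (+)\<rparr>"

definition compact_operators ::
    "('k::real_or_complex \<Rightarrow> 'a::banach \<Rightarrow> 'a) \<Rightarrow> ('a \<Rightarrow>\<^sub>L 'a) set"
  where "compact_operators smul =
    {T \<in> carrier (bounded_operators smul). compact_on (blinfun_apply T) UNIV}"

definition calkin_algebra ::
    "('k::real_or_complex \<Rightarrow> 'a::banach \<Rightarrow> 'a) \<Rightarrow> ('a \<Rightarrow>\<^sub>L 'a) set ring"
  where "calkin_algebra smul = bounded_operators smul Quot compact_operators smul"

definition calkin_class ::
    "('k::real_or_complex \<Rightarrow> 'a::banach \<Rightarrow> 'a) \<Rightarrow> ('a \<Rightarrow>\<^sub>L 'a) \<Rightarrow> ('a \<Rightarrow>\<^sub>L 'a) set"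
  where "calkin_class smul T = compact_operators smul +>\<^bsub>bounded_operators smul\<^esub> T"

text \<open>Multiplication of cosets by real scalars, in the style of \<^const>\<open>rcoset_mult\<close>.\<close>

definition calkin_scaleR ::
    "('k::real_or_complex \<Rightarrow> 'a::banach \<Rightarrow> 'a) \<Rightarrow> real \<Rightarrow> ('a \<Rightarrow>\<^sub>L 'a) set \<Rightarrow> ('a \<Rightarrow>\<^sub>L 'a) set"
  where "calkin_scaleR smul r A = (\<Union>S\<in>A. calkin_class smul (r *\<^sub>R S))"

definition quotient_norm :: "'b::real_normed_vector set \<Rightarrow> real"
  where "quotient_norm A = (INF S\<in>A. norm S)"

definition essential_norm ::
    "('k::real_or_complex \<Rightarrow> 'a::banach \<Rightarrow> 'a) \<Rightarrow> ('a \<Rightarrow>\<^sub>L 'a) \<Rightarrow> real"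
  where "essential_norm smul T = quotient_norm (calkin_class smul T)"

definition calkin_mean ::
    "('k::real_or_complex \<Rightarrow> 'a::banach \<Rightarrow> 'a) \<Rightarrow> nat \<Rightarrow> ('a \<Rightarrow>\<^sub>L 'a) set \<Rightarrow> ('a \<Rightarrow>\<^sub>L 'a) set"
  where "calkin_mean smul n A =
    calkin_scaleR smul (1 / (real n + 1))
      (\<Oplus>\<^bsub>calkin_algebra smul\<^esub>i\<in>{0..n}. A [^]\<^bsub>calkin_algebra smul\<^esub> i)"

definition calkin_convergent ::
    "('k::real_or_complex \<Rightarrow> 'a::banach \<Rightarrow> 'a) \<Rightarrow> (nat \<Rightarrow> ('a \<Rightarrow>\<^sub>L 'a) set) \<Rightarrow> bool"
  where "calkin_convergent smul A \<longleftrightarrow>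
    (\<exists>L\<in>carrier (calkin_algebra smul).
       (\<lambda>n. quotient_norm (A n \<ominus>\<^bsub>calkin_algebra smul\<^esub> L)) \<longlonglongrightarrow> 0)"


section \<open>The bounded compact approximation property\<close>

text \<open>
  A net of operators is represented by the filter on operators that it generates.  The lemmas
  \<open>bounded_compact_approximation_property_if_net\<close> and
  \<open>net_if_bounded_compact_approximation_property\<close> below show that this is the same as asking for a
  net over a directed set, of any type.
\<close>

definition bounded_compact_approximation_property ::
    "('k::real_or_complex \<Rightarrow> 'a::banach \<Rightarrow> 'a) \<Rightarrow> bool"
  where "bounded_compact_approximation_property smul \<longleftrightarrow>
    (\<exists>F C. F \<noteq> bot \<and>
       (\<forall>\<^sub>F S in F. S \<in> compact_operators smul \<and> norm S \<le> C) \<and>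
       (\<forall>x. ((\<lambda>S. blinfun_apply S x) \<longlongrightarrow> x) F))"

definition directed_set :: "'i set \<Rightarrow> ('i \<Rightarrow> 'i \<Rightarrow> bool) \<Rightarrow> bool"
  where "directed_set \<Lambda> pre \<longleftrightarrow> \<Lambda> \<noteq> {} \<and> (\<forall>a\<in>\<Lambda>. pre a a) \<and>
    (\<forall>a\<in>\<Lambda>. \<forall>b\<in>\<Lambda>. \<forall>c\<in>\<Lambda>. pre a b \<longrightarrow> pre b c \<longrightarrow> pre a c) \<and>
    (\<forall>a\<in>\<Lambda>. \<forall>b\<in>\<Lambda>. \<exists>c\<in>\<Lambda>. pre a c \<and> pre b c)"

definition bounded_compact_approximation_net ::
    "('k::real_or_complex \<Rightarrow> 'a::banach \<Rightarrow> 'a) \<Rightarrow> 'i set \<Rightarrow> ('i \<Rightarrow> 'i \<Rightarrow> bool) \<Rightarrow>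
     ('i \<Rightarrow> 'a \<Rightarrow>\<^sub>L 'a) \<Rightarrow> bool"
  where "bounded_compact_approximation_net smul \<Lambda> pre S \<longleftrightarrow>
    directed_set \<Lambda> pre \<and>
    (\<forall>a\<in>\<Lambda>. S a \<in> compact_operators smul) \<and> (\<exists>C. \<forall>a\<in>\<Lambda>. norm (S a) \<le> C) \<and>
    (\<forall>x. \<forall>e>0. \<exists>a\<in>\<Lambda>. \<forall>b\<in>\<Lambda>. pre a b \<longrightarrow> norm (blinfun_apply (S b) x - x) < e)"

lemma bounded_compact_approximation_property_if_net:
  assumes "bounded_compact_approximation_net smul \<Lambda> pre S"
  shows "bounded_compact_approximation_property smul"
proof -
  define G where "G = (INF a\<in>\<Lambda>. principal {b\<in>\<Lambda>. pre a b})"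
  have dir: "directed_set \<Lambda> pre" and K: "\<And>a. a \<in> \<Lambda> \<Longrightarrow> S a \<in> compact_operators smul"
    and conv: "\<And>x e. e > 0 \<Longrightarrow> \<exists>a\<in>\<Lambda>. \<forall>b\<in>\<Lambda>. pre a b \<longrightarrow> norm (blinfun_apply (S b) x - x) < e"
    using assms by (auto simp: bounded_compact_approximation_net_def)
  from assms have "\<exists>C. \<forall>a\<in>\<Lambda>. norm (S a) \<le> C"
    by (simp add: bounded_compact_approximation_net_def)
  then obtain C where C: "\<And>a. a \<in> \<Lambda> \<Longrightarrow> norm (S a) \<le> C" by blast
  have ev: "eventually P G \<longleftrightarrow> (\<exists>a\<in>\<Lambda>. \<forall>b\<in>\<Lambda>. pre a b \<longrightarrow> P b)" for P
  proof -
    have "eventually P G \<longleftrightarrow> (\<exists>a\<in>\<Lambda>. eventually P (principal {b\<in>\<Lambda>. pre a b}))"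
      unfolding G_def
    proof (rule eventually_INF_base)
      show "\<Lambda> \<noteq> {}" using dir by (simp add: directed_set_def)
      fix a b assume ab: "a \<in> \<Lambda>" "b \<in> \<Lambda>"
      then obtain c where c: "c \<in> \<Lambda>" "pre a c" "pre b c"
        using dir unfolding directed_set_def by blast
      have "{d\<in>\<Lambda>. pre c d} \<subseteq> {d\<in>\<Lambda>. pre a d} \<inter> {d\<in>\<Lambda>. pre b d}"
        using dir ab c unfolding directed_set_def by blast
      then show "\<exists>x\<in>\<Lambda>. principal {d\<in>\<Lambda>. pre x d} \<le>
          inf (principal {d\<in>\<Lambda>. pre a d}) (principal {d\<in>\<Lambda>. pre b d})"
        using c(1) by auto
    qed
    then show ?thesis by (auto simp: eventually_principal)
  qed
  have "G \<noteq> bot"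
    unfolding trivial_limit_def ev using dir unfolding directed_set_def by blast
  moreover have "\<forall>\<^sub>F T in filtermap S G. T \<in> compact_operators smul \<and> norm T \<le> C"
    unfolding eventually_filtermap ev
    using dir K C unfolding directed_set_def by blast
  moreover have "((\<lambda>T. blinfun_apply T x) \<longlongrightarrow> x) (filtermap S G)" for x
    unfolding tendsto_iff eventually_filtermap ev dist_norm using conv by blast
  ultimately show ?thesis
    unfolding bounded_compact_approximation_property_def
    by (intro exI[of _ "filtermap S G"] exI[of _ C]) (simp add: filtermap_bot_iff)
qed

lemma net_if_bounded_compact_approximation_property:
  fixes smul :: "'k::real_or_complex \<Rightarrow> 'a::banach \<Rightarrow> 'a"
  assumes "bounded_compact_approximation_property smul"
  shows "\<exists>(\<Lambda> :: (('a \<Rightarrow>\<^sub>L 'a) set \<times> ('a \<Rightarrow>\<^sub>L 'a)) set) pre S.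
           bounded_compact_approximation_net smul \<Lambda> pre S"
proof -
  from assms obtain F C where F: "F \<noteq> bot"
    and good: "\<forall>\<^sub>F S in F. S \<in> compact_operators smul \<and> norm S \<le> C"
    and conv: "\<And>x. ((\<lambda>S. blinfun_apply S x) \<longlongrightarrow> x) F"
    unfolding bounded_compact_approximation_property_def by blast
  define good_set where "good_set = {S \<in> compact_operators smul. norm S \<le> C}"
  define \<Lambda> where "\<Lambda> = {(E, S). eventually (\<lambda>S. S \<in> E) F \<and> S \<in> E \<inter> good_set}"
  define pre where "pre =
    (\<lambda>(p :: ('a \<Rightarrow>\<^sub>L 'a) set \<times> ('a \<Rightarrow>\<^sub>L 'a)) (q :: ('a \<Rightarrow>\<^sub>L 'a) set \<times> ('a \<Rightarrow>\<^sub>L 'a)). fst q \<subseteq> fst p)"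
  have ne: "\<exists>S. (E, S) \<in> \<Lambda>" if "eventually (\<lambda>S. S \<in> E) F" for E
  proof -
    have "eventually (\<lambda>S. S \<in> E \<inter> good_set) F"
      using that good by eventually_elim (simp add: good_set_def)
    then obtain S where "S \<in> E \<inter> good_set" using eventually_happens'[OF F] by blast
    then show ?thesis using that by (auto simp: \<Lambda>_def)
  qed
  have "directed_set \<Lambda> pre"
    unfolding directed_set_def
  proof (intro conjI)
    show "\<Lambda> \<noteq> {}" using ne[of UNIV] by auto
    show "\<forall>a\<in>\<Lambda>. \<forall>b\<in>\<Lambda>. \<exists>c\<in>\<Lambda>. pre a c \<and> pre b c"
    proof (intro ballI)
      fix a b assume "a \<in> \<Lambda>" "b \<in> \<Lambda>"
      then have "eventually (\<lambda>S. S \<in> fst a \<inter> fst b) F"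
        by (auto simp: \<Lambda>_def eventually_conj)
      then obtain S where S: "(fst a \<inter> fst b, S) \<in> \<Lambda>" using ne by blast
      then show "\<exists>c\<in>\<Lambda>. pre a c \<and> pre b c" by (rule bexI[rotated]) (simp add: pre_def)
    qed
  qed (auto simp: pre_def)
  moreover have "\<exists>a\<in>\<Lambda>. \<forall>b\<in>\<Lambda>. pre a b \<longrightarrow> norm (blinfun_apply (snd b) x - x) < e"
    if "e > 0" for x e
  proof -
    define E where "E = {S. norm (blinfun_apply S x - x) < e}"
    have "eventually (\<lambda>S. S \<in> E) F"
      using conv[of x] that by (simp add: tendsto_iff dist_norm E_def)
    then obtain S where "(E, S) \<in> \<Lambda>" using ne by blast
    then show ?thesis
      by (rule bexI[rotated]) (auto simp: pre_def \<Lambda>_def E_def)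
  qed
  ultimately have "bounded_compact_approximation_net smul \<Lambda> pre snd"
    unfolding bounded_compact_approximation_net_def
    by (auto simp: \<Lambda>_def good_set_def)
  then show ?thesis by blast
qed


section \<open>Essentially maximal subspaces\<close>

text \<open>
  \<open>dim M0/M < \<infinity>\<close> for subspaces \<open>M \<subseteq> M0\<close>: the cosets of finitely many elements of \<open>M0\<close> span
  the quotient.
\<close>

definition finite_dim_quotient ::
    "('k::real_or_complex \<Rightarrow> 'a::banach \<Rightarrow> 'a) \<Rightarrow> 'a set \<Rightarrow> 'a set \<Rightarrow> bool"
  where "finite_dim_quotient smul M0 M \<longleftrightarrow>
    (\<exists>B. finite B \<and> B \<subseteq> M0 \<and> M0 \<subseteq> module.span smul (M \<union> B))"

text \<open>Subspaces are linear subspaces; they are not required to be closed.\<close>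

definition essentially_maximal_subspace ::
    "('k::real_or_complex \<Rightarrow> 'a::banach \<Rightarrow> 'a) \<Rightarrow> ('a set \<Rightarrow> bool) \<Rightarrow> 'a set \<Rightarrow> bool"
  where "essentially_maximal_subspace smul P M \<longleftrightarrow>
    module.subspace smul M \<and> P M \<and>
    (\<forall>M0. module.subspace smul M0 \<and> M \<subseteq> M0 \<and> P M0 \<longrightarrow> finite_dim_quotient smul M0 M)"


section \<open>The Calkin algebra is a ring\<close>

context banach_over
begin

lemma linear_iff:
  "Vector_Spaces.linear smul smul f \<longleftrightarrow>
     (\<forall>x y. f (x + y) = f x + f y) \<and> (\<forall>c x. f (smul c x) = smul c (f x))"
  by (auto simp: Vector_Spaces.linear_def module_hom_def module_hom_axioms_def
      vector_space_axioms module_axioms)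

lemma mem_bounded_operators_iff:
  "T \<in> carrier (bounded_operators smul) \<longleftrightarrow>
     (\<forall>c x. blinfun_apply T (smul c x) = smul c (blinfun_apply T x))"
  by (simp add: bounded_operators_def linear_iff blinfun.add_right)

lemma ring_bounded_operators: "ring (bounded_operators smul)"
proof (rule ringI)
  show "abelian_group (bounded_operators smul)"
  proof (rule abelian_groupI)
    fix T assume "T \<in> carrier (bounded_operators smul)"
    then have "- T \<in> carrier (bounded_operators smul)"
      by (simp add: mem_bounded_operators_iff blinfun.minus_left)
    then show "\<exists>y\<in>carrier (bounded_operators smul).
        y \<oplus>\<^bsub>bounded_operators smul\<^esub> T = \<zero>\<^bsub>bounded_operators smul\<^esub>"
      by (rule bexI[rotated]) (simp add: bounded_operators_def)
  qed (simp_all add: bounded_operators_def linear_iff blinfun.add_left scale_right_distrib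
      algebra_simps)
  show "Group.monoid (bounded_operators smul)"
    by (rule Group.monoidI)
      (simp_all add: bounded_operators_def linear_iff blinfun_eqI)
qed (auto simp: bounded_operators_def blinfun.add_left blinfun.add_right intro!: blinfun_eqI)

lemma ideal_compact_operators: "ideal (compact_operators smul) (bounded_operators smul)"
proof -
  interpret B: ring "bounded_operators smul" by (rule ring_bounded_operators)
  have car: "T \<in> carrier (bounded_operators smul)" if "T \<in> compact_operators smul" for T
    using that by (simp add: compact_operators_def)
  have cpt: "compact (closure (blinfun_apply T ` A))"
    if "T \<in> compact_operators smul" "bounded A" for T A
    using that by (simp add: compact_operators_def compact_on_def)
  have inv: "\<ominus>\<^bsub>bounded_operators smul\<^esub> T = - T"
    if "T \<in> carrier (bounded_operators smul)" for T
  proof (rule B.minus_equality)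
    show "- T \<in> carrier (bounded_operators smul)"
      using that by (simp add: mem_bounded_operators_iff blinfun.minus_left)
  qed (use that in \<open>simp_all add: bounded_operators_def\<close>)
  have sub: "compact (closure X)" if "compact Y" "X \<subseteq> Y" for X Y :: "'a set"
    using that by (metis closure_minimal compact_Int_closed compact_imp_closed closed_closure
        inf.absorb2)
  have comp: "compact_on (blinfun_apply (T o\<^sub>L S)) UNIV" "compact_on (blinfun_apply (S o\<^sub>L T)) UNIV"
    if "T \<in> compact_operators smul" for S T
  proof -
    show "compact_on (blinfun_apply (T o\<^sub>L S)) UNIV"
      unfolding compact_on_def
    proof (intro allI impI)
      fix A :: "'a set" assume "bounded A"
      then have "bounded (blinfun_apply S ` A)"
        by (rule bounded_linear_image) (rule blinfun.bounded_linear_right)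
      from cpt[OF that this] show "compact (closure (blinfun_apply (T o\<^sub>L S) ` A))"
        by (simp add: image_image)
    qed
    show "compact_on (blinfun_apply (S o\<^sub>L T)) UNIV"
      unfolding compact_on_def
    proof (intro allI impI)
      fix A :: "'a set" assume "bounded A"
      have "compact (blinfun_apply S ` closure (blinfun_apply T ` A))"
        using cpt[OF that \<open>bounded A\<close>]
        by (intro compact_continuous_image linear_continuous_on blinfun.bounded_linear_right)
      moreover have "blinfun_apply (S o\<^sub>L T) ` A \<subseteq> blinfun_apply S ` closure (blinfun_apply T ` A)"
        using closure_subset by fastforce
      ultimately show "compact (closure (blinfun_apply (S o\<^sub>L T) ` A))"
        by (rule sub)
    qed
  qed
  have add: "compact_on (blinfun_apply (S + T)) UNIV"
    if "S \<in> compact_operators smul" "T \<in> compact_operators smul" for S T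
    unfolding compact_on_def
  proof (intro allI impI)
    fix A :: "'a set" assume "bounded A"
    let ?Y = "{x + y | x y. x \<in> closure (blinfun_apply S ` A) \<and> y \<in> closure (blinfun_apply T ` A)}"
    have "compact ?Y"
      by (intro compact_sums cpt that \<open>bounded A\<close>)
    moreover have "blinfun_apply (S + T) ` A \<subseteq> ?Y"
      using closure_subset[of "blinfun_apply S ` A"] closure_subset[of "blinfun_apply T ` A"]
      by (auto simp: blinfun.add_left) blast
    ultimately show "compact (closure (blinfun_apply (S + T) ` A))"
      by (rule sub)
  qed
  have neg: "compact_on (blinfun_apply (- T)) UNIV" if "T \<in> compact_operators smul" for T
  proof -
    have "(- id_blinfun) o\<^sub>L T = - T"
      by (rule blinfun_eqI) (simp add: blinfun.minus_left)
    then show ?thesis using comp(2)[OF that, of "- id_blinfun"] by simp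
  qed
  have zero: "compact_on (blinfun_apply (0 :: 'a \<Rightarrow>\<^sub>L 'a)) UNIV"
    unfolding compact_on_def by (auto intro!: sub[of "{0}"])
  have ops: "S \<oplus>\<^bsub>bounded_operators smul\<^esub> T = S + T" "S \<otimes>\<^bsub>bounded_operators smul\<^esub> T = S o\<^sub>L T"
    "\<zero>\<^bsub>bounded_operators smul\<^esub> = 0" for S T :: "'a \<Rightarrow>\<^sub>L 'a"
    by (simp_all add: bounded_operators_def)
  show ?thesis
  proof (rule idealI[OF ring_bounded_operators])
    show "subgroup (compact_operators smul) (add_monoid (bounded_operators smul))"
    proof
      fix S T assume ST: "S \<in> compact_operators smul" "T \<in> compact_operators smul"
      show "S \<otimes>\<^bsub>add_monoid (bounded_operators smul)\<^esub> T \<in> compact_operators smul"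
        using B.a_closed[OF car car, OF ST] add[OF ST]
        by (simp add: compact_operators_def ops)
    next
      fix T assume T: "T \<in> compact_operators smul"
      show "inv\<^bsub>add_monoid (bounded_operators smul)\<^esub> T \<in> compact_operators smul"
        using B.a_inv_closed[OF car[OF T]] neg[OF T] inv[OF car[OF T]]
        by (simp add: compact_operators_def a_inv_def)
    qed (use B.zero_closed zero in \<open>auto simp: compact_operators_def ops\<close>)
  next
    fix T S assume TS: "T \<in> compact_operators smul" "S \<in> carrier (bounded_operators smul)"
    show "S \<otimes>\<^bsub>bounded_operators smul\<^esub> T \<in> compact_operators smul"
      using B.m_closed[OF TS(2) car[OF TS(1)]] comp(2)[OF TS(1), of S]
      by (simp add: compact_operators_def ops)
    show "T \<otimes>\<^bsub>bounded_operators smul\<^esub> S \<in> compact_operators smul"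
      using B.m_closed[OF car[OF TS(1)] TS(2)] comp(1)[OF TS(1), of S]
      by (simp add: compact_operators_def ops)
  qed
qed

lemma ring_calkin_algebra: "ring (calkin_algebra smul)"
  unfolding calkin_algebra_def by (rule ideal.quotient_is_ring[OF ideal_compact_operators])

end

end

theory Submission
  imports Defs "HOL-Library.Ramsey" "HOL-Real_Asymp.Real_Asymp"
begin

text \<open>
  Write \<open>D = I - T\<close>.  The essential norm is compared with the seminorm \<open>hnorm f\<close>, the Hausdorff measure
  of noncompactness of the image of the unit ball; the bounded compact approximation property makes
  the two equivalent.  As \<open>\<parallel>T\<^sup>n\<parallel>\<^sub>e / n \<rightarrow> 0\<close>, compactness of \<open>D\<^sup>m\<close> on a subspace implies compactness of \<open>D\<close>.

  If the means converge to \<open>L\<close> modulo compact operators, then \<open>U = I - L\<close> is idempotent modulo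
  compact operators, so apart from \<open>0\<close> and \<open>1\<close> its spectrum consists of eigenvalues that accumulate only
  there.  The spectral subspace \<open>M = {x. (U/r)\<^sup>n x \<rightarrow> 0}\<close> for a circle of radius \<open>r\<close> without eigenvalues
  is essentially maximal: \<open>U\<close> is compact on \<open>M\<close>, and \<open>dist(y, M) \<le> C \<parallel>U y\<parallel>\<close>.

  Conversely, let \<open>M\<close> be essentially maximal.  A gliding hump argument shows that some \<open>Y \<supseteq> M\<close> on which
  \<open>D\<^sup>m\<close> is compact controls \<open>D\<^sup>m\<close>: modulo precompact sequences, the distance to \<open>Y\<close> is bounded by a
  multiple of the norm of the image under \<open>D\<^sup>m\<close>.  As \<open>(k + 1) M\<^sub>k D = I - T\<^sup>k\<^sup>+\<^sup>1\<close>, this makes the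
  \<open>k\<close>-th mean \<open>M\<^sub>k\<close> small on the range of \<open>D\<close>, which contains the range of every \<open>I - M\<^sub>l\<close>; hence
  \<open>M\<^sub>k - M\<^sub>l = M\<^sub>k (I - M\<^sub>l) - M\<^sub>l (I - M\<^sub>k)\<close> is small and the means form a Cauchy sequence.
\<close>

section \<open>Finite coverings and precompact sets\<close>

text \<open>The subspaces are in general neither closed nor complemented, so an operator can be
  neither compressed to them nor passed to a quotient Banach space. Finite coverings of images of
  bounded sets survive restriction to subsets and cutting into finitely many pieces; hence every
  estimate is phrased through them. The approximation property turns means that are Cauchy for
  \<open>hnorm\<close> into means that are Cauchy for the essential norm, and completeness of the
  Calkin algebra supplies the limit. The spectral theory stays over the reals: a conjugate pair of
  spectral points becomes a real quadratic in the operator, and a contour integral becomes a finite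
  average over roots of unity. Any circle separating 0 from 1 would serve; radii in [1/4, 1/2] give
  explicit constants. In the converse, maximality only yields a dimension count, so the estimate has
  to come by contradiction from an infinite chain of extensions. An arbitrary adjoined vector could
  keep compactness at each stage and lose it on the union; the adjoined vectors must be almost
  harmless both to norms and to images.\<close>

definition covered :: "real \<Rightarrow> 'a::metric_space set \<Rightarrow> bool"
  where "covered e A \<longleftrightarrow> (\<exists>F. finite F \<and> A \<subseteq> (\<Union>x\<in>F. cball x e))"

definition precompact :: "'a::metric_space set \<Rightarrow> bool"
  where "precompact A \<longleftrightarrow> (\<forall>e>0. covered e A)"

lemma coveredE:
  assumes "covered e A"
  obtains F where "finite F" "\<And>a. a \<in> A \<Longrightarrow> \<exists>x\<in>F. dist x a \<le> e"
  using assms unfolding covered_def by fastforce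

lemma coveredI:
  assumes "finite F" "\<And>a. a \<in> A \<Longrightarrow> \<exists>x\<in>F. dist x a \<le> e"
  shows "covered e A"
proof -
  have "A \<subseteq> (\<Union>x\<in>F. cball x e)" using assms(2) by auto
  then show ?thesis using assms(1) unfolding covered_def by blast
qed

lemma covered_mono:
  assumes "covered d A" "d \<le> e" "B \<subseteq> A"
  shows "covered e B"
proof -
  obtain F where F: "finite F" "\<And>a. a \<in> A \<Longrightarrow> \<exists>x\<in>F. dist x a \<le> d"
    by (rule coveredE[OF assms(1)]) blast
  show ?thesis
  proof (rule coveredI[OF F(1)])
    fix a assume "a \<in> B"
    then obtain x where "x \<in> F" "dist x a \<le> d" using F(2) assms(3) by blast
    then show "\<exists>x\<in>F. dist x a \<le> e" using assms(2) order_trans by blast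
  qed
qed

lemma covered_pieces:
  assumes "finite I" "\<And>i. i \<in> I \<Longrightarrow> covered e (B i)" "A \<subseteq> (\<Union>i\<in>I. B i)"
  shows "covered e A"
proof -
  from assms(2) obtain F where F: "\<And>i. i \<in> I \<Longrightarrow> finite (F i) \<and> B i \<subseteq> (\<Union>x\<in>F i. cball x e)"
    unfolding covered_def by metis
  then have "A \<subseteq> (\<Union>x\<in>(\<Union>i\<in>I. F i). cball x e)" using assms(3) by fastforce
  moreover have "finite (\<Union>i\<in>I. F i)" using F assms(1) by blast
  ultimately show ?thesis unfolding covered_def by (intro exI conjI)
qed

lemma covered_near:
  assumes "covered d A" "\<And>b. b \<in> B \<Longrightarrow> \<exists>a\<in>A. dist a b \<le> e"
  shows "covered (d + e) B"
proof -
  from assms(1) obtain F where F: "finite F" "\<And>a. a \<in> A \<Longrightarrow> \<exists>x\<in>F. dist x a \<le> d"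
    by (rule coveredE) blast
  show ?thesis
  proof (rule coveredI[OF F(1)])
    fix b assume "b \<in> B"
    then obtain a where a: "a \<in> A" "dist a b \<le> e" using assms(2) by blast
    then obtain x where "x \<in> F" "dist x a \<le> d" using F(2) by blast
    then show "\<exists>x\<in>F. dist x b \<le> d + e"
      using a(2) dist_triangle[of x b a] by (intro bexI[of _ x]) auto
  qed
qed

lemma covered_sum:
  fixes A B C :: "'a::real_normed_vector set"
  assumes "covered d A" "covered e B" "\<And>c. c \<in> C \<Longrightarrow> \<exists>a\<in>A. \<exists>b\<in>B. c = a + b"
  shows "covered (d + e) C"
proof -
  obtain F where F: "finite F" "\<And>a. a \<in> A \<Longrightarrow> \<exists>x\<in>F. dist x a \<le> d"
    by (rule coveredE[OF assms(1)]) blast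
  obtain G where G: "finite G" "\<And>a. a \<in> B \<Longrightarrow> \<exists>x\<in>G. dist x a \<le> e"
    by (rule coveredE[OF assms(2)]) blast
  show ?thesis
  proof (rule coveredI[of "(\<lambda>(x, y). x + y) ` (F \<times> G)"])
    fix c assume "c \<in> C"
    then obtain a b where ab: "a \<in> A" "b \<in> B" "c = a + b" using assms(3) by blast
    obtain x y where xy: "x \<in> F" "dist x a \<le> d" "y \<in> G" "dist y b \<le> e"
      using F(2) G(2) ab by meson
    have "dist (x + y) (a + b) \<le> d + e" using dist_triangle_add[of x y a b] xy by linarith
    then show "\<exists>z\<in>(\<lambda>(x, y). x + y) ` (F \<times> G). dist z c \<le> d + e" using xy ab by force
  qed (use F G in simp)
qed

lemma covered_image:
  assumes "covered e A" "\<And>x y. dist (f x) (f y) \<le> c * dist x y" "0 \<le> c"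
  shows "covered (c * e) (f ` A)"
proof -
  obtain F where F: "finite F" "\<And>a. a \<in> A \<Longrightarrow> \<exists>x\<in>F. dist x a \<le> e"
    by (rule coveredE[OF assms(1)]) blast
  show ?thesis
  proof (rule coveredI[of "f ` F"])
    fix b assume "b \<in> f ` A"
    then obtain a where a: "a \<in> A" "b = f a" by blast
    then obtain x where x: "x \<in> F" "dist x a \<le> e" using F(2) by blast
    have "dist (f x) b \<le> c * e"
      using order_trans[OF assms(2)[of x a] mult_left_mono[OF x(2) assms(3)]] a(2) by simp
    then show "\<exists>y\<in>f ` F. dist y b \<le> c * e" using x by blast
  qed (use F in simp)
qed

lemma covered_cball: "A \<subseteq> cball x e \<Longrightarrow> covered e A"
  by (rule coveredI[of "{x}"]) auto

lemma precompactD: "precompact A \<Longrightarrow> 0 < e \<Longrightarrow> covered e A"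
  by (simp add: precompact_def)

lemma precompact_subset: "precompact A \<Longrightarrow> B \<subseteq> A \<Longrightarrow> precompact B"
  unfolding precompact_def using covered_mono by blast

lemma precompact_finite: "finite A \<Longrightarrow> precompact A"
  unfolding precompact_def by (intro allI impI coveredI[of A]) (auto intro!: bexI)

lemma precompact_near:
  assumes "\<And>e. e > 0 \<Longrightarrow> \<exists>A. covered e A \<and> (\<forall>b\<in>B. \<exists>a\<in>A. dist a b \<le> e)"
  shows "precompact B"
  unfolding precompact_def
proof (intro allI impI)
  fix e :: real assume "e > 0"
  then obtain A where "covered (e/2) A" "\<forall>b\<in>B. \<exists>a\<in>A. dist a b \<le> e/2"
    using assms[of "e/2"] by auto
  then have "covered (e/2 + e/2) B" by (intro covered_near[of "e/2" A]) auto
  then show "covered e B" by simp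
qed

lemma precompact_pieces:
  assumes "finite I" "\<And>i. i \<in> I \<Longrightarrow> precompact (B i)" "A \<subseteq> (\<Union>i\<in>I. B i)"
  shows "precompact A"
  unfolding precompact_def
proof (intro allI impI)
  fix e :: real assume "e > 0"
  then show "covered e A"
    using assms covered_pieces[of I e B A] by (auto simp: precompact_def)
qed

lemma precompact_sum:
  fixes A B C :: "'a::real_normed_vector set"
  assumes "precompact A" "precompact B" "\<And>c. c \<in> C \<Longrightarrow> \<exists>a\<in>A. \<exists>b\<in>B. c = a + b"
  shows "precompact C"
  unfolding precompact_def
proof (intro allI impI)
  fix e :: real assume "e > 0"
  then have "covered (e/2 + e/2) C"
    by (intro covered_sum[OF _ _ assms(3)] precompactD assms) auto
  then show "covered e C" by simp
qed

lemma precompact_image_add: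
  fixes f g :: "'b \<Rightarrow> 'a::real_normed_vector"
  assumes "precompact (f ` B)" "precompact (g ` B)"
  shows "precompact ((\<lambda>x. f x + g x) ` B)"
proof (rule precompact_sum[OF assms])
  fix c assume "c \<in> (\<lambda>x. f x + g x) ` B"
  then obtain x where "x \<in> B" "c = f x + g x" by blast
  then show "\<exists>a\<in>f ` B. \<exists>b\<in>g ` B. c = a + b" by (intro bexI[of _ "f x"] bexI[of _ "g x"]) auto
qed

lemma precompact_image:
  assumes "precompact A" "bounded_linear f"
  shows "precompact (f ` A)"
  unfolding precompact_def
proof (intro allI impI)
  fix e :: real assume e: "e > 0"
  interpret f: bounded_linear f by fact
  obtain K where K: "K > 0" "\<And>x. norm (f x) \<le> norm x * K" using f.pos_bounded by blast
  have "covered (K * (e / K)) (f ` A)"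
    by (rule covered_image)
      (use K e assms in \<open>auto simp: dist_norm f.diff[symmetric] mult.commute intro: precompactD\<close>)
  then show "covered e (f ` A)" using K by simp
qed

lemma covered_closure: "covered e A \<Longrightarrow> covered e (closure A)"
proof -
  assume "covered e A"
  then obtain F where F: "finite F" "A \<subseteq> (\<Union>x\<in>F. cball x e)" unfolding covered_def by blast
  then have "closure A \<subseteq> (\<Union>x\<in>F. cball x e)" by (intro closure_minimal) auto
  then show ?thesis using F(1) unfolding covered_def by blast
qed

text \<open>Each useful center is replaced by a point of \<open>A\<close> in its ball, which doubles
  the radius. Centers inside \<open>A\<close> matter where they must themselves be images of vectors
  of the unit ball.\<close>

lemma covered_subset_centers:
  assumes "covered e A"
  obtains F where "finite F" "F \<subseteq> A" "\<And>a. a \<in> A \<Longrightarrow> \<exists>x\<in>F. dist x a \<le> 2 * e"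
proof -
  obtain G where G: "finite G" "\<And>a. a \<in> A \<Longrightarrow> \<exists>x\<in>G. dist x a \<le> e"
    by (rule coveredE[OF assms]) blast
  define p where "p x = (SOME a. a \<in> A \<and> dist x a \<le> e)" for x
  define H where "H = {x\<in>G. \<exists>a\<in>A. dist x a \<le> e}"
  have p: "p x \<in> A \<and> dist x (p x) \<le> e" if "x \<in> H" for x
    unfolding p_def by (rule someI_ex) (use that in \<open>auto simp: H_def\<close>)
  show ?thesis
  proof (rule that[of "p ` H"])
    fix a assume a: "a \<in> A"
    then obtain x where x: "x \<in> G" "dist x a \<le> e" using G by blast
    then have "x \<in> H" using a by (auto simp: H_def)
    then have "dist (p x) a \<le> 2 * e"
      using p[of x] x dist_triangle3[of "p x" a x] by (auto simp: dist_commute)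
    then show "\<exists>x\<in>p ` H. dist x a \<le> 2 * e" using \<open>x \<in> H\<close> by blast
  qed (use G p in \<open>auto simp: H_def\<close>)
qed

lemma precompact_iff:
  fixes A :: "'a::complete_space set"
  shows "precompact A \<longleftrightarrow> compact (closure A)"
proof
  assume A: "precompact A"
  show "compact (closure A)"
    unfolding compact_eq_totally_bounded
  proof (intro conjI allI impI)
    show "complete (closure A)" by (simp add: complete_eq_closed)
    fix e :: real assume e: "e > 0"
    have "covered (e/2) (closure A)" by (intro covered_closure precompactD[OF A]) (use e in simp)
    then obtain F where F: "finite F" "closure A \<subseteq> (\<Union>x\<in>F. cball x (e/2))"
      unfolding covered_def by blast
    have "(\<Union>x\<in>F. cball x (e/2)) \<subseteq> (\<Union>x\<in>F. ball x e)" using e by force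
    then have "closure A \<subseteq> (\<Union>x\<in>F. ball x e)" using F(2) by (rule order_trans[rotated])
    then show "\<exists>k. finite k \<and> closure A \<subseteq> (\<Union>x\<in>k. ball x e)" using F(1) by blast
  qed
next
  assume "compact (closure A)"
  then have *: "\<exists>k. finite k \<and> closure A \<subseteq> (\<Union>x\<in>k. ball x e)" if "e > 0" for e
    using that unfolding compact_eq_totally_bounded by blast
  show "precompact A"
    unfolding precompact_def
  proof (intro allI impI)
    fix e :: real assume "e > 0"
    then obtain k where "finite k" "closure A \<subseteq> (\<Union>x\<in>k. ball x e)" using * by blast
    then have k: "finite k" "A \<subseteq> (\<Union>x\<in>k. ball x e)" using closure_subset[of A] by blast+
    then have "A \<subseteq> (\<Union>x\<in>k. cball x e)" using ball_subset_cball by blast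
    then show "covered e A" using k(1) unfolding covered_def by blast
  qed
qed

lemma precompact_subseq:
  fixes s :: "nat \<Rightarrow> 'a::complete_space"
  assumes "precompact (range s)"
  obtains l r where "strict_mono (r :: nat \<Rightarrow> nat)" "(s \<circ> r) \<longlonglongrightarrow> l"
proof -
  have "seq_compact (closure (range s))"
    using assms by (simp add: precompact_iff compact_eq_seq_compact_metric)
  moreover have "s n \<in> closure (range s)" for n using closure_subset[of "range s"] by auto
  ultimately obtain l r where "strict_mono (r :: nat \<Rightarrow> nat)" "(s \<circ> r) \<longlonglongrightarrow> l"
    unfolding seq_compact_def by meson
  then show ?thesis by (intro that)
qed

lemma not_precompact_if_separated:
  fixes s :: "nat \<Rightarrow> 'a::metric_space"
  assumes "d > 0" "\<And>i j. i < j \<Longrightarrow> d \<le> dist (s i) (s j)"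
  shows "\<not> precompact (range s)"
proof
  assume "precompact (range s)"
  \<comment> \<open>Two terms sharing a center are at distance at most \<open>2 * d / 3\<close>,
    below the separation \<open>d\<close>.\<close>
  then have "covered (d/3) (range s)" using assms(1) by (auto intro: precompactD)
  then obtain F where F: "finite F" "\<And>a. a \<in> range s \<Longrightarrow> \<exists>x\<in>F. dist x a \<le> d/3"
    by (rule coveredE) blast
  then have "\<forall>i. \<exists>x. x \<in> F \<and> dist x (s i) \<le> d/3" by blast
  then obtain c where c: "\<And>i. c i \<in> F \<and> dist (c i) (s i) \<le> d/3" by metis
  then have "\<not> inj c" using finite_imageD[of c UNIV] finite_subset[of "range c" F] F(1) by auto
  then obtain i j where ij: "i \<noteq> j" "c i = c j" by (auto simp: inj_on_def)
  have "dist (s i) (s j) \<le> d/3 + d/3"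
    using c[of i] c[of j] ij(2) dist_triangle3[of "s i" "s j" "c i"] by auto
  moreover have "d \<le> dist (s i) (s j)"
    using assms(2)[of i j] assms(2)[of j i] ij(1) by (cases "i < j") (auto simp: dist_commute)
  ultimately show False using assms(1) by simp
qed

lemma compact_on_iff:
  fixes f :: "'a::real_normed_vector \<Rightarrow> 'b::banach"
  shows "compact_on f M \<longleftrightarrow> (\<forall>B\<subseteq>M. bounded B \<longrightarrow> precompact (f ` B))"
  by (simp add: compact_on_def precompact_iff)

lemma compact_onD:
  fixes f :: "'a::real_normed_vector \<Rightarrow> 'b::banach"
  shows "compact_on f M \<Longrightarrow> B \<subseteq> M \<Longrightarrow> bounded B \<Longrightarrow> precompact (f ` B)"
  by (simp add: compact_on_iff)

section \<open>Spectral splitting of an almost idempotent operator\<close>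

lemma riesz_vector:
  fixes L L' :: "'a::real_normed_vector set"
  assumes "subspace L" "closed L" "subspace L'" "L \<subseteq> L'" "x \<in> L'" "x \<notin> L"
  obtains y where "y \<in> L'" "norm y = 1" "\<And>l. l \<in> L \<Longrightarrow> 1/2 \<le> norm (y - l)"
proof -
  have ne: "L \<noteq> {}" using subspace_0[OF assms(1)] by blast
  define d where "d = infdist x L"
  have d: "d > 0" using in_closed_iff_infdist_zero[OF assms(2) ne, of x] assms(6) infdist_nonneg[of x L]
    by (auto simp: d_def)
  \<comment> \<open>After division by a norm below \<open>2 * d\<close>, every distance of at least
    \<open>d\<close> becomes at least 1/2.\<close>
  have "\<exists>l\<in>L. dist x l < 2 * d"
  proof (rule ccontr)
    assume "\<not> ?thesis"
    then have "2 * d \<le> infdist x L" using ne by (auto simp: infdist_notempty not_less intro!: cINF_greatest)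
    then show False using d by (simp add: d_def)
  qed
  then obtain l0 where l0: "l0 \<in> L" "norm (x - l0) < 2 * d" by (auto simp: dist_norm)
  define n where "n = norm (x - l0)"
  have n: "n > 0" using l0(1) assms(6) by (auto simp: n_def)
  show ?thesis
  proof (rule that[of "(1/n) *\<^sub>R (x - l0)"])
    show "(1/n) *\<^sub>R (x - l0) \<in> L'" using assms l0 by (intro subspace_scale subspace_diff) auto
    show "norm ((1/n) *\<^sub>R (x - l0)) = 1" using n by (simp add: n_def)
    fix l assume l: "l \<in> L"
    have "l0 + n *\<^sub>R l \<in> L" using assms(1) l l0(1) by (intro subspace_add subspace_scale)
    then have "d \<le> norm (x - (l0 + n *\<^sub>R l))" unfolding d_def dist_norm[symmetric] by (rule infdist_le)
    also have "x - (l0 + n *\<^sub>R l) = n *\<^sub>R ((1/n) *\<^sub>R (x - l0) - l)"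
      using n by (simp add: scaleR_right_diff_distrib)
    also have "norm \<dots> = n * norm ((1/n) *\<^sub>R (x - l0) - l)" using n by simp
    finally have "n * (1/2) \<le> n * norm ((1/n) *\<^sub>R (x - l0) - l)"
      using l0(2) by (simp add: n_def)
    then show "1/2 \<le> norm ((1/n) *\<^sub>R (x - l0) - l)" using n by (simp only: mult_le_cancel_left_pos)
  qed
qed

lemma closed_range_if_bounded_below:
  fixes f :: "'b::banach \<Rightarrow> 'c::banach"
  assumes "bounded_linear f" "C > 0" "\<And>x. norm x \<le> C * norm (f x)"
  shows "closed (range f)"
proof -
  have "complete (f ` UNIV)"
  proof (rule complete_isometric_image[of "1 / C"])
    show "\<forall>x\<in>UNIV. 1 / C * norm x \<le> norm (f x)"
      using assms(2,3) by (simp add: divide_le_eq mult.commute)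
  qed (use assms in \<open>auto simp: complete_UNIV\<close>)
  then show ?thesis by (simp add: complete_eq_closed)
qed

text \<open>For \<lambda> of modulus \<open>r\<close> with real part \<open>a\<close>, the two
  quantities are the squared modulus and the absolute real part of \<mu> = \<lambda> (1 -
  \<lambda>). The radius bounds keep \<lambda> at least 1/4 from 0 and 1/2 from 1, whence
  1/64.\<close>

lemma defect_coeff_bound:
  fixes a r :: real
  assumes "\<bar>a\<bar> \<le> r" "1/4 \<le> r" "r \<le> 1/2"
  shows "1/64 \<le> r\<^sup>2 * (1 - 2 * a + r\<^sup>2)" "\<bar>a - 2 * a\<^sup>2 + r\<^sup>2\<bar> \<le> 2"
proof -
  have "(1/4)\<^sup>2 \<le> r\<^sup>2" using assms by (intro power_mono) auto
  moreover have "(1/2)\<^sup>2 \<le> (1 - r)\<^sup>2" using assms by (intro power_mono) auto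
  then have "(1/2)\<^sup>2 \<le> 1 - 2 * a + r\<^sup>2" using assms(1) by (simp add: power2_eq_square algebra_simps)
  ultimately have "(1/4)\<^sup>2 * (1/2)\<^sup>2 \<le> r\<^sup>2 * (1 - 2 * a + r\<^sup>2)"
    by (intro mult_mono) auto
  then show "1/64 \<le> r\<^sup>2 * (1 - 2 * a + r\<^sup>2)" by (simp add: power2_eq_square)
  have "a\<^sup>2 \<le> r\<^sup>2" using assms(1) abs_le_square_iff[of a r] by simp
  moreover have "r\<^sup>2 \<le> (1/2)\<^sup>2" using assms by (intro power_mono) auto
  ultimately have "a\<^sup>2 \<le> 1/4" "r\<^sup>2 \<le> 1/4" "0 \<le> a\<^sup>2" "0 \<le> r\<^sup>2" by (auto simp: power2_eq_square)
  then show "\<bar>a - 2 * a\<^sup>2 + r\<^sup>2\<bar> \<le> 2" using assms unfolding abs_le_iff by linarith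
qed

text \<open>The cosines are the real parts of a geometric progression of \<open>N\<close>-th roots
  of unity; \<open>|m| < N\<close> keeps its ratio from being 1.\<close>

lemma sum_cos_roots:
  fixes m :: int
  assumes "m \<noteq> 0" "\<bar>m\<bar> < int N"
  shows "(\<Sum>j<N. cos (of_int m * (2 * pi * real j / real N))) = 0"
proof -
  have N: "N > 0" using assms by auto
  define z where "z = cis (2 * pi * of_int m / real N)"
  have "z \<noteq> 1"
  proof
    assume "z = 1"
    then have "cos (2 * pi * of_int m / real N) = 1" by (metis z_def cis.sel(1) one_complex.sel(1))
    then obtain i :: int where "2 * pi * of_int m / real N = of_int i * 2 * pi"
      by (auto simp: cos_one_2pi_int)
    then have "real_of_int m = of_int (i * int N)" using N by (simp add: field_simps)
    then have "m = i * int N" by (simp only: of_int_eq_iff)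
    with assms show False by (cases "i = 0") (auto simp: abs_mult)
  qed
  moreover have "z ^ N = 1"
  proof -
    have "z ^ N = cis (2 * pi * of_int m)" unfolding z_def Complex.DeMoivre using N by simp
    then show ?thesis by (simp add: cis_multiple_2pi)
  qed
  ultimately have "(\<Sum>j<N. z ^ j) = 0" by (simp add: sum_gp_strict)
  moreover have "Re (z ^ j) = cos (of_int m * (2 * pi * real j / real N))" for j
    unfolding z_def Complex.DeMoivre by (simp add: algebra_simps)
  ultimately show ?thesis by (metis (mono_tags, lifting) Re_sum sum.cong zero_complex.sel(1))
qed

lemma bounded_linear_funpow:
  assumes "bounded_linear (f :: 'a::real_normed_vector \<Rightarrow> 'a)"
  shows "bounded_linear (f ^^ n)"
proof (induction n)
  case 0
  show ?case using bounded_linear_ident by (simp add: id_def)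
next
  case (Suc n)
  then show ?case using bounded_linear_compose[OF assms, of "f ^^ n"] by (simp add: comp_def)
qed

text \<open>
  Averages over the \<open>N\<close>-th roots of unity express \<open>v ^ p * (1 - v ^ N) ^ -1\<close> through the inverses of
  \<open>1 - \<omega> v\<close>; real and imaginary parts are separated so that no complexification is needed.
\<close>

lemma power_bound_if_no_circle_spectrum:
  fixes v :: "'a::real_normed_vector \<Rightarrow> 'a"
  assumes "bounded_linear v" "C > 0"
    and below: "\<And>t x. norm x \<le> C * norm (x - (2 * cos t) *\<^sub>R v x + v (v x))"
  obtains D where "D > 0" "\<And>N p x. p < N \<Longrightarrow> norm ((v ^^ p) x) \<le> D * norm (x - (v ^^ N) x)"
proof -
  interpret v: bounded_linear v by fact
  obtain V where V: "V > 0" "\<And>x. norm (v x) \<le> norm x * V" using v.pos_bounded by blast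
  define D where "D = C * (1 + 2 * V)"
  have "norm ((v ^^ p) x) \<le> D * norm (x - (v ^^ N) x)" if p: "p < N" for N p x
  proof -
    define y where "y = x - (v ^^ N) x"
    \<comment> \<open>\<open>A t n + i B t n\<close> stands for the sum of
      \<open>(exp(it) v)^k x\<close> over \<open>k < n\<close>. The two recurrences below are the
      real and imaginary parts of multiplying it by \<open>1 - exp(it) v\<close>.\<close>
    define A where "A t n = (\<Sum>k<n. cos (real k * t) *\<^sub>R (v ^^ k) x)" for t :: real and n
    define B where "B t n = (\<Sum>k<n. sin (real k * t) *\<^sub>R (v ^^ k) x)" for t :: real and n
    have AS: "A t (Suc n) = A t n + cos (real n * t) *\<^sub>R (v ^^ n) x"
      and BS: "B t (Suc n) = B t n + sin (real n * t) *\<^sub>R (v ^^ n) x" for t n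
      by (simp_all add: A_def B_def)
    have A: "A t n - cos t *\<^sub>R v (A t n) + sin t *\<^sub>R v (B t n) = x - cos (real n * t) *\<^sub>R (v ^^ n) x" for t n
    proof (induction n)
      case 0
      show ?case by (simp add: A_def B_def v.zero)
    next
      case (Suc n)
      have cosS: "cos (real (Suc n) * t) = cos t * cos (real n * t) - sin t * sin (real n * t)"
        by (simp add: distrib_right cos_add)
      have "A t (Suc n) - cos t *\<^sub>R v (A t (Suc n)) + sin t *\<^sub>R v (B t (Suc n))
          = (A t n - cos t *\<^sub>R v (A t n) + sin t *\<^sub>R v (B t n)) + cos (real n * t) *\<^sub>R (v ^^ n) x
            - cos (real (Suc n) * t) *\<^sub>R (v ^^ Suc n) x"
        unfolding AS BS cosS by (simp add: v.add v.scaleR algebra_simps)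
      then show ?case unfolding Suc by simp
    qed
    have B: "B t n - sin t *\<^sub>R v (A t n) - cos t *\<^sub>R v (B t n) = - sin (real n * t) *\<^sub>R (v ^^ n) x" for t n
    proof (induction n)
      case 0
      show ?case by (simp add: A_def B_def v.zero)
    next
      case (Suc n)
      have "sin (real (Suc n) * t) = sin t * cos (real n * t) + cos t * sin (real n * t)"
        by (simp add: distrib_right sin_add)
      then have "B t (Suc n) - sin t *\<^sub>R v (A t (Suc n)) - cos t *\<^sub>R v (B t (Suc n))
          = (B t n - sin t *\<^sub>R v (A t n) - cos t *\<^sub>R v (B t n)) + sin (real n * t) *\<^sub>R (v ^^ n) x
            - sin (real (Suc n) * t) *\<^sub>R (v ^^ Suc n) x"
        unfolding AS BS by (simp add: v.add v.scaleR algebra_simps)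
      then show ?case unfolding Suc by simp
    qed
    have AB: "norm (A t N) + norm (B t N) \<le> D * norm y" if t: "cos (real N * t) = 1" "sin (real N * t) = 0" for t
    proof -
      define a b c s where "a = A t N" "b = B t N" "c = cos t" "s = sin t"
      note abcs = this
      have 1: "a - c *\<^sub>R v a + s *\<^sub>R v b = y" and 2: "b - s *\<^sub>R v a - c *\<^sub>R v b = 0"
        using A[of t N] B[of t N] t by (simp_all add: abcs y_def)
      have cs: "c * c + s * s = 1" by (simp add: abcs flip: power2_eq_square)
      have vv: "v (v z) = (c * c) *\<^sub>R v (v z) + (s * s) *\<^sub>R v (v z)" for z
        unfolding scaleR_add_left[symmetric] cs by simp
      have b: "b = s *\<^sub>R v a + c *\<^sub>R v b" and a: "a = y + c *\<^sub>R v a - s *\<^sub>R v b"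
        using 1 2 by (simp_all add: algebra_simps)
      have vb: "v b = s *\<^sub>R v (v a) + c *\<^sub>R v (v b)" using arg_cong[OF b, of v] by (simp add: v.add v.scaleR)
      have va: "v a = v y + c *\<^sub>R v (v a) - s *\<^sub>R v (v b)"
        using arg_cong[OF a, of v] by (simp add: v.add v.diff v.scaleR)
      have two: "(2 * c) *\<^sub>R z = c *\<^sub>R z + c *\<^sub>R z" for z :: 'a
        by (simp add: scaleR_add_left[symmetric])
      \<comment> \<open>Multiplying \<open>(1 - exp(it) v) (a + ib) = y\<close> by
        \<open>1 - exp(-it) v\<close> produces the real operator \<open>1 - 2 cos t v + v^2\<close>,
        to which the lower bound applies. This is the real part; the imaginary part follows
        below.\<close>
      have "a - (2 * c) *\<^sub>R v a + v (v a) = y - c *\<^sub>R v y"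
      proof -
        have "a - (2 * c) *\<^sub>R v a + v (v a) = (a - c *\<^sub>R v a) - c *\<^sub>R v a + v (v a)"
          unfolding two by simp
        also have "a - c *\<^sub>R v a = y - s *\<^sub>R v b" using 1 by (simp add: algebra_simps)
        finally have *: "a - (2 * c) *\<^sub>R v a + v (v a) = y - s *\<^sub>R v b - c *\<^sub>R v a + v (v a)" .
        have svb: "s *\<^sub>R v b = (s * s) *\<^sub>R v (v a) + (s * c) *\<^sub>R v (v b)"
          using arg_cong[OF vb, of "scaleR s"] by (simp add: scaleR_add_right)
        have cva: "c *\<^sub>R v a = c *\<^sub>R v y + (c * c) *\<^sub>R v (v a) - (s * c) *\<^sub>R v (v b)"
          using arg_cong[OF va, of "scaleR c"] by (simp add: scaleR_add_right scaleR_diff_right mult.commute)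
        show ?thesis using vv[of a] unfolding * svb cva by (simp add: algebra_simps)
      qed
      then have "norm a \<le> C * norm (y - c *\<^sub>R v y)" using below[of a t] by (simp add: abcs)
      also have "\<dots> \<le> C * (norm y + norm y * V)"
      proof -
        have "norm (c *\<^sub>R v y) \<le> 1 * norm (v y)"
          unfolding norm_scaleR by (intro mult_right_mono) (auto simp: abcs)
        then show ?thesis
          using norm_triangle_ineq4[of y "c *\<^sub>R v y"] V(2)[of y] assms(2) by (intro mult_left_mono) auto
      qed
      finally have na: "norm a \<le> C * (norm y + norm y * V)" .
      have "b - (2 * c) *\<^sub>R v b + v (v b) = s *\<^sub>R v y"
      proof -
        have "b - (2 * c) *\<^sub>R v b + v (v b) = (b - c *\<^sub>R v b) - c *\<^sub>R v b + v (v b)"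
          unfolding two by simp
        also have "b - c *\<^sub>R v b = s *\<^sub>R v a" using 2 by (simp add: algebra_simps)
        finally have *: "b - (2 * c) *\<^sub>R v b + v (v b) = s *\<^sub>R v a - c *\<^sub>R v b + v (v b)" .
        have sva: "s *\<^sub>R v a = s *\<^sub>R v y + (s * c) *\<^sub>R v (v a) - (s * s) *\<^sub>R v (v b)"
          using arg_cong[OF va, of "scaleR s"] by (simp add: scaleR_add_right scaleR_diff_right)
        have cvb: "c *\<^sub>R v b = (s * c) *\<^sub>R v (v a) + (c * c) *\<^sub>R v (v b)"
          using arg_cong[OF vb, of "scaleR c"] by (simp add: scaleR_add_right mult.commute)
        show ?thesis using vv[of b] unfolding * sva cvb by (simp add: algebra_simps)
      qed
      then have "norm b \<le> C * norm (s *\<^sub>R v y)" using below[of b t] by (simp add: abcs)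
      also have "\<dots> \<le> C * (norm y * V)"
      proof -
        have "norm (s *\<^sub>R v y) \<le> 1 * norm (v y)"
          unfolding norm_scaleR by (intro mult_right_mono) (auto simp: abcs)
        then show ?thesis using V(2)[of y] assms(2) by (intro mult_left_mono) auto
      qed
      finally show ?thesis using na by (simp add: D_def abcs algebra_simps)
    qed
    define t where "t j = 2 * pi * real j / real N" for j :: nat
    have N: "real N > 0" using p by simp
    have tN: "cos (real N * t j) = 1" "sin (real N * t j) = 0" for j
    proof -
      have "real N * t j = 2 * pi * real j" using N by (simp add: t_def)
      then show "cos (real N * t j) = 1" "sin (real N * t j) = 0"
        using cos_int_2pin[of "int j"] sin_int_2pin[of "int j"] by simp_all
    qed
    \<comment> \<open>Discrete Fourier inversion: averaging against \<open>exp(-ip t)\<close> over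
      the angles \<open>t j\<close> keeps only the term \<open>k = p\<close>. Each summand is
      bounded by \<open>D * norm y\<close>, so \<open>D\<close> depends neither on \<open>N\<close>
      nor on \<open>p\<close>.\<close>
    have "(\<Sum>j<N. cos (real p * t j) *\<^sub>R A (t j) N + sin (real p * t j) *\<^sub>R B (t j) N)
        = (\<Sum>j<N. \<Sum>k<N. cos (of_int (int k - int p) * t j) *\<^sub>R (v ^^ k) x)"
    proof (intro sum.cong refl)
      fix j
      have "cos (of_int (int k - int p) * t j)
          = cos (real p * t j) * cos (real k * t j) + sin (real p * t j) * sin (real k * t j)" for k
        by (simp add: left_diff_distrib cos_diff)
      then show "cos (real p * t j) *\<^sub>R A (t j) N + sin (real p * t j) *\<^sub>R B (t j) N
          = (\<Sum>k<N. cos (of_int (int k - int p) * t j) *\<^sub>R (v ^^ k) x)"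
        by (simp add: A_def B_def scaleR_sum_right sum.distrib scaleR_add_left)
    qed
    also have "\<dots> = (\<Sum>k<N. (\<Sum>j<N. cos (of_int (int k - int p) * t j)) *\<^sub>R (v ^^ k) x)"
      by (subst sum.swap) (simp add: scaleR_sum_left)
    also have "\<dots> = (\<Sum>k<N. if k = p then real N *\<^sub>R (v ^^ p) x else 0)"
    proof (intro sum.cong refl)
      fix k assume k: "k \<in> {..<N}"
      show "(\<Sum>j<N. cos (of_int (int k - int p) * t j)) *\<^sub>R (v ^^ k) x
          = (if k = p then real N *\<^sub>R (v ^^ p) x else 0)"
      proof (cases "k = p")
        case False
        then have "(\<Sum>j<N. cos (of_int (int k - int p) * t j)) = 0"
          unfolding t_def using k p by (intro sum_cos_roots) auto
        then show ?thesis using False by simp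
      qed simp
    qed
    also have "\<dots> = real N *\<^sub>R (v ^^ p) x" using p by simp
    finally have "real N * norm ((v ^^ p) x)
        = norm (\<Sum>j<N. cos (real p * t j) *\<^sub>R A (t j) N + sin (real p * t j) *\<^sub>R B (t j) N)" by simp
    also have "\<dots> \<le> (\<Sum>j<N. D * norm y)"
    proof (rule sum_norm_le)
      fix j
      have "norm (cos (real p * t j) *\<^sub>R A (t j) N) \<le> 1 * norm (A (t j) N)"
        "norm (sin (real p * t j) *\<^sub>R B (t j) N) \<le> 1 * norm (B (t j) N)"
        unfolding norm_scaleR by (intro mult_right_mono; simp)+
      then show "norm (cos (real p * t j) *\<^sub>R A (t j) N + sin (real p * t j) *\<^sub>R B (t j) N) \<le> D * norm y"
        using AB[OF tN, of j] norm_triangle_ineq[of "cos (real p * t j) *\<^sub>R A (t j) N"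
            "sin (real p * t j) *\<^sub>R B (t j) N"] by linarith
    qed
    also have "\<dots> = real N * (D * norm y)" by simp
    finally show ?thesis using N by (simp add: y_def)
  qed
  moreover have "D > 0" using V assms(2) by (simp add: D_def)
  ultimately show ?thesis using that by blast
qed

section \<open>Eigenvalues of an operator that is idempotent modulo compact ones\<close>

locale almost_idempotent = bounded_linear u for u :: "'a::banach \<Rightarrow> 'a" +
  assumes precompact_defect: "bounded B \<Longrightarrow> precompact ((\<lambda>x. u x - u (u x)) ` B)"
begin

definition defect :: "'a \<Rightarrow> 'a" where "defect x = u x - u (u x)"

definition quad :: "real \<Rightarrow> real \<Rightarrow> 'a \<Rightarrow> 'a"
  where "quad a r x = u (u x) - (2 * a) *\<^sub>R u x + (r * r) *\<^sub>R x"

text \<open>For \<open>r > 0\<close> this says that the complexification has an eigenvalue of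
  modulus \<open>r\<close> and real part \<open>a\<close>; a conjugate pair of eigenvalues is seen
  through the kernel of a real quadratic.\<close>

definition bad_radius :: "real \<Rightarrow> bool"
  where "bad_radius r \<longleftrightarrow> (\<exists>a x. \<bar>a\<bar> \<le> r \<and> x \<noteq> 0 \<and> quad a r x = 0)"

lemma bl_u: "bounded_linear u" ..

lemma bl_defect: "bounded_linear defect"
  unfolding defect_def[abs_def]
  by (intro bounded_linear_sub bl_u bounded_linear_compose[OF bl_u, unfolded o_def])

lemma bl_quad: "bounded_linear (quad a r)"
  unfolding quad_def[abs_def]
  by (intro bounded_linear_sub bounded_linear_add bl_u bounded_linear_compose[OF bl_u]
      bounded_linear_compose[OF bounded_linear_scaleR_right] bounded_linear_ident)

lemma quad_commute: "quad a r (quad b s x) = quad b s (quad a r x)"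
  by (simp add: quad_def diff add scaleR scaleR_add_right scaleR_diff_right mult.commute mult.left_commute)

text \<open>With \<mu> = \<lambda> (1 - \<lambda>), the left side is
  \<open>(p - \<mu>) (p - cnj \<mu>)\<close> for \<open>p = u - u^2\<close>. Its roots as a
  polynomial in \<open>u\<close> are \<lambda>, 1 - \<lambda> and their conjugates, so it is
  divisible by \<open>quad a r\<close>; the cofactor is the quadratic with roots 1 - \<lambda> and
  its conjugate.\<close>

lemma defect_quad:
  "defect (defect x) - (2 * (a - 2 * a\<^sup>2 + r\<^sup>2)) *\<^sub>R defect x + (r\<^sup>2 * (1 - 2 * a + r\<^sup>2)) *\<^sub>R x
     = u (u (quad a r x)) - (2 * (1 - a)) *\<^sub>R u (quad a r x) + (1 - 2 * a + r\<^sup>2) *\<^sub>R quad a r x"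
  (is "?l = ?r")
proof -
  define p q where "p = 1 - a" and "q = 1 - 2 * a + r\<^sup>2"
  define A B A' where "A = 2 * a" and "B = r * r" and "A' = 2 * p"
  have coeffs: "A + A' = 2" "q + A * A' + B = 1 + 2 * (a - 2 * a\<^sup>2 + r\<^sup>2)"
    "A * q + A' * B = 2 * (a - 2 * a\<^sup>2 + r\<^sup>2)" "B * q = r\<^sup>2 * q"
    by (simp_all add: A_def B_def A'_def p_def q_def power2_eq_square algebra_simps)
  have "?r = u (u (u (u x))) - (A + A') *\<^sub>R u (u (u x)) + (q + A * A' + B) *\<^sub>R u (u x)
      - (A * q + A' * B) *\<^sub>R u x + (B * q) *\<^sub>R x"
    unfolding q_def[symmetric] p_def[symmetric]
    unfolding quad_def A_def[symmetric] B_def[symmetric] A'_def[symmetric]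
    by (simp add: diff add scaleR algebra_simps)
  also have "\<dots> = ?l"
    unfolding coeffs q_def[symmetric]
    by (simp add: defect_def diff scaleR_2 scaleR_add_left algebra_simps)
  finally show ?thesis by simp
qed

text \<open>Subtracting the two equations makes \<open>x\<close> an eigenvector for a real
  \<open>g\<close>, or contradicts \<open>r \<noteq> s\<close> at once if \<open>a = b\<close>. The
  discriminant of a quadratic with \<open>|a| <= r\<close> is at most 0, so its only possible real
  root is \<open>a\<close>; likewise \<open>g\<close> would be \<open>b\<close>.\<close>

lemma quad_common_root:
  assumes "\<bar>a\<bar> \<le> r" "\<bar>b\<bar> \<le> s" "0 < r" "0 < s" "r \<noteq> s" "quad a r x = 0" "quad b s x = 0"
  shows "x = 0"
proof (rule ccontr)
  assume x: "x \<noteq> 0"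
  have rs: "r * r \<noteq> s * s"
    using assms(3-5) by (metis abs_of_pos power2_eq_iff_nonneg power2_eq_square less_imp_le)
  have "quad a r x - quad b s x = 0" using assms by simp
  then have eq: "(2 * (b - a)) *\<^sub>R u x = (s * s - r * r) *\<^sub>R x"
    by (simp add: quad_def algebra_simps)
  show False
  proof (cases "a = b")
    case True
    then show False using eq rs x by simp
  next
    case False
    define g where "g = (s * s - r * r) / (2 * (b - a))"
    have "u x = (1 / (2 * (b - a))) *\<^sub>R ((2 * (b - a)) *\<^sub>R u x)" using False by simp
    then have g: "u x = g *\<^sub>R x" unfolding eq g_def by simp
    have root: "g = c" if "\<bar>c\<bar> \<le> t" "quad c t x = 0" for c t
    proof -
      have "(g * g - 2 * c * g + t * t) *\<^sub>R x = 0"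
        using that(2) by (simp add: quad_def g scaleR algebra_simps)
      then have "g * g - 2 * c * g + t * t = 0" using x by simp
      then have "(g - c)\<^sup>2 = c\<^sup>2 - t\<^sup>2" by (simp add: power2_eq_square algebra_simps)
      also have "\<dots> \<le> 0" using that(1) abs_le_square_iff[of c t] by simp
      finally show ?thesis by simp
    qed
    from root[OF assms(1,6)] root[OF assms(2,7)] False show False by simp
  qed
qed

text \<open>Solved for \<open>x\<close>: where \<open>quad a r x\<close> is negligible,
  \<open>x\<close> is recovered from values of the compact operator \<open>defect\<close>, its
  coefficient being bounded away from 0 for the radii in use.\<close>

lemma defect_eq_quad:
  "(r\<^sup>2 * (1 - 2 * a + r\<^sup>2)) *\<^sub>R x =
     (u (u (quad a r x)) - (2 * (1 - a)) *\<^sub>R u (quad a r x) + (1 - 2 * a + r\<^sup>2) *\<^sub>R quad a r x)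
     - defect (defect x) + (2 * (a - 2 * a\<^sup>2 + r\<^sup>2)) *\<^sub>R defect x"
  using defect_quad[of x a r] by (simp add: algebra_simps)

text \<open>
  Riesz's argument: infinitely many bad radii give a strictly increasing sequence of closed invariant
  subspaces on whose successive quotients the compact operator \<^term>\<open>defect\<close> is bounded below.
\<close>

lemma exists_good_radius:
  assumes "inj r" "\<And>n. 1/4 \<le> r n" "\<And>n::nat. r n \<le> 1/2"
  obtains n where "\<not> bad_radius (r n)"
proof -
  have "\<exists>n. \<not> bad_radius (r n)"
  proof (rule ccontr)
    assume "\<not> ?thesis"
    then have "\<forall>n. \<exists>a x. \<bar>a\<bar> \<le> r n \<and> x \<noteq> 0 \<and> quad a (r n) x = 0"
      by (auto simp: bad_radius_def)
    then obtain a x where a: "\<And>n. \<bar>a n\<bar> \<le> r n" and x: "\<And>n. x n \<noteq> 0" "\<And>n. quad (a n) (r n) (x n) = 0"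
      by metis
    have rpos: "0 < r n" for n using assms(2)[of n] by simp
    \<comment> \<open>\<open>Q n\<close> is the product of the first \<open>n\<close> quadratics and
      \<open>L n\<close> its kernel, so the next quadratic maps \<open>L (Suc n)\<close> into
      \<open>L n\<close>.\<close>
    define Q where "Q = rec_nat (\<lambda>y. y) (\<lambda>n f y. quad (a n) (r n) (f y))"
    have Q0: "Q 0 y = y" and QS: "Q (Suc n) y = quad (a n) (r n) (Q n y)" for n y
      by (simp_all add: Q_def)
    have blQ: "bounded_linear (Q n)" for n
    proof (induction n)
      case 0
      show ?case unfolding Q_def by (simp add: bounded_linear_ident)
    next
      case (Suc n)
      show ?case using bounded_linear_compose[OF bl_quad Suc] by (simp add: QS[abs_def])
    qed
    have Qquad: "quad b s (Q n y) = Q n (quad b s y)" for b s n y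
      by (induction n) (simp_all add: Q0 QS quad_commute[of b s])
    have Qu: "u (Q n y) = Q n (u y)" for n y
      by (induction n) (simp_all add: Q0 QS quad_def diff add scaleR)
    define L where "L n = {y. Q n y = 0}" for n
    have subL: "subspace (L n)" for n
    proof -
      interpret Q: bounded_linear "Q n" by (rule blQ)
      show ?thesis by (auto simp: L_def subspace_def Q.add Q.scaleR Q.zero)
    qed
    have closedL: "closed (L n)" for n
      unfolding L_def using blQ[of n]
      by (intro closed_Collect_eq linear_continuous_on continuous_on_const)
    have quadL: "quad (a n) (r n) y \<in> L n" if "y \<in> L (Suc n)" for n y
      using that by (simp add: L_def QS Qquad)
    have quad0: "quad b s 0 = 0" for b s using bl_quad[of b s] by (rule linear_simps(3))
    have LS: "L n \<subseteq> L (Suc n)" for n by (auto simp: L_def QS quad0)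
    then have Lmono: "L i \<subseteq> L j" if "i \<le> j" for i j using that by (rule lift_Suc_mono_le)
    have uL: "u y \<in> L n" if "y \<in> L n" for n y using that by (simp add: L_def Qu[symmetric] zero)
    have defL: "defect y \<in> L n" if "y \<in> L n" for n y
      unfolding defect_def by (intro subspace_diff subL uL that)
    have "x n \<in> L (Suc n)" for n
    proof -
      interpret Q: bounded_linear "Q n" by (rule blQ)
      show ?thesis by (simp add: L_def QS Qquad x Q.zero)
    qed
    \<comment> \<open>The radii are distinct, so the quadratic of \<open>x n\<close> shares no
      nonzero kernel vector with an earlier one: applying the earlier factors one by one never
      annihilates \<open>x n\<close>.\<close>
    moreover have "x n \<notin> L n" for n
    proof -
      have "Q i (x n) \<noteq> 0" if "i \<le> n" for i
        using that
      proof (induction i)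
        case 0
        then show ?case using x by (simp add: Q0)
      next
        case (Suc i)
        interpret Q: bounded_linear "Q i" by (rule blQ)
        have "quad (a n) (r n) (Q i (x n)) = 0" by (simp add: Qquad x Q.zero)
        moreover have "r i \<noteq> r n" using assms(1) Suc.prems by (auto dest: injD)
        ultimately show ?case
          using quad_common_root[OF a[of i] a[of n] rpos rpos, of "Q i (x n)"] Suc by (auto simp: QS)
      qed
      then show ?thesis by (simp add: L_def)
    qed
    ultimately have "\<exists>y. y \<in> L (Suc n) \<and> norm y = 1 \<and> (\<forall>l\<in>L n. 1/2 \<le> norm (y - l))" for n
      using riesz_vector[OF subL closedL subL LS, of "x n" n] by metis
    then obtain y where y: "\<And>n. y n \<in> L (Suc n)" "\<And>n. norm (y n) = 1"
      "\<And>n l. l \<in> L n \<Longrightarrow> 1/2 \<le> norm (y n - l)" by metis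
    interpret defect: bounded_linear defect by (rule bl_defect)
    obtain K where K: "K > 0" "\<And>x. norm (defect x) \<le> norm x * K" using defect.pos_bounded by blast
    have sep: "1/128 / (K + 4) \<le> norm (defect (y n) - l)" if l: "l \<in> L n" for n l
    proof -
      define c d where "c = a n - 2 * (a n)\<^sup>2 + (r n)\<^sup>2" and "d = (r n)\<^sup>2 * (1 - 2 * a n + (r n)\<^sup>2)"
      have c: "\<bar>c\<bar> \<le> 2" and d: "1/64 \<le> d"
        unfolding c_def d_def using defect_coeff_bound[OF a assms(2,3)] by blast+
      define z where "z = defect (y n) - l"
      define q where "q = quad (a n) (r n) (y n)"
      \<comment> \<open>All terms of \<open>defect_eq_quad\<close> that lie in \<open>L n\<close>
        are collected in \<open>w\<close>. The others are at most \<open>(K + 4) * norm z\<close>,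
        the 4 coming from \<open>|2 * c| <= 4\<close>.\<close>
      define w where "w = (u (u q) - (2 * (1 - a n)) *\<^sub>R u q + (1 - 2 * a n + (r n)\<^sup>2) *\<^sub>R q)
        - defect l + (2 * c) *\<^sub>R l"
      have "q \<in> L n" unfolding q_def by (rule quadL[OF y(1)])
      then have w: "w \<in> L n"
        unfolding w_def by (intro subspace_add subspace_diff subspace_scale subL uL defL l)
      have "d *\<^sub>R y n = w - defect z + (2 * c) *\<^sub>R z"
        unfolding d_def by (subst defect_eq_quad)
          (simp add: w_def z_def q_def c_def defect.diff scaleR_diff_right)
      then have "norm (d *\<^sub>R y n - w) = norm ((2 * c) *\<^sub>R z - defect z)" by simp
      also have "\<dots> \<le> 2 * \<bar>c\<bar> * norm z + norm z * K"
        using norm_triangle_ineq4[of "(2 * c) *\<^sub>R z" "defect z"] K(2)[of z] by simp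
      also have "\<dots> \<le> 4 * norm z + norm z * K"
        using mult_right_mono[OF c, of "norm z"] by simp
      also have "\<dots> = norm z * (K + 4)" by (simp add: algebra_simps)
      finally have "norm (d *\<^sub>R y n - w) \<le> norm z * (K + 4)" .
      moreover have "d *\<^sub>R y n - w = d *\<^sub>R (y n - (1/d) *\<^sub>R w)" using d by (simp add: scaleR_diff_right)
      moreover have "1/2 \<le> norm (y n - (1/d) *\<^sub>R w)" by (intro y subspace_scale subL w)
      then have "1/64 * (1/2) \<le> d * norm (y n - (1/d) *\<^sub>R w)" using d by (intro mult_mono) auto
      ultimately have "1/128 \<le> norm z * (K + 4)" using d by simp
      then show ?thesis using K(1) unfolding z_def by (subst pos_divide_le_eq) auto
    qed
    have "\<not> precompact (range (\<lambda>n. defect (y n)))"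
    proof (rule not_precompact_if_separated)
      show "0 < 1/128 / (K + 4)" using K by simp
      fix i j :: nat assume "i < j"
      then have "defect (y i) \<in> L j" using Lmono[of "Suc i" j] y(1)[of i] by (intro defL) auto
      then show "1/128 / (K + 4) \<le> dist (defect (y i)) (defect (y j))"
        using sep by (simp add: dist_norm norm_minus_commute)
    qed
    moreover have "bounded (range y)" using y(2) by (auto simp: bounded_iff)
    then have "precompact (defect ` range y)"
      using precompact_defect unfolding defect_def[abs_def] by blast
    ultimately show False by (simp add: image_image)
  qed
  then show ?thesis using that by blast
qed

text \<open>
  For \<open>\<lambda> = a + \<i> b\<close> with \<open>\<bar>\<lambda>\<bar> = r\<close>, \<^term>\<open>quad a r\<close> is \<open>(u - \<lambda>) (u - cnj \<lambda>)\<close>: there is no spectrum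
  on the circle of radius \<open>r\<close>.
\<close>

lemma quad_bounded_below:
  assumes good: "\<not> bad_radius r" and r: "1/4 \<le> r" "r \<le> 1/2"
  obtains C where "C > 0" "\<And>a x. \<bar>a\<bar> \<le> r \<Longrightarrow> norm x \<le> C * norm (quad a r x)"
proof -
  have "\<exists>C>0. \<forall>a x. \<bar>a\<bar> \<le> r \<longrightarrow> norm x \<le> C * norm (quad a r x)"
  proof (rule ccontr)
    assume neg: "\<not> ?thesis"
    have "\<exists>a x. \<bar>a\<bar> \<le> r \<and> norm x = 1 \<and> norm (quad a r x) < 1 / (real n + 1)" for n :: nat
    proof -
      obtain a x where ax: "\<bar>a\<bar> \<le> r" "(real n + 1) * norm (quad a r x) < norm x"
        using neg by (metis not_le of_nat_0_le_iff add_nonneg_pos zero_less_one)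
      interpret q: bounded_linear "quad a r" by (rule bl_quad)
      have "x \<noteq> 0" using ax(2) by (auto simp: q.zero)
      then show ?thesis
        using ax by (intro exI[of _ a] exI[of _ "(1 / norm x) *\<^sub>R x"]) (auto simp: q.scaleR field_simps)
    qed
    then obtain a x where a: "\<And>n. \<bar>a n\<bar> \<le> r" and x: "\<And>n. norm (x n) = 1"
      "\<And>n. norm (quad (a n) r (x n)) < 1 / (real n + 1)" by metis
    interpret defect: bounded_linear defect by (rule bl_defect)
    have qx: "(\<lambda>n. quad (a n) r (x n)) \<longlonglongrightarrow> 0"
    proof (rule tendsto_norm_zero_cancel, rule tendsto_sandwich[OF _ _ tendsto_const])
      show "(\<lambda>n. 1 / (real n + 1)) \<longlonglongrightarrow> 0" by real_asymp
      show "\<forall>\<^sub>F n in sequentially. norm (quad (a n) r (x n)) \<le> 1 / (real n + 1)"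
        using x(2) by (intro always_eventually allI less_imp_le)
    qed simp
    have "compact {-r..r}" by simp
    moreover have "\<forall>n. a n \<in> {-r..r}" using a by (auto simp: abs_le_iff minus_le_iff)
    ultimately obtain l f where f: "l \<in> {-r..r}" "strict_mono (f :: nat \<Rightarrow> nat)" "(a \<circ> f) \<longlonglongrightarrow> l"
      unfolding compact_def by meson
    have "bounded (range x)" using x(1) by (auto simp: bounded_iff)
    then have "precompact (defect ` range x)"
      using precompact_defect unfolding defect_def[abs_def] by blast
    then have "precompact (range (\<lambda>n. defect (x (f n))))"
      by (rule precompact_subset) auto
    then obtain z g where g: "strict_mono (g :: nat \<Rightarrow> nat)" "(\<lambda>n. defect (x (f (g n)))) \<longlonglongrightarrow> z"
      by (rule precompact_subseq) (simp add: o_def)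
    define h where "h n = f (g n)" for n
    have h: "strict_mono h" using f(2) g(1) by (simp add: h_def strict_mono_def)
    have ah: "(\<lambda>n. a (h n)) \<longlonglongrightarrow> l"
      using LIMSEQ_subseq_LIMSEQ[OF f(3) g(1)] by (simp add: h_def o_def)
    have qh: "(\<lambda>n. quad (a (h n)) r (x (h n))) \<longlonglongrightarrow> 0"
      using LIMSEQ_subseq_LIMSEQ[OF qx h] by (simp add: o_def)
    have dh: "(\<lambda>n. defect (x (h n))) \<longlonglongrightarrow> z" using g(2) by (simp add: h_def)
    define d where "d n = r\<^sup>2 * (1 - 2 * a n + r\<^sup>2)" for n
    have dpos: "1/64 \<le> d n" for n unfolding d_def using defect_coeff_bound(1)[OF a r] .
    \<comment> \<open>Every term on the right of \<open>defect_eq_quad\<close> converges along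
      \<open>h\<close>, so \<open>d * x\<close> converges. As \<open>d\<close> stays above 1/64, so
      does \<open>x\<close>, and its limit is a unit vector in the kernel of
      \<open>quad l r\<close>.\<close>
    obtain w where w: "(\<lambda>n. d (h n) *\<^sub>R x (h n)) \<longlonglongrightarrow> w"
    proof
      show "(\<lambda>n. d (h n) *\<^sub>R x (h n)) \<longlonglongrightarrow>
          (u (u 0) - (2 * (1 - l)) *\<^sub>R u 0 + (1 - 2 * l + r\<^sup>2) *\<^sub>R 0)
           - defect z + (2 * (l - 2 * l\<^sup>2 + r\<^sup>2)) *\<^sub>R z"
        unfolding d_def
        by (subst defect_eq_quad) (intro tendsto_intros tendsto qh ah dh defect.tendsto)
    qed
    have dl: "(\<lambda>n. d (h n)) \<longlonglongrightarrow> r\<^sup>2 * (1 - 2 * l + r\<^sup>2)"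
      unfolding d_def by (intro tendsto_intros ah)
    have "1/64 \<le> r\<^sup>2 * (1 - 2 * l + r\<^sup>2)"
      using f(1) by (intro defect_coeff_bound(1)[OF _ r]) (auto simp: abs_le_iff)
    then have "(\<lambda>n. inverse (d (h n)) *\<^sub>R (d (h n) *\<^sub>R x (h n))) \<longlonglongrightarrow> inverse (r\<^sup>2 * (1 - 2 * l + r\<^sup>2)) *\<^sub>R w"
      by (intro tendsto_intros w dl) auto
    moreover have "inverse (d n) *\<^sub>R (d n *\<^sub>R y) = y" for n and y :: 'a using dpos[of n] by simp
    ultimately obtain y where y: "(\<lambda>n. x (h n)) \<longlonglongrightarrow> y" by simp
    have "norm y = 1" using tendsto_norm[OF y] x(1) by (simp add: LIMSEQ_const_iff)
    moreover have "(\<lambda>n. quad (a (h n)) r (x (h n))) \<longlonglongrightarrow> quad l r y"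
      unfolding quad_def by (intro tendsto_intros tendsto y ah)
    then have "quad l r y = 0" using qh LIMSEQ_unique by blast
    moreover have "\<bar>l\<bar> \<le> r" using f(1) by (auto simp: abs_le_iff)
    ultimately show False using good unfolding bad_radius_def by force
  qed
  then show ?thesis using that by blast
qed

section \<open>Powers rescaled by a radius free of eigenvalues\<close>

definition scaled_power :: "real \<Rightarrow> nat \<Rightarrow> 'a \<Rightarrow> 'a"
  where "scaled_power r n x = (1 / r) ^ n *\<^sub>R (u ^^ n) x"

lemma bl_funpow: "bounded_linear (u ^^ n)"
  by (rule bounded_linear_funpow[OF bl_u])

lemma bl_scaled_power: "bounded_linear (scaled_power r n)"
  unfolding scaled_power_def[abs_def]
  by (intro bounded_linear_compose[OF bounded_linear_scaleR_right] bl_funpow)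

lemma scaled_power_0: "scaled_power r 0 x = x"
  by (simp add: scaled_power_def)

lemma scaled_power_add: "scaled_power r (m + n) x = scaled_power r m (scaled_power r n x)"
proof -
  interpret P: bounded_linear "u ^^ m" by (rule bl_funpow)
  show ?thesis by (simp add: scaled_power_def funpow_add P.scaleR power_add)
qed

lemma scaled_power_Suc: "scaled_power r (Suc n) x = (1 / r) *\<^sub>R u (scaled_power r n x)"
  by (simp add: scaled_power_def scaleR)

lemma scaled_power_eq_funpow: "scaled_power r n x = ((\<lambda>x. (1 / r) *\<^sub>R u x) ^^ n) x"
  by (induction n) (simp_all add: scaled_power_0 scaled_power_Suc)

lemma funpow_eq_scaled_power: "r \<noteq> 0 \<Longrightarrow> (u ^^ n) x = r ^ n *\<^sub>R scaled_power r n x"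
  by (simp add: scaled_power_def power_divide)

text \<open>The point of angle \<open>t\<close> on the circle has real part
  \<open>r * cos t\<close>, and there \<open>quad\<close> is \<open>r^2\<close> times
  \<open>1 - 2 cos t v + v^2\<close> for \<open>v = u / r\<close>.\<close>

lemma good_radius_power_bound:
  assumes good: "\<not> bad_radius r" and r: "1/4 \<le> r" "r \<le> 1/2"
  obtains D where "D > 0"
    "\<And>N p x. p < N \<Longrightarrow> norm (scaled_power r p x) \<le> D * norm (x - scaled_power r N x)"
proof -
  obtain C where C: "C > 0" "\<And>a x. \<bar>a\<bar> \<le> r \<Longrightarrow> norm x \<le> C * norm (quad a r x)"
    using quad_bounded_below[OF assms] by blast
  define v where "v x = (1 / r) *\<^sub>R u x" for x
  have below: "norm x \<le> (C * (r * r)) * norm (x - (2 * cos t) *\<^sub>R v x + v (v x))" for t x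
  proof -
    have "r * \<bar>cos t\<bar> \<le> r * 1" using r by (intro mult_left_mono) auto
    then have "\<bar>r * cos t\<bar> \<le> r" using r by (simp add: abs_mult)
    then have "norm x \<le> C * norm (quad (r * cos t) r x)" by (rule C(2))
    also have "quad (r * cos t) r x = (r * r) *\<^sub>R (x - (2 * cos t) *\<^sub>R v x + v (v x))"
      using r by (simp add: quad_def v_def scaleR scaleR_add_right scaleR_diff_right mult.commute)
    finally show ?thesis by simp
  qed
  have "bounded_linear v"
    unfolding v_def[abs_def] by (intro bounded_linear_compose[OF bounded_linear_scaleR_right] bl_u)
  moreover have "C * (r * r) > 0" using C r by simp
  ultimately obtain D where "D > 0" "\<And>N p x. p < N \<Longrightarrow> norm ((v ^^ p) x) \<le> D * norm (x - (v ^^ N) x)"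
    using power_bound_if_no_circle_spectrum[OF _ _ below] by blast
  then show ?thesis using that by (simp add: scaled_power_eq_funpow v_def[abs_def])
qed

text \<open>Modulo compact operators \<open>u = u^2\<close>, so all powers of positive exponent
  agree; the difference telescopes. \<open>Suc m\<close> keeps the exponents positive.\<close>

lemma precompact_power_diff:
  assumes "bounded B"
  shows "precompact ((\<lambda>x. (u ^^ Suc m) x - (u ^^ (Suc m + n)) x) ` B)"
proof (induction n)
  case 0
  show ?case by (rule precompact_subset[of "{0}"]) (auto intro: precompact_finite)
next
  case (Suc n)
  interpret P: bounded_linear "u ^^ (m + n)" by (rule bl_funpow)
  have "precompact ((u ^^ (m + n)) ` ((\<lambda>x. u x - u (u x)) ` B))"
    by (intro precompact_image precompact_defect assms P.bounded_linear_axioms)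
  moreover have "(u ^^ (m + n)) (u x - u (u x)) = (u ^^ (Suc m + n)) x - (u ^^ (Suc m + Suc n)) x" for x
    by (simp add: P.diff funpow_swap1)
  ultimately have "precompact ((\<lambda>x. (u ^^ (Suc m + n)) x - (u ^^ (Suc m + Suc n)) x) ` B)"
    by (simp add: image_image)
  from precompact_image_add[OF Suc this] show ?case by simp
qed

text \<open>A Fredholm alternative for \<open>g = 1 - (u/r)^N\<close>: \<open>g\<close> is bounded
  below, so if it missed \<open>y\<close>, the ranges of its powers would be closed and strictly
  decreasing. Riesz vectors of these ranges would then be kept apart by \<open>u^N - u^(2N)\<close>,
  which is compact.\<close>

lemma surj_if_good_radius:
  assumes good: "\<not> bad_radius r" and r: "1/4 \<le> r" "r \<le> 1/2" and N: "N \<ge> 1"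
  shows "\<exists>x. x - scaled_power r N x = y"
proof (rule ccontr)
  assume y: "\<not> ?thesis"
  obtain D where D: "D > 0"
    "\<And>N p x. p < N \<Longrightarrow> norm (scaled_power r p x) \<le> D * norm (x - scaled_power r N x)"
    using good_radius_power_bound[OF good r] by blast
  define g where "g x = x - scaled_power r N x" for x
  have gb: "norm x \<le> D * norm (g x)" for x
    using D(2)[of 0 N x] N by (simp add: g_def scaled_power_0)
  have blg: "bounded_linear g"
    unfolding g_def[abs_def] by (intro bounded_linear_sub bounded_linear_ident bl_scaled_power)
  interpret g: bounded_linear g by (rule blg)
  have blgn: "bounded_linear (g ^^ n)" for n by (rule bounded_linear_funpow[OF blg])
  have gnb: "norm x \<le> D ^ n * norm ((g ^^ n) x)" for n x
  proof (induction n)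
    case (Suc n)
    have "D ^ n * norm ((g ^^ n) x) \<le> D ^ n * (D * norm (g ((g ^^ n) x)))"
      using D(1) gb by (intro mult_left_mono) auto
    with Suc show ?case by (simp add: mult.assoc mult.left_commute)
  qed simp
  define R where "R n = range (g ^^ n)" for n
  have closedR: "closed (R n)" for n
    unfolding R_def by (rule closed_range_if_bounded_below[OF blgn _ gnb]) (use D in simp)
  have subR: "subspace (R n)" for n
    unfolding R_def using blgn[of n]
    by (intro linear_subspace_image bounded_linear.linear subspace_UNIV)
  have gR: "g x \<in> R (Suc n)" if "x \<in> R n" for x n
    using that by (auto simp: R_def)
  have RS: "R (Suc n) \<subseteq> R n" for n by (auto simp: R_def funpow_swap1)
  then have Rmono: "R j \<subseteq> R i" if "i \<le> j" for i j using that by (rule lift_Suc_antimono_le)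
  have "(g ^^ n) y \<notin> R (Suc n)" for n
  proof
    interpret gn: bounded_linear "g ^^ n" by (rule blgn)
    assume "(g ^^ n) y \<in> R (Suc n)"
    then obtain x where "(g ^^ n) y = (g ^^ n) (g x)" by (auto simp: R_def funpow_swap1)
    then have "y - g x = 0" using gnb[of "y - g x" n] by (simp add: gn.diff)
    then show False using y by (auto simp: g_def)
  qed
  moreover have "(g ^^ n) y \<in> R n" for n by (auto simp: R_def)
  ultimately have "\<exists>z. z \<in> R n \<and> norm z = 1 \<and> (\<forall>l\<in>R (Suc n). 1/2 \<le> norm (z - l))" for n
    using riesz_vector[OF subR closedR subR RS, of "(g ^^ n) y" n] by metis
  then obtain z where z: "\<And>n. z n \<in> R n" "\<And>n. norm (z n) = 1"
    "\<And>n l. l \<in> R (Suc n) \<Longrightarrow> 1/2 \<le> norm (z n - l)" by metis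
  define \<rho> where "\<rho> = r ^ N"
  have \<rho>: "0 < \<rho>" "\<rho> < 1" unfolding \<rho>_def using r N by (auto intro: power_Suc_less_one simp: power_less_one_iff)
  define c where "c x = (u ^^ N) x - (u ^^ (N + N)) x" for x
  \<comment> \<open>With \<open>(u/r)^N = 1 - g\<close>, the polynomial
    \<open>\<rho> (1 - g) - \<rho>^2 (1 - g)^2\<close> has the constant term
    \<open>\<rho> (1 - \<rho>)\<close>, nonzero because \<open>0 < \<rho> < 1\<close>. The rest is
    divisible by \<open>g\<close> and lands one range lower.\<close>
  have c: "c x = (\<rho> * (1 - \<rho>)) *\<^sub>R x + g ((\<rho> * \<rho>) *\<^sub>R (x + x - g x) - \<rho> *\<^sub>R x)" for x
  proof -
    interpret s: bounded_linear "scaled_power r N" by (rule bl_scaled_power)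
    have "c x = \<rho> *\<^sub>R scaled_power r N x - (\<rho> * \<rho>) *\<^sub>R scaled_power r N (scaled_power r N x)"
      using r by (simp add: c_def \<rho>_def funpow_eq_scaled_power[of r] scaled_power_add power_add)
    then show ?thesis by (simp add: g_def s.diff s.add s.scaleR algebra_simps)
  qed
  have cR: "c x - (\<rho> * (1 - \<rho>)) *\<^sub>R x \<in> R (Suc n)" if "x \<in> R n" for x n
  proof -
    have "g x \<in> R n" using gR[OF that] RS by blast
    then have "g ((\<rho> * \<rho>) *\<^sub>R (x + x - g x) - \<rho> *\<^sub>R x) \<in> R (Suc n)"
      by (intro gR subspace_diff[OF subR] subspace_add[OF subR] subspace_scale[OF subR] that)
    then show ?thesis unfolding c by simp
  qed
  have "\<not> precompact (range (\<lambda>n. c (z n)))"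
  proof (rule not_precompact_if_separated)
    show "0 < \<rho> * (1 - \<rho>) * (1/2)" using \<rho> by simp
    fix i j :: nat assume ij: "i < j"
    define \<tau> where "\<tau> = \<rho> * (1 - \<rho>)"
    have \<tau>: "\<tau> > 0" using \<rho> by (simp add: \<tau>_def)
    have "(c (z j) - \<tau> *\<^sub>R z j) + \<tau> *\<^sub>R z j \<in> R j"
      using cR[OF z(1), of j] RS[of j] z(1)[of j] unfolding \<tau>_def
      by (intro subspace_add subspace_scale subR) auto
    then have "c (z j) \<in> R (Suc i)" using Rmono[of "Suc i" j] ij by auto
    then have "(1/\<tau>) *\<^sub>R (c (z j) - (c (z i) - \<tau> *\<^sub>R z i)) \<in> R (Suc i)"
      using subspace_scale[OF subR subspace_diff[OF subR _ cR[OF z(1)]]] unfolding \<tau>_def by blast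
    from z(3)[OF this] have "\<tau> * (1/2) \<le> \<tau> * norm (z i - (1/\<tau>) *\<^sub>R (c (z j) - (c (z i) - \<tau> *\<^sub>R z i)))"
      using \<tau> by (intro mult_left_mono) auto
    also have "\<dots> = norm (\<tau> *\<^sub>R (z i - (1/\<tau>) *\<^sub>R (c (z j) - (c (z i) - \<tau> *\<^sub>R z i))))"
      using \<tau> by simp
    also have "\<tau> *\<^sub>R (z i - (1/\<tau>) *\<^sub>R (c (z j) - (c (z i) - \<tau> *\<^sub>R z i))) = c (z i) - c (z j)"
      using \<tau> by (simp add: scaleR_diff_right)
    finally show "\<rho> * (1 - \<rho>) * (1/2) \<le> dist (c (z i)) (c (z j))"
      by (simp add: \<tau>_def dist_norm)
  qed
  moreover have "bounded (range z)" using z(2) by (auto simp: bounded_iff)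
  then have "precompact (c ` range z)"
    using precompact_power_diff[of "range z" "N - 1" N] N by (simp add: c_def[abs_def])
  ultimately show False by (simp add: image_image)
qed

text \<open>Telescoping of \<open>u^i (u - u^2)\<close>: up to a compact operator, \<open>u\<close>
  equals an arbitrarily high power of itself.\<close>

lemma u_eq_sum_defect: "u x = (\<Sum>i<n. (u ^^ i) (defect x)) + (u ^^ Suc n) x"
proof (induction n)
  case (Suc n)
  interpret P: bounded_linear "u ^^ n" by (rule bl_funpow)
  have eq: "(u ^^ n) (defect x) = (u ^^ Suc n) x - (u ^^ Suc (Suc n)) x"
    by (simp add: defect_def P.diff funpow_swap1)
  have "(\<Sum>i<n. (u ^^ i) (defect x)) + (u ^^ Suc n) x = (\<Sum>i<Suc n. (u ^^ i) (defect x)) + (u ^^ Suc (Suc n)) x"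
    unfolding sum.lessThan_Suc eq by (simp del: funpow.simps)
  with Suc show ?case by (rule trans)
qed simp

text \<open>High powers of \<open>u\<close> are to be small off a finite set that may depend on the
  tolerance: for a sequence, the estimate may start at an index that depends on the power.\<close>

lemma precompact_u_image:
  assumes "bounded E"
    and small: "\<And>e. e > 0 \<Longrightarrow> \<exists>n F. finite F \<and> (\<forall>x\<in>E - F. norm ((u ^^ Suc n) x) \<le> e)"
  shows "precompact (u ` E)"
proof (rule precompact_near)
  fix e :: real assume e: "e > 0"
  then obtain n F where nF: "finite F" "\<And>x. x \<in> E - F \<Longrightarrow> norm ((u ^^ Suc n) x) \<le> e"
    using small[OF e] by blast
  have pre: "precompact ((\<lambda>x. \<Sum>i<n. (u ^^ i) (defect x)) ` E)"
  proof (induction n)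
    case 0
    show ?case by (rule precompact_subset[of "{0}"]) (auto intro: precompact_finite)
  next
    case (Suc n)
    have "precompact ((u ^^ n) ` (defect ` E))"
      by (rule precompact_image[OF _ bl_funpow])
        (use precompact_defect[OF assms(1)] in \<open>simp add: defect_def[abs_def]\<close>)
    then have "precompact ((\<lambda>x. (u ^^ n) (defect x)) ` E)" by (simp add: image_image)
    from precompact_image_add[OF Suc this] show ?case by simp
  qed
  let ?A = "(\<lambda>x. \<Sum>i<n. (u ^^ i) (defect x)) ` E \<union> u ` F"
  have "precompact ?A"
    by (rule precompact_pieces[of "{True, False}" "\<lambda>b. if b then (\<lambda>x. \<Sum>i<n. (u ^^ i) (defect x)) ` E else u ` F"])
      (use pre nF(1) in \<open>auto intro: precompact_finite\<close>)
  moreover have "\<exists>a\<in>?A. dist a (u x) \<le> e" if "x \<in> E" for x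
  proof (cases "x \<in> F")
    case True
    then show ?thesis using e by (intro bexI[of _ "u x"]) auto
  next
    case False
    then show ?thesis
      using nF(2)[of x] that u_eq_sum_defect[of x n]
      by (intro bexI[of _ "\<Sum>i<n. (u ^^ i) (defect x)"]) (auto simp: dist_norm norm_minus_commute)
  qed
  ultimately show "\<exists>A. covered e A \<and> (\<forall>b\<in>u ` E. \<exists>a\<in>A. dist a b \<le> e)"
    using e by (intro exI[of _ ?A]) (auto intro: precompactD)
qed

section \<open>The spectral subspace inside a circle\<close>

lemma two_good_radii:
  obtains s r where "\<not> bad_radius s" "1/4 \<le> s" "s < r" "r \<le> 1/2" "\<not> bad_radius r"
proof -
  \<comment> \<open>The first family of candidate radii lies in (1/4, 3/8], the second in (3/8,
    1/2], which forces \<open>s < r\<close>.\<close>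
  obtain n where n: "\<not> bad_radius (1/4 + 1 / (8 * (real n + 1)))"
    by (rule exists_good_radius[of "\<lambda>n. 1/4 + 1 / (8 * (real n + 1))"]) (auto simp: inj_def field_simps)
  obtain m where m: "\<not> bad_radius (3/8 + 1 / (8 * (real m + 1)))"
    by (rule exists_good_radius[of "\<lambda>n. 3/8 + 1 / (8 * (real n + 1))"]) (auto simp: inj_def field_simps)
  have "1 / (8 * (real n + 1)) \<le> 1/8" "1 / (8 * (real m + 1)) \<le> 1/8"
    "0 < 1 / (8 * (real n + 1))" "0 < 1 / (8 * (real m + 1))"
    by (simp_all add: field_simps)
  then show ?thesis by (intro that[OF n _ _ _ m]) linarith+
qed

lemma scaled_power_mono:
  assumes "0 < s" "s < r"
  shows "scaled_power r p x = (s / r) ^ p *\<^sub>R scaled_power s p x"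
  using assms by (simp add: scaled_power_def power_divide)

text \<open>
  The subspace is the part of the space on which \<open>u\<close> has spectral radius less than \<open>r\<close>, and \<open>e\<close> is the
  spectral projection of \<open>y\<close>, a limit of the vectors \<open>(1 - (u/s)^N)^-1 y\<close>.
\<close>

lemma exists_small_part:
  obtains r M C where "M = {x. (\<lambda>n. scaled_power r n x) \<longlonglongrightarrow> 0}" "closed M" "compact_on u M"
    "\<And>y. \<exists>e\<in>M. norm (y - e) \<le> C * norm (u y)" "C > 0"
proof -
  obtain s r where s: "\<not> bad_radius s" "1/4 \<le> s" and sr: "s < r" and r: "r \<le> 1/2" "\<not> bad_radius r"
    by (rule two_good_radii)
  have s': "s \<le> 1/2" and r': "1/4 \<le> r" using s sr r by auto
  obtain D where D: "D > 0"
    "\<And>N p x. p < N \<Longrightarrow> norm (scaled_power s p x) \<le> D * norm (x - scaled_power s N x)"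
    using good_radius_power_bound[OF s s'] by blast
  obtain D' where D': "D' > 0"
    "\<And>N p x. p < N \<Longrightarrow> norm (scaled_power r p x) \<le> D' * norm (x - scaled_power r N x)"
    using good_radius_power_bound[OF r(2) r' r(1)] by blast
  define M where "M = {x. (\<lambda>n. scaled_power r n x) \<longlonglongrightarrow> 0}"
  \<comment> \<open>For \<open>x\<close> in \<open>M\<close>, \<open>x - scaled_power r N x\<close>
    tends to \<open>x\<close> as \<open>N\<close> grows, which turns the estimate at radius
    \<open>r\<close> into a bound on all scaled powers.\<close>
  have bound: "norm (scaled_power r p x) \<le> D' * norm x" if "x \<in> M" for x p
  proof (rule tendsto_le[OF sequentially_bot])
    have "(\<lambda>n. scaled_power r n x) \<longlonglongrightarrow> 0" using that by (simp add: M_def)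
    then have "(\<lambda>N. D' * norm (x - scaled_power r N x)) \<longlonglongrightarrow> D' * norm (x - 0)"
      by (intro tendsto_intros)
    then show "(\<lambda>N. D' * norm (x - scaled_power r N x)) \<longlonglongrightarrow> D' * norm x" by simp
    show "\<forall>\<^sub>F N in sequentially. norm (scaled_power r p x) \<le> D' * norm (x - scaled_power r N x)"
      using eventually_gt_at_top[of p] by eventually_elim (rule D'(2))
  qed simp
  have closedM: "closed M"
    unfolding closed_sequential_limits
  proof (intro allI impI)
    fix f l assume "(\<forall>n. f n \<in> M) \<and> f \<longlonglongrightarrow> l"
    then have f: "\<And>n. f n \<in> M" "f \<longlonglongrightarrow> l" by auto
    \<comment> \<open>The bound for \<open>f n - f m\<close> passes to the limit in
      \<open>m\<close>, uniformly in \<open>p\<close>; this uniformity puts \<open>l\<close> into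
      \<open>M\<close>.\<close>
    have diff: "norm (scaled_power r p (f n - l)) \<le> D' * norm (f n - l)" for n p
    proof (rule tendsto_le[OF sequentially_bot])
      interpret P: bounded_linear "scaled_power r p" by (rule bl_scaled_power)
      show "(\<lambda>m. D' * norm (f n - f m)) \<longlonglongrightarrow> D' * norm (f n - l)"
        by (intro tendsto_intros f)
      show "(\<lambda>m. norm (scaled_power r p (f n - f m))) \<longlonglongrightarrow> norm (scaled_power r p (f n - l))"
        by (intro tendsto_intros P.tendsto f)
      have "f n - f m \<in> M" for m
      proof -
        have "(\<lambda>k. scaled_power r k (f n) - scaled_power r k (f m)) \<longlonglongrightarrow> 0 - 0"
          using f(1)[of n] f(1)[of m] by (intro tendsto_diff) (auto simp: M_def)
        then show ?thesis
          by (simp add: M_def linear_diff[OF bounded_linear.linear[OF bl_scaled_power]])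
      qed
      then show "\<forall>\<^sub>F m in sequentially. norm (scaled_power r p (f n - f m)) \<le> D' * norm (f n - f m)"
        by (intro always_eventually allI bound)
    qed
    have "(\<lambda>p. scaled_power r p l) \<longlonglongrightarrow> 0"
    proof (rule LIMSEQ_I)
      fix e :: real assume e: "e > 0"
      have "(\<lambda>n. D' * norm (f n - l)) \<longlonglongrightarrow> D' * norm (l - l)" by (intro tendsto_intros f)
      then have "\<forall>\<^sub>F n in sequentially. D' * norm (f n - l) < e/2"
        using e by (intro order_tendstoD) auto
      then obtain n where n: "D' * norm (f n - l) < e/2" by (auto simp: eventually_sequentially)
      have "(\<lambda>p. scaled_power r p (f n)) \<longlonglongrightarrow> 0" using f(1)[of n] by (simp add: M_def)
      then obtain p0 where p0: "\<And>p. p \<ge> p0 \<Longrightarrow> norm (scaled_power r p (f n)) < e/2"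
        using e LIMSEQ_D[of "\<lambda>p. scaled_power r p (f n)" 0 "e/2"] by auto
      have "norm (scaled_power r p l - 0) < e" if "p \<ge> p0" for p
      proof -
        have "scaled_power r p l = scaled_power r p (f n) - scaled_power r p (f n - l)"
          by (simp add: linear_diff[OF bounded_linear.linear[OF bl_scaled_power]])
        then show ?thesis
          using p0[OF that] diff[of p n] n
            norm_triangle_ineq4[of "scaled_power r p (f n)" "scaled_power r p (f n - l)"] by simp
      qed
      then show "\<exists>p0. \<forall>p\<ge>p0. norm (scaled_power r p l - 0) < e" by blast
    qed
    then show "l \<in> M" by (simp add: M_def)
  qed
  have cpt: "compact_on u M"
    unfolding compact_on_iff
  proof (intro allI impI)
    fix B assume B: "B \<subseteq> M" "bounded B"
    obtain b where b: "b > 0" "\<And>x. x \<in> B \<Longrightarrow> norm x \<le> b" using B(2) by (auto simp: bounded_pos)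
    show "precompact (u ` B)"
    proof (rule precompact_u_image[OF B(2)])
      fix e :: real assume e: "e > 0"
      have "(\<lambda>n. (1/2) ^ n * (D' * b)) \<longlonglongrightarrow> 0 * (D' * b)"
        by (intro tendsto_intros LIMSEQ_power_zero) auto
      then have "\<forall>\<^sub>F n in sequentially. (1/2) ^ n * (D' * b) < e" using e by (intro order_tendstoD) auto
      then obtain n where "\<forall>k\<ge>n. (1/2) ^ k * (D' * b) < e" unfolding eventually_sequentially by blast
      then have n: "(1/2) ^ Suc n * (D' * b) < e" using le_SucI by blast
      have "norm ((u ^^ Suc n) x) \<le> e" if "x \<in> B" for x
      proof -
        have "norm (scaled_power r (Suc n) x) \<le> D' * b"
          using order_trans[OF bound[OF subsetD[OF B(1) that]] mult_left_mono[OF b(2)[OF that]]] D'(1) by simp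
        moreover have "r ^ Suc n \<le> (1/2) ^ Suc n" using r r' by (intro power_mono) auto
        ultimately have "r ^ Suc n * norm (scaled_power r (Suc n) x) \<le> (1/2) ^ Suc n * (D' * b)"
          using r' by (intro mult_mono) auto
        moreover have "norm ((u ^^ Suc n) x) = r ^ Suc n * norm (scaled_power r (Suc n) x)"
          using r' funpow_eq_scaled_power[of r "Suc n" x] by (simp del: funpow.simps)
        ultimately show ?thesis using n by linarith
      qed
      then show "\<exists>n F. finite F \<and> (\<forall>x\<in>B - F. norm ((u ^^ Suc n) x) \<le> e)" by blast
    qed
  qed
  have approx: "\<exists>e\<in>M. norm (y - e) \<le> (D / s) * norm (u y)" for y
  proof -
    have "\<exists>x. x - scaled_power s (Suc n) x = y" for n by (rule surj_if_good_radius[OF s s']) simp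
    \<comment> \<open>With \<open>N = Suc n\<close>, the inverse of \<open>1 - (u/s)^N\<close>
      heuristically tends to the identity inside the circle and to 0 outside. So \<open>e n\<close>
      should approach the part of \<open>y\<close> inside, and \<open>h n\<close> minus the part
      outside.\<close>
    then obtain e where e: "\<And>n. e n - scaled_power s (Suc n) (e n) = y" by metis
    have eb: "norm (scaled_power s p (e n)) \<le> D * norm y" if "p \<le> n" for p n
      using D(2)[of p "Suc n" "e n"] that by (simp add: e)
    define h where "h n = e n - y" for n
    have h: "h n = scaled_power s (Suc n) (e n)" for n using e[of n] by (simp add: h_def algebra_simps)
    \<comment> \<open>One factor \<open>u/s\<close> of \<open>h n\<close> is moved onto
      \<open>y\<close>, which makes the bound a multiple of \<open>norm (u y)\<close>. The other
      \<open>n\<close> factors are covered by the estimate at radius \<open>s\<close> with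
      \<open>p = n\<close>, below \<open>Suc n\<close>.\<close>
    have hb: "norm (h n) \<le> (D / s) * norm (u y)" for n
    proof -
      have "h n = scaled_power s n (scaled_power s 1 (e n))"
        by (simp add: h scaled_power_add[symmetric])
      then have "norm (h n) \<le> D * norm (scaled_power s 1 (e n) - scaled_power s (Suc n) (scaled_power s 1 (e n)))"
        using D(2)[of n "Suc n"] by simp
      also have "scaled_power s (Suc n) (scaled_power s 1 (e n)) = scaled_power s 1 (scaled_power s (Suc n) (e n))"
        by (simp add: scaled_power_add[symmetric])
      also have "scaled_power s 1 (e n) - scaled_power s 1 (scaled_power s (Suc n) (e n)) = scaled_power s 1 y"
        by (simp add: linear_diff[OF bounded_linear.linear[OF bl_scaled_power], symmetric] e)
      also have "norm \<dots> = norm (u y) / s" using s by (simp add: scaled_power_def)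
      finally show ?thesis by simp
    qed
    have be: "bounded (range e)"
      using eb[of 0] by (auto simp: bounded_iff scaled_power_0)
    \<comment> \<open>Precompactness of \<open>h\<close> is split: \<open>h - u h\<close> is a
      multiple of \<open>defect\<close> on a bounded sequence, and \<open>u h\<close> is treated
      through the smallness of high powers.\<close>
    have "precompact (range (\<lambda>n. h n - u (h n)))"
    proof -
      have eq: "h n - u (h n) = (1 / s) *\<^sub>R defect (scaled_power s n (e n))" for n
        by (simp add: h scaled_power_Suc scaleR defect_def scaleR_diff_right)
      have "bounded (range (\<lambda>n. scaled_power s n (e n)))" using eb by (auto simp: bounded_iff)
      then have "precompact (scaleR (1 / s) ` (\<lambda>x. u x - u (u x)) ` range (\<lambda>n. scaled_power s n (e n)))"
        by (intro precompact_image precompact_defect bounded_linear_scaleR_right)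
      then show ?thesis unfolding eq by (simp add: image_image defect_def)
    qed
    moreover have "precompact (range (\<lambda>n. u (h n)))"
    proof -
      have "precompact (u ` range e)"
      proof (rule precompact_u_image[OF be])
        fix \<epsilon> :: real assume \<epsilon>: "\<epsilon> > 0"
        have "(\<lambda>n. (1/2) ^ n * (D * norm y)) \<longlonglongrightarrow> 0 * (D * norm y)"
          by (intro tendsto_intros LIMSEQ_power_zero) auto
        then have "\<forall>\<^sub>F n in sequentially. (1/2) ^ n * (D * norm y) < \<epsilon>"
          using \<epsilon> by (intro order_tendstoD) auto
        then obtain n where "\<forall>k\<ge>n. (1/2) ^ k * (D * norm y) < \<epsilon>" unfolding eventually_sequentially by blast
        then have n: "(1/2) ^ Suc n * (D * norm y) < \<epsilon>" using le_SucI by blast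
        \<comment> \<open>The bound \<open>eb\<close> for the power \<open>Suc n\<close> holds for
          \<open>e k\<close> with \<open>Suc n <= k\<close>; the finitely many earlier terms form
          the exceptional set.\<close>
        have "norm ((u ^^ Suc n) (e k)) \<le> \<epsilon>" if "k > n" for k
        proof -
          have "norm (scaled_power s (Suc n) (e k)) \<le> D * norm y" using that by (intro eb) auto
          moreover have "s ^ Suc n \<le> (1/2) ^ Suc n" using s s' by (intro power_mono) auto
          ultimately have "s ^ Suc n * norm (scaled_power s (Suc n) (e k)) \<le> (1/2) ^ Suc n * (D * norm y)"
            using s by (intro mult_mono) auto
          moreover have "norm ((u ^^ Suc n) (e k)) = s ^ Suc n * norm (scaled_power s (Suc n) (e k))"
            using s funpow_eq_scaled_power[of s "Suc n" "e k"] by (simp del: funpow.simps)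
          ultimately show ?thesis using n by linarith
        qed
        then have "\<forall>x\<in>range e - e ` {..n}. norm ((u ^^ Suc n) x) \<le> \<epsilon>"
          by (auto simp del: funpow.simps simp: not_le[symmetric])
        then show "\<exists>n F. finite F \<and> (\<forall>x\<in>range e - F. norm ((u ^^ Suc n) x) \<le> \<epsilon>)" by blast
      qed
      then have "precompact (range (\<lambda>n. u (e n) + (- u y)))"
        by (intro precompact_image_add) (auto simp: image_image intro: precompact_finite)
      then show ?thesis by (simp add: h_def diff)
    qed
    ultimately have "precompact (range (\<lambda>n. (h n - u (h n)) + u (h n)))" by (rule precompact_image_add)
    then have "precompact (range h)" by simp
    then obtain l f where f: "strict_mono (f :: nat \<Rightarrow> nat)" "(h \<circ> f) \<longlonglongrightarrow> l" by (rule precompact_subseq)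
    then have lim: "(\<lambda>n. e (f n)) \<longlonglongrightarrow> y + l"
      using tendsto_add[OF tendsto_const[of y], of "h \<circ> f" l] by (simp add: h_def o_def)
    have lb: "norm (scaled_power s p (y + l)) \<le> D * norm y" for p
    proof (rule tendsto_upperbound)
      interpret P: bounded_linear "scaled_power s p" by (rule bl_scaled_power)
      show "(\<lambda>n. norm (scaled_power s p (e (f n)))) \<longlonglongrightarrow> norm (scaled_power s p (y + l))"
        by (intro tendsto_intros P.tendsto lim)
      show "\<forall>\<^sub>F n in sequentially. norm (scaled_power s p (e (f n))) \<le> D * norm y"
        using eventually_ge_at_top[of p]
      proof eventually_elim
        case (elim n)
        then show ?case using seq_suble[OF f(1), of n] by (intro eb) auto
      qed
    qed simp
    \<comment> \<open>Here the two radii meet: the limit keeps its scaled powers bounded at radius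
      \<open>s\<close>, and the ratio \<open>s / r < 1\<close> turns boundedness into convergence to
      0.\<close>
    have "(\<lambda>p. scaled_power r p (y + l)) \<longlonglongrightarrow> 0"
    proof (rule tendsto_norm_zero_cancel, rule tendsto_sandwich[OF _ _ tendsto_const])
      have "(\<lambda>p. (s / r) ^ p * (D * norm y)) \<longlonglongrightarrow> 0 * (D * norm y)"
        using s sr by (intro tendsto_intros LIMSEQ_power_zero) auto
      then show "(\<lambda>p. (s / r) ^ p * (D * norm y)) \<longlonglongrightarrow> 0" by simp
      have "norm (scaled_power r p (y + l)) \<le> (s / r) ^ p * (D * norm y)" for p
        using s sr scaled_power_mono[of s r p "y + l"] lb[of p] by (auto intro!: mult_left_mono)
      then show "\<forall>\<^sub>F p in sequentially. norm (scaled_power r p (y + l)) \<le> (s / r) ^ p * (D * norm y)"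
        by simp
    qed simp
    then have "y + l \<in> M" by (simp add: M_def)
    moreover have "norm l \<le> (D / s) * norm (u y)"
      using hb by (intro tendsto_upperbound[OF tendsto_norm[OF f(2)]]) auto
    ultimately show ?thesis by (intro bexI[of _ "y + l"]) auto
  qed
  have "D / s > 0" using D(1) s by simp
  with M_def closedM cpt approx show ?thesis by (rule that)
qed

end

section \<open>Compact operators on essentially maximal subspaces\<close>

lemma closed_extend_line:
  fixes N :: "'a::banach set"
  assumes N: "subspace N" "closed N"
  shows "closed {z. \<exists>t. z - t *\<^sub>R x \<in> N}"
proof (cases "x \<in> N")
  case True
  have "z \<in> N" if "z - t *\<^sub>R x \<in> N" for z t
  proof -
    have "z - t *\<^sub>R x + t *\<^sub>R x \<in> N" by (intro subspace_add subspace_scale N(1) that True)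
    then show ?thesis by simp
  qed
  then have "{z. \<exists>t. z - t *\<^sub>R x \<in> N} = N" by (auto intro: exI[of _ 0])
  then show ?thesis using N(2) by simp
next
  case False
  have ne: "N \<noteq> {}" using subspace_0[OF N(1)] by blast
  define d where "d = infdist x N"
  have d: "d > 0"
    using in_closed_iff_infdist_zero[OF N(2) ne, of x] False infdist_nonneg[of x N] by (auto simp: d_def)
  \<comment> \<open>The positive distance of \<open>x\<close> from \<open>N\<close> controls the
    coefficient of \<open>x\<close>, so the coefficients along a convergent sequence are
    Cauchy.\<close>
  have bound: "\<bar>t\<bar> * d \<le> norm (t *\<^sub>R x - m)" if "m \<in> N" for t m
  proof (cases "t = 0")
    case False
    have "(1/t) *\<^sub>R m \<in> N" by (intro subspace_scale N(1) that)
    then have "d \<le> norm (x - (1/t) *\<^sub>R m)" unfolding d_def dist_norm[symmetric] by (rule infdist_le)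
    then have "\<bar>t\<bar> * d \<le> norm (t *\<^sub>R (x - (1/t) *\<^sub>R m))" by (simp add: mult_left_mono)
    then show ?thesis using False by (simp add: scaleR_diff_right)
  qed simp
  show ?thesis
    unfolding closed_sequential_limits
  proof (intro allI impI)
    fix f l assume "(\<forall>n. f n \<in> {z. \<exists>t. z - t *\<^sub>R x \<in> N}) \<and> f \<longlonglongrightarrow> l"
    then obtain t where t: "\<And>n. f n - t n *\<^sub>R x \<in> N" and f: "f \<longlonglongrightarrow> l" by (auto, metis)
    have diff: "\<bar>t m - t n\<bar> * d \<le> norm (f m - f n)" for m n
    proof -
      have "(t m - t n) *\<^sub>R x - ((f n - t n *\<^sub>R x) - (f m - t m *\<^sub>R x)) = f m - f n"
        by (simp add: algebra_simps)
      then show ?thesis using bound[of "(f n - t n *\<^sub>R x) - (f m - t m *\<^sub>R x)" "t m - t n"] t N(1)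
        by (simp add: subspace_diff)
    qed
    have "Cauchy t"
    proof (rule metric_CauchyI)
      fix e :: real assume "e > 0"
      then obtain n0 where n0: "\<And>m n. m \<ge> n0 \<Longrightarrow> n \<ge> n0 \<Longrightarrow> dist (f m) (f n) < e * d"
        using LIMSEQ_imp_Cauchy[OF f] d unfolding Cauchy_def by (metis mult_pos_pos)
      have "dist (t m) (t n) < e" if "m \<ge> n0" "n \<ge> n0" for m n
      proof -
        have "\<bar>t m - t n\<bar> * d < e * d" using diff[of m n] n0[OF that] by (simp add: dist_norm)
        then show ?thesis using d by (simp add: dist_real_def)
      qed
      then show "\<exists>M. \<forall>m\<ge>M. \<forall>n\<ge>M. dist (t m) (t n) < e" by blast
    qed
    then obtain s where "t \<longlonglongrightarrow> s" using Cauchy_convergent unfolding convergent_def by blast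
    then have "(\<lambda>n. f n - t n *\<^sub>R x) \<longlonglongrightarrow> l - s *\<^sub>R x" by (intro tendsto_intros f)
    then have "l - s *\<^sub>R x \<in> N" by (rule closed_sequentially[OF N(2) t])
    then show "l \<in> {z. \<exists>t. z - t *\<^sub>R x \<in> N}" by blast
  qed
qed

lemma closed_span_Un_finite:
  fixes N :: "'a::banach set"
  assumes N: "subspace N" "closed N" and "finite X"
  shows "closed (span (N \<union> X))"
  using assms(3)
proof (induction X)
  case empty
  then show ?case using N by (simp add: span_eq_iff[THEN iffD2])
next
  case (insert x X)
  have "span (N \<union> insert x X) = {z. \<exists>t. z - t *\<^sub>R x \<in> span (N \<union> X)}"
    by (simp add: span_insert)
  then show ?case using closed_extend_line[OF subspace_span insert.IH] by simp
qed

context banach_over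
begin

lemma real_subspace: "subspace M \<Longrightarrow> real_vector.subspace M"
  unfolding subspace_def real_vector.subspace_def by (metis smul_of_real)

text \<open>A Riesz vector \<open>y\<close> of \<open>M0\<close> far from \<open>M\<close> plus the
  span of a suitable finite \<open>X\<close> cannot exist: \<open>u y\<close> is close to some
  \<open>u z\<close> with \<open>z\<close> in \<open>X\<close>, and the distance estimate puts
  \<open>y - z\<close> close to \<open>M\<close>. Riesz's lemma is applied to the real span, which
  the span over all scalars contains.\<close>

lemma finite_dim_quotient_if_compact_on:
  fixes u :: "'a \<Rightarrow> 'b::banach"
  assumes u: "bounded_linear u" and M: "subspace M" "closed M" and M0: "subspace M0" "M \<subseteq> M0"
    and cpt: "compact_on u M0" and C: "C > 0" "\<And>y. \<exists>e\<in>M. norm (y - e) \<le> C * norm (u y)"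
  shows "finite_dim_quotient smul M0 M"
proof -
  interpret u: bounded_linear u by (rule u)
  note sM = real_subspace[OF M(1)] and sM0 = real_subspace[OF M0(1)]
  define B where "B = M0 \<inter> cball 0 1"
  have "precompact (u ` B)" by (rule compact_onD[OF cpt]) (auto simp: B_def)
  \<comment> \<open>Moving the centers into the image doubles the radius to
    \<open>1 / (4 * C)\<close>, and \<open>C\<close> times that is 1/4, below the Riesz constant
    1/2.\<close>
  then have "covered (1 / (8 * C)) (u ` B)" using C(1) by (auto intro: precompactD)
  then obtain F where F: "finite F" "F \<subseteq> u ` B" "\<And>a. a \<in> u ` B \<Longrightarrow> \<exists>x\<in>F. dist x a \<le> 2 * (1 / (8 * C))"
    by (rule covered_subset_centers) blast
  obtain X where X: "X \<subseteq> B" "finite X" "F = u ` X"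
    using finite_subset_image[OF F(1,2)] by blast
  define N where "N = real_vector.span (M \<union> X)"
  have subN: "real_vector.subspace N" unfolding N_def by (rule real_vector.subspace_span)
  have closedN: "closed N" unfolding N_def by (rule closed_span_Un_finite[OF sM M(2) X(2)])
  have NM0: "N \<subseteq> M0"
    unfolding N_def using M0(2) X(1) by (intro real_vector.span_minimal sM0) (auto simp: B_def)
  have "M0 \<subseteq> N"
  proof (rule ccontr)
    assume "\<not> M0 \<subseteq> N"
    then obtain x where "x \<in> M0" "x \<notin> N" by blast
    then obtain y where y: "y \<in> M0" "norm y = 1" "\<And>l. l \<in> N \<Longrightarrow> 1/2 \<le> norm (y - l)"
      using riesz_vector[OF subN closedN sM0 NM0] by blast
    then have "u y \<in> u ` B" by (auto simp: B_def)
    then obtain z where z: "z \<in> X" "norm (u z - u y) \<le> 2 * (1 / (8 * C))"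
      using F(3) X(3) by (auto simp: dist_norm)
    obtain e where e: "e \<in> M" "norm (y - z - e) \<le> C * norm (u (y - z))" using C(2) by blast
    have "z + e \<in> N"
      unfolding N_def using z(1) e(1) by (intro real_vector.span_add real_vector.span_base) auto
    then have "1/2 \<le> norm (y - z - e)" using y(3)[of "z + e"] by (simp add: diff_diff_eq)
    also have "\<dots> \<le> C * (2 * (1 / (8 * C)))"
      using e(2) mult_left_mono[OF z(2), of C] C(1) by (simp add: u.diff norm_minus_commute)
    also have "\<dots> = 1/4" using C(1) by simp
    finally show False by simp
  qed
  also have "N \<subseteq> span (M \<union> X)"
    unfolding N_def by (intro real_vector.span_minimal real_subspace subspace_span span_superset)
  finally show ?thesis
    unfolding finite_dim_quotient_def using X(1,2) by (intro exI[of _ X]) (auto simp: B_def)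
qed

end

section \<open>Coverings modulo a subspace\<close>

definition near_covered :: "real \<Rightarrow> 'a::real_normed_vector set \<Rightarrow> 'a set \<Rightarrow> bool"
  where "near_covered r Y E \<longleftrightarrow> (\<exists>F. finite F \<and> (\<forall>z\<in>E. \<exists>x\<in>F. \<exists>y\<in>Y. norm (z - x - y) \<le> r))"

text \<open>
  In the quotient of the bounded sequences by the precompact ones, \<open>compactly_controls s Y\<close> says that
  the norm modulo the sequences in \<open>Y\<close> is controlled by the norm of the image under \<open>s\<close>.
\<close>

definition compactly_controls :: "('a::real_normed_vector \<Rightarrow> 'b::metric_space) \<Rightarrow> 'a set \<Rightarrow> bool"
  where "compactly_controls s Y \<longleftrightarrow>
    (\<exists>C>0. \<forall>E e. bounded E \<longrightarrow> 0 < e \<longrightarrow> covered e (s ` E) \<longrightarrow> near_covered (C * e) Y E)"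

lemma near_covered_pieces:
  assumes "finite I" "\<And>i. i \<in> I \<Longrightarrow> near_covered r Y (B i)" "E \<subseteq> (\<Union>i\<in>I. B i)"
  shows "near_covered r Y E"
proof -
  from assms(2) obtain F where F: "\<And>i. i \<in> I \<Longrightarrow> finite (F i) \<and> (\<forall>z\<in>B i. \<exists>x\<in>F i. \<exists>y\<in>Y. norm (z - x - y) \<le> r)"
    unfolding near_covered_def by metis
  show ?thesis
    unfolding near_covered_def
  proof (intro exI[of _ "\<Union>i\<in>I. F i"] conjI ballI)
    show "finite (\<Union>i\<in>I. F i)" using F assms(1) by blast
    fix z assume "z \<in> E"
    then obtain i where "i \<in> I" "z \<in> B i" using assms(3) by blast
    then show "\<exists>x\<in>\<Union>i\<in>I. F i. \<exists>y\<in>Y. norm (z - x - y) \<le> r" using F[of i] by blast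
  qed
qed

lemma separated_sequence_if_not_near_covered:
  assumes "\<not> near_covered r Y E"
  obtains e :: "nat \<Rightarrow> 'a::real_normed_vector"
    where "\<And>k. e k \<in> E" "\<And>k l y. l < k \<Longrightarrow> y \<in> Y \<Longrightarrow> r < norm (e k - e l - y)"
proof -
  have "\<exists>z\<in>E. \<forall>x\<in>F. \<forall>y\<in>Y. r < norm (z - x - y)" if "finite F" for F
  proof (rule ccontr)
    assume "\<not> ?thesis"
    then have "near_covered r Y E"
      unfolding near_covered_def using that by (intro exI[of _ F]) (auto simp: not_less)
    with assms show False ..
  qed
  then obtain pick where pick: "\<And>F. finite F \<Longrightarrow> pick F \<in> E \<and> (\<forall>x\<in>F. \<forall>y\<in>Y. r < norm (pick F - x - y))"
    by metis
  define G where "G = rec_nat {} (\<lambda>n F. insert (pick F) F)"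
  have G0: "G 0 = {}" and GS: "G (Suc n) = insert (pick (G n)) (G n)" for n by (simp_all add: G_def)
  have fin: "finite (G n)" for n by (induction n) (simp_all add: G0 GS)
  have mem: "pick (G l) \<in> G k" if "l < k" for k l
    using that by (induction k) (auto simp: GS less_Suc_eq)
  show ?thesis
    by (rule that[of "\<lambda>n. pick (G n)"]) (use pick[OF fin] mem in blast)+
qed

text \<open>Failure of control with the constant \<open>4 / \<eta>\<close> gives vectors that are
  spread out modulo \<open>Y\<close> although their images are close. The radius is tuned so that
  vectors separated at \<rho> still lie within \<open>2 * \<rho>\<close> of one translate of
  \<open>Y\<close>; subtracting elements of \<open>Y\<close> and dividing by \<rho> bounds them by
  2.\<close>

lemma exists_separated_small_images:
  fixes s :: "'a::real_normed_vector \<Rightarrow> 'b::banach"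
  assumes s: "bounded_linear s" and Y: "subspace Y" and cpt: "compact_on s Y"
    and neg: "\<not> compactly_controls s Y" and \<eta>: "\<eta> > 0"
  obtains w :: "nat \<Rightarrow> 'a" where "\<And>k. norm (w k) \<le> 2"
    "\<And>k l y. k < l \<Longrightarrow> y \<in> Y \<Longrightarrow> 1 < norm (w k - w l - y)" "\<And>k l. norm (s (w k - w l)) \<le> \<eta>"
proof -
  interpret s: bounded_linear s by (rule s)
  define C where "C = 4 / \<eta>"
  have "C > 0" using \<eta> by (simp add: C_def)
  then obtain E e where E: "bounded E" and e: "e > 0" and cov: "covered e (s ` E)"
    and nE: "\<not> near_covered (C * e) Y E"
    using neg unfolding compactly_controls_def by meson
  obtain R where R: "R > 0" "\<And>x. x \<in> E \<Longrightarrow> norm x \<le> R" using E by (auto simp: bounded_pos)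
  define \<rho>0 where "\<rho>0 = C * e"
  have \<rho>0: "\<rho>0 > 0" using \<open>C > 0\<close> e by (simp add: \<rho>0_def)
  obtain j0 :: nat where j0: "R / \<rho>0 < 2 ^ j0" using real_arch_pow[of 2 "R / \<rho>0"] by auto
  have "near_covered (2 ^ j0 * \<rho>0) Y E"
    unfolding near_covered_def
  proof (intro exI[of _ "{0}"] conjI ballI)
    fix z assume "z \<in> E"
    then have "norm (z - 0 - 0) \<le> 2 ^ j0 * \<rho>0"
      using R(2)[of z] j0 \<rho>0 by (simp add: divide_less_eq)
    then show "\<exists>x\<in>{0}. \<exists>y\<in>Y. norm (z - x - y) \<le> 2 ^ j0 * \<rho>0" using subspace_0[OF Y] by blast
  qed simp
  \<comment> \<open>Minimality of \<open>j\<close> gives failure at \<rho> and success at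
    \<open>2 * \<rho>\<close>; \<open>j\<close> is positive since the covering fails at
    \<open>C * e\<close>.\<close>
  then obtain j where j: "near_covered (2 ^ j * \<rho>0) Y E" "\<And>i. i < j \<Longrightarrow> \<not> near_covered (2 ^ i * \<rho>0) Y E"
    using exists_least_iff[of "\<lambda>j. near_covered (2 ^ j * \<rho>0) Y E"] by blast
  have "j \<noteq> 0" using j(1) nE by (auto simp: \<rho>0_def intro: gr0I)
  then obtain i where i: "j = Suc i" by (cases j) auto
  define \<rho> where "\<rho> = 2 ^ i * \<rho>0"
  have "1 * \<rho>0 \<le> 2 ^ i * \<rho>0" using \<rho>0 by (intro mult_right_mono) auto
  then have \<rho>: "\<rho> > 0" "C * e \<le> \<rho>" using \<rho>0 by (auto simp: \<rho>_def \<rho>0_def)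
  have n\<rho>: "\<not> near_covered \<rho> Y E" using j(2)[of i] i by (simp add: \<rho>_def)
  have "near_covered (2 * \<rho>) Y E" using j(1) i by (simp add: \<rho>_def mult.assoc)
  then obtain F where F: "finite F" "\<And>z. z \<in> E \<Longrightarrow> \<exists>x\<in>F. \<exists>y\<in>Y. norm (z - x - y) \<le> 2 * \<rho>"
    unfolding near_covered_def by blast
  define P where "P x = {z\<in>E. \<exists>y\<in>Y. norm (z - x - y) \<le> 2 * \<rho>}" for x
  have "E \<subseteq> (\<Union>x\<in>F. P x)" using F(2) by (auto simp: P_def)
  then obtain x where x: "x \<in> F" "\<not> near_covered \<rho> Y (P x)"
    using near_covered_pieces[OF F(1), of \<rho> Y P E] n\<rho> by blast
  obtain z :: "nat \<Rightarrow> 'a" where z: "\<And>k. z k \<in> P x"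
    "\<And>k l y. l < k \<Longrightarrow> y \<in> Y \<Longrightarrow> \<rho> < norm (z k - z l - y)"
    using separated_sequence_if_not_near_covered[OF x(2)] by blast
  have "\<exists>m. m \<in> Y \<and> norm (z k - x - m) \<le> 2 * \<rho>" for k using z(1)[of k] by (auto simp: P_def)
  then obtain m where m: "\<And>k. m k \<in> Y" "\<And>k. norm (z k - x - m k) \<le> 2 * \<rho>" by metis
  have zE: "z k \<in> E" for k using z(1) by (auto simp: P_def)
  have "norm (m k) \<le> R + norm x + 2 * \<rho>" for k
  proof -
    have "m k = z k - x - (z k - x - m k)" by simp
    then have "norm (m k) \<le> norm (z k) + norm x + norm (z k - x - m k)"
      by (metis add_right_mono norm_triangle_ineq4 order_trans)
    then show ?thesis using R(2)[OF zE, of k] m(2)[of k] by linarith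
  qed
  then have "bounded (range m)" by (auto simp: bounded_iff)
  then have "precompact (s ` range m)" using m(1) by (intro compact_onD[OF cpt]) auto
  then have "covered e (s ` range m)" using e by (rule precompactD)
  then obtain F2 where F2: "finite F2" "\<And>a. a \<in> s ` range m \<Longrightarrow> \<exists>x\<in>F2. dist x a \<le> e"
    by (rule coveredE) blast
  obtain F1 where F1: "finite F1" "\<And>a. a \<in> s ` E \<Longrightarrow> \<exists>x\<in>F1. dist x a \<le> e"
    using cov by (rule coveredE) blast
  have "\<exists>p q. p \<in> F1 \<and> q \<in> F2 \<and> dist p (s (z k)) \<le> e \<and> dist q (s (m k)) \<le> e" for k
    using F1(2)[of "s (z k)"] F2(2)[of "s (m k)"] zE by blast
  then obtain p q where pq: "\<And>k. p k \<in> F1 \<and> q k \<in> F2 \<and> dist (p k) (s (z k)) \<le> e \<and> dist (q k) (s (m k)) \<le> e"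
    by metis
  \<comment> \<open>Pigeonhole: on a subsequence the images of \<open>z\<close> share one center and
    those of \<open>m\<close> another, so the images of differences of \<open>v\<close> are within
    \<open>4 * e\<close>. That is at most \<open>\<eta> * \<rho>\<close>, as
    \<open>C * e <= \<rho>\<close>.\<close>
  have "finite (range (\<lambda>k. (p k, q k)))"
    by (rule finite_subset[of _ "F1 \<times> F2"]) (use pq F1(1) F2(1) in auto)
  then obtain k0 where H: "infinite {k \<in> UNIV. (p k, q k) = (p k0, q k0)}"
    using pigeonhole_infinite[of UNIV "\<lambda>k. (p k, q k)"] infinite_UNIV_nat by auto
  define f where "f = enumerate {k \<in> UNIV. (p k, q k) = (p k0, q k0)}"
  have f: "strict_mono f" unfolding f_def by (rule strict_mono_enumerate[OF H])
  have fpq: "p (f k) = p k0" "q (f k) = q k0" for k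
    using enumerate_in_set[OF H, of k] by (auto simp: f_def)
  define v where "v k = z (f k) - x - m (f k)" for k
  have vdiff: "v k - v l = (z (f k) - z (f l)) - (m (f k) - m (f l))" for k l by (simp add: v_def)
  show ?thesis
  proof (rule that[of "\<lambda>k. (1/\<rho>) *\<^sub>R v k"])
    show "norm ((1/\<rho>) *\<^sub>R v k) \<le> 2" for k
      using m(2)[of "f k"] \<rho> by (simp add: v_def divide_le_eq)
    show "1 < norm ((1/\<rho>) *\<^sub>R v k - (1/\<rho>) *\<^sub>R v l - y)" if "k < l" "y \<in> Y" for k l y
    proof -
      have "m (f k) - m (f l) + \<rho> *\<^sub>R y \<in> Y"
        by (intro subspace_add subspace_diff subspace_scale Y m that)
      then have "- (m (f k) - m (f l) + \<rho> *\<^sub>R y) \<in> Y" using subspace_neg[OF Y] by blast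
      then have "\<rho> < norm (z (f l) - z (f k) - (- (m (f k) - m (f l) + \<rho> *\<^sub>R y)))"
        using strict_monoD[OF f that(1)] by (intro z(2))
      also have "z (f l) - z (f k) - (- (m (f k) - m (f l) + \<rho> *\<^sub>R y))
          = - (\<rho> *\<^sub>R ((1/\<rho>) *\<^sub>R v k - (1/\<rho>) *\<^sub>R v l - y))"
        using \<rho>(1) by (simp add: scaleR_diff_right v_def)
      finally show ?thesis using \<rho>(1) by simp
    qed
    show "norm (s ((1/\<rho>) *\<^sub>R v k - (1/\<rho>) *\<^sub>R v l)) \<le> \<eta>" for k l
    proof -
      have "dist (s (z (f k))) (s (z (f l))) \<le> 2 * e"
        using pq[of "f k"] pq[of "f l"] dist_triangle3[of "s (z (f k))" "s (z (f l))" "p k0"]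
        by (auto simp: fpq)
      moreover have "dist (s (m (f k))) (s (m (f l))) \<le> 2 * e"
        using pq[of "f k"] pq[of "f l"] dist_triangle3[of "s (m (f k))" "s (m (f l))" "q k0"]
        by (auto simp: fpq)
      moreover have "s (v k - v l) = (s (z (f k)) - s (z (f l))) - (s (m (f k)) - s (m (f l)))"
        by (simp add: vdiff s.diff)
      ultimately have "norm (s (v k - v l)) \<le> 4 * e"
        using norm_triangle_ineq4[of "s (z (f k)) - s (z (f l))" "s (m (f k)) - s (m (f l))"]
        by (simp add: dist_norm)
      then have "norm (s ((1/\<rho>) *\<^sub>R v k - (1/\<rho>) *\<^sub>R v l)) \<le> (4 * e) / \<rho>"
        using \<rho>(1) by (simp add: scaleR_diff_right[symmetric] s.scaleR divide_right_mono)
      also have "\<dots> \<le> (4 * e) / (C * e)" using \<rho> \<open>C > 0\<close> e by (intro divide_left_mono) auto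
      also have "\<dots> = \<eta>" using e \<eta> by (simp add: C_def)
      finally show ?thesis .
    qed
  qed
qed

section \<open>Compact balls of scalars and extensions by a line\<close>

lemma compact_cball_scalar: "compact (cball (0 :: 'k::real_or_complex) R)"
proof -
  obtain f :: "'k \<Rightarrow> complex" where f1: "f 1 = 1" and
    f: "\<And>r x. f (r *\<^sub>R x) = complex_of_real r * f x" "\<And>x y. f (x + y) = f x + f y"
      "\<And>x. cmod (f x) = norm x" and rng: "range f = \<real> \<or> range f = UNIV"
    using real_or_complex[where 'a='k] by blast
  have lin: "linear f"
    by (rule linearI) (simp_all only: f(1,2) scaleR_conv_of_real[where 'a=complex])
  have iso: "dist (f x) (f y) = dist x y" for x y
    by (simp add: dist_norm linear_diff[OF lin, symmetric] f(3))
  have inj: "inj f" by (rule injI) (metis iso dist_eq_0_iff)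
  define K where "K = range f \<inter> cball 0 R"
  have "closed (range f)" using rng closed_complex_Reals by auto
  then have "compact K" unfolding K_def by (intro closed_Int_compact compact_cball)
  moreover have "continuous_on K (inv_into UNIV f)"
    unfolding continuous_on_iff
  proof (intro ballI allI impI)
    fix e :: real and c assume "c \<in> K" "0 < e"
    moreover have "dist (inv_into UNIV f y) (inv_into UNIV f c) = dist y c" if "y \<in> K" "c \<in> K" for y
      using that by (auto simp: K_def inv_f_f[OF inj] iso)
    ultimately show "\<exists>d>0. \<forall>x'\<in>K. dist x' c < d \<longrightarrow> dist (inv_into UNIV f x') (inv_into UNIV f c) < e" by auto
  qed
  ultimately have "compact (inv_into UNIV f ` K)" by (rule compact_continuous_image[rotated])
  moreover have "inv_into UNIV f ` K = cball 0 R"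
  proof
    show "inv_into UNIV f ` K \<subseteq> cball 0 R" by (auto simp: K_def inv_f_f[OF inj] f(3))
    show "cball 0 R \<subseteq> inv_into UNIV f ` K"
    proof
      fix c :: 'k assume "c \<in> cball 0 R"
      then have "f c \<in> K" by (auto simp: K_def f(3))
      then show "c \<in> inv_into UNIV f ` K" by (rule rev_image_eqI) (simp add: inv_f_f[OF inj])
    qed
  qed
  ultimately show ?thesis by simp
qed

lemma covered_cball_scalar: "e > 0 \<Longrightarrow> covered e (cball (0 :: 'k::real_or_complex) R)"
proof -
  assume e: "e > 0"
  obtain F where F: "finite F" "cball (0 :: 'k) R \<subseteq> (\<Union>x\<in>F. ball x e)"
    using compact_cball_scalar[where 'k='k, of R] e unfolding compact_eq_totally_bounded by blast
  show ?thesis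
  proof (rule coveredI[OF F(1)])
    fix a :: 'k assume "a \<in> cball 0 R"
    then obtain x where "x \<in> F" "a \<in> ball x e" using F(2) by blast
    then show "\<exists>x\<in>F. dist x a \<le> e" by (auto intro!: bexI[of _ x])
  qed
qed

context banach_over
begin

lemma smul_scaleR: "smul c (r *\<^sub>R x) = r *\<^sub>R smul c x"
  by (metis mult.commute scale_scale smul_of_real)

lemma bounded_linear_smul: "bounded_linear (smul c)"
  by (rule bounded_linear_intro[of _ "norm c"])
    (simp_all add: scale_right_distrib smul_scaleR norm_smul mult.commute)

lemma norm_scalar_le:
  assumes Y: "subspace Y" "y \<in> Y" and sep: "\<And>y. y \<in> Y \<Longrightarrow> 1 < norm (x - y)"
    and n: "norm (y + smul t x) \<le> r"
  shows "norm t \<le> r"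
proof (cases "t = 0")
  case True
  then show ?thesis using n order_trans[OF norm_ge_zero[of y]] by simp
next
  case False
  have "smul (- inverse t) y \<in> Y" by (intro subspace_scale Y)
  then have "norm t * 1 \<le> norm t * norm (x - smul (- inverse t) y)"
    by (rule mult_left_mono[OF less_imp_le[OF sep] norm_ge_zero])
  also have "\<dots> = norm (smul t (x - smul (- inverse t) y))" by (simp add: norm_smul)
  also have "smul t (x - smul (- inverse t) y) = y + smul t x"
    using False by (simp add: scale_right_distrib)
  finally show ?thesis using n by simp
qed

lemma precompact_smul_cball: "precompact ((\<lambda>t. smul t x) ` cball 0 R)"
  unfolding precompact_def
proof (intro allI impI)
  fix e :: real assume e: "e > 0"
  have n1: "norm x + 1 > 0" by (intro add_nonneg_pos) auto
  have "covered (norm x * (e / (norm x + 1))) ((\<lambda>t. smul t x) ` cball 0 R)"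
  proof (rule covered_image)
    show "covered (e / (norm x + 1)) (cball (0 :: 'k) R)"
      using e n1 by (intro covered_cball_scalar divide_pos_pos)
    show "dist (smul t x) (smul t' x) \<le> norm x * dist t t'" for t t'
      by (simp add: dist_norm scale_left_diff_distrib[symmetric] norm_smul mult.commute)
  qed simp
  moreover have "norm x * (e / (norm x + 1)) \<le> e"
    using e n1 by (simp add: pos_divide_le_eq algebra_simps)
  ultimately show "covered e ((\<lambda>t. smul t x) ` cball 0 R)" by (rule covered_mono) simp
qed

text \<open>The separation of \<open>x\<close> from \<open>Y\<close> bounds both components of a
  bounded vector \<open>y + smul t x\<close>; its image is a value on a bounded part of
  \<open>Y\<close> plus a multiple of \<open>s x\<close> with bounded coefficient.\<close>

lemma compact_on_extend_line:
  fixes s :: "'a \<Rightarrow> 'a"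
  assumes s: "bounded_linear s" "\<And>c x. s (smul c x) = smul c (s x)" and Y: "subspace Y" "compact_on s Y"
    and sep: "\<And>y. y \<in> Y \<Longrightarrow> 1 < norm (x - y)"
  shows "compact_on s {y + smul t x | y t. y \<in> Y}"
  unfolding compact_on_iff
proof (intro allI impI)
  interpret s: bounded_linear s by (rule s)
  fix B assume B: "B \<subseteq> {y + smul t x | y t. y \<in> Y}" "bounded B"
  obtain R where R: "R > 0" "\<And>z. z \<in> B \<Longrightarrow> norm z \<le> R" using B(2) by (auto simp: bounded_pos)
  have "precompact (s ` (Y \<inter> cball 0 (R + R * norm x)))"
    by (rule compact_onD[OF Y(2)]) auto
  then show "precompact (s ` B)"
  proof (rule precompact_sum[OF _ precompact_smul_cball[of "s x" R]])
    fix c assume "c \<in> s ` B"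
    then obtain z where z: "z \<in> B" "c = s z" by blast
    then obtain y t where yt: "y \<in> Y" "z = y + smul t x" using B(1) by blast
    have t: "norm t \<le> R" using norm_scalar_le[OF Y(1) yt(1) sep, of t R] R(2)[OF z(1)] yt(2) by simp
    have "norm y \<le> norm z + norm (smul t x)" using yt(2) by (metis norm_triangle_ineq4 add_diff_cancel)
    also have "\<dots> \<le> R + R * norm x"
      using R(2)[OF z(1)] t by (auto simp: norm_smul intro!: add_mono mult_right_mono)
    finally show "\<exists>a\<in>s ` (Y \<inter> cball 0 (R + R * norm x)). \<exists>b\<in>(\<lambda>t. smul t (s x)) ` cball 0 R. c = a + b"
      using yt t z s(2) by (intro bexI[of _ "s y"] bexI[of _ "smul t (s x)"]) (auto simp: s.add)
  qed
qed

text \<open>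
  If every difference of the sequence failed, Ramsey's theorem would give a path
  \<open>k\<^sub>0 < k\<^sub>1 < \<dots> < k\<^sub>n\<close> along which the witnesses of failure nearly agree; in their average the
  differences telescope, and the average is an admissible approximation after all.
\<close>

lemma exists_almost_norm_preserving_extension:
  fixes s :: "'a \<Rightarrow> 'a"
  assumes s: "bounded_linear s" "\<And>c x. s (smul c x) = smul c (s x)" and Y: "subspace Y" "compact_on s Y"
    and neg: "\<not> compactly_controls s Y" and \<delta>: "\<delta> > 0" and \<eta>: "\<eta> > 0"
  obtains x where "\<And>y. y \<in> Y \<Longrightarrow> 1 < norm (x - y)"
    "\<And>y t. y \<in> Y \<Longrightarrow> norm (y + smul t x) \<le> 1 \<Longrightarrow>
      \<exists>y'\<in>Y. norm y' \<le> 1 + \<delta> \<and> norm (s (y + smul t x) - s y') \<le> \<eta>"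
proof -
  interpret s: bounded_linear s by (rule s)
  have "\<eta> / 8 > 0" using \<eta> by simp
  then obtain w :: "nat \<Rightarrow> 'a" where w: "\<And>k. norm (w k) \<le> 2"
    and sep: "\<And>k l y. k < l \<Longrightarrow> y \<in> Y \<Longrightarrow> 1 < norm (w k - w l - y)"
    and small: "\<And>k l. norm (s (w k - w l)) \<le> \<eta> / 8"
    using exists_separated_small_images[OF s(1) real_subspace[OF Y(1)] Y(2) neg] by metis
  have w4: "norm (w k - w l) \<le> 4" for k l
    using norm_triangle_ineq4[of "w k" "w l"] w[of k] w[of l] by simp
  have "\<exists>k l. k < l \<and> (\<forall>y\<in>Y. \<forall>t. norm (y + smul t (w k - w l)) \<le> 1 \<longrightarrow>
      (\<exists>y'\<in>Y. norm y' \<le> 1 + \<delta> \<and> norm (s (y + smul t (w k - w l)) - s y') \<le> \<eta>))"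
  proof (rule ccontr)
    assume "\<not> ?thesis"
    then have neg: "\<not> (\<forall>y\<in>Y. \<forall>t. norm (y + smul t (w k - w l)) \<le> 1 \<longrightarrow>
      (\<exists>y'\<in>Y. norm y' \<le> 1 + \<delta> \<and> norm (s (y + smul t (w k - w l)) - s y') \<le> \<eta>))"
      if "k < l" for k l using that by blast
    \<comment> \<open>A pair \<open>(y, t)\<close> witnesses the failure of
      \<open>w k - w l\<close>: it gives a vector of the unit ball that no admissible vector of
      \<open>Y\<close> matches under \<open>s\<close>.\<close>
    define P where "P k l y t \<longleftrightarrow> y \<in> Y \<and> norm (y + smul t (w k - w l)) \<le> 1 \<and>
        (\<forall>y'\<in>Y. norm y' \<le> 1 + \<delta> \<longrightarrow> \<eta> < norm (s (y + smul t (w k - w l)) - s y'))" for k l y t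
    have "\<exists>y t. P k l y t" if "k < l" for k l
      using neg[OF that] unfolding P_def not_le[symmetric] by blast
    then obtain y t where P: "\<And>k l. k < l \<Longrightarrow> P k l (y k l) (t k l)" by metis
    have yY: "y k l \<in> Y" and yn: "norm (y k l + smul (t k l) (w k - w l)) \<le> 1" if "k < l" for k l
      using P[OF that] by (simp_all add: P_def)
    have far: "\<eta> < norm (s (y k l + smul (t k l) (w k - w l)) - s y')"
      if "k < l" "y' \<in> Y" "norm y' \<le> 1 + \<delta>" for k l y'
      using P[OF that(1)] that(2,3) by (simp add: P_def)
    have tn: "norm (t k l) \<le> 1" if "k < l" for k l
      using norm_scalar_le[OF Y(1) yY[OF that] sep yn, OF that _ that] .
    have yb: "norm (y k l) \<le> 5" if "k < l" for k l
    proof -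
      have "norm (smul (t k l) (w k - w l)) \<le> 1 * 4"
        unfolding norm_smul using tn[OF that] w4 by (intro mult_mono) auto
      moreover have "norm (y k l) \<le> norm (y k l + smul (t k l) (w k - w l)) + norm (smul (t k l) (w k - w l))"
        by (metis norm_triangle_ineq4 add_diff_cancel)
      ultimately show ?thesis using yn[OF that] by simp
    qed
    \<comment> \<open>Half of the allowed excess \<delta> goes to the coefficient error
      \<open>4 * \<tau>\<close>, the other half to the telescoped sum divided by
      \<open>n\<close>.\<close>
    define \<tau> where "\<tau> = \<delta> / 8"
    have \<tau>: "\<tau> > 0" using \<delta> by (simp add: \<tau>_def)
    have "precompact (s ` (Y \<inter> cball 0 5))" by (rule compact_onD[OF Y(2)]) auto
    then have "covered (\<eta> / 8) (s ` (Y \<inter> cball 0 5))" using \<eta> by (intro precompactD) auto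
    then obtain F1 where F1: "finite F1" "\<And>a. a \<in> s ` (Y \<inter> cball 0 5) \<Longrightarrow> \<exists>x\<in>F1. dist x a \<le> \<eta> / 8"
      by (rule coveredE) blast
    obtain F2 :: "'k set" where F2: "finite F2" "\<And>a. a \<in> cball 0 1 \<Longrightarrow> \<exists>x\<in>F2. dist x a \<le> \<tau>"
      using covered_cball_scalar[OF \<tau>] by (rule coveredE) blast
    have "\<exists>c. k < l \<longrightarrow> c \<in> F1 \<times> F2 \<and> dist (fst c) (s (y k l)) \<le> \<eta> / 8 \<and> dist (snd c) (t k l) \<le> \<tau>" for k l
    proof (cases "k < l")
      case True
      then have "s (y k l) \<in> s ` (Y \<inter> cball 0 5)" "t k l \<in> cball 0 1" using yY yb tn by auto
      then obtain p q where "p \<in> F1" "dist p (s (y k l)) \<le> \<eta> / 8" "q \<in> F2" "dist q (t k l) \<le> \<tau>"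
        using F1(2) F2(2) by meson
      then show ?thesis by (intro exI[of _ "(p, q)"]) auto
    qed simp
    then obtain c where c: "\<And>k l. k < l \<Longrightarrow>
        c k l \<in> F1 \<times> F2 \<and> dist (fst (c k l)) (s (y k l)) \<le> \<eta> / 8 \<and> dist (snd (c k l)) (t k l) \<le> \<tau>"
      by metis
    obtain h :: "'a \<times> 'k \<Rightarrow> nat" and N where h: "h ` (F1 \<times> F2) = {i. i < N}" "inj_on h (F1 \<times> F2)"
      using finite_imp_inj_to_nat_seg[of "F1 \<times> F2"] F1(1) F2(1) by auto
    \<comment> \<open>A pair \<open>k < l\<close> is coloured by approximations of
      \<open>s (y k l)\<close> and \<open>t k l\<close>, numbered by \<open>h\<close> because the
      colours in \<open>Ramsey2\<close> are natural numbers. \<open>Min\<close> and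
      \<open>Max\<close> recover the order of an unordered pair.\<close>
    define col where "col A = h (c (Min A) (Max A))" for A
    have col: "col {k, l} = h (c k l)" if "k < l" for k l using that by (simp add: col_def)
    have "\<forall>k\<in>UNIV. \<forall>l\<in>UNIV. k \<noteq> l \<longrightarrow> col {k, l} < N"
    proof (intro ballI impI)
      fix k l :: nat assume "k \<noteq> l"
      then have "Min {k, l} < Max {k, l}" by (auto simp: min_def max_def)
      then have "h (c (Min {k, l}) (Max {k, l})) \<in> h ` (F1 \<times> F2)" using c by blast
      then show "col {k, l} < N" using h(1) by (simp add: col_def)
    qed
    from Ramsey2[OF infinite_UNIV_nat this] obtain H i
      where "H \<subseteq> UNIV \<and> infinite H \<and> i < N \<and> (\<forall>k\<in>H. \<forall>l\<in>H. k \<noteq> l \<longrightarrow> col {k, l} = i)"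
      by (elim exE)
    then have H: "infinite H" "\<forall>k\<in>H. \<forall>l\<in>H. k \<noteq> l \<longrightarrow> col {k, l} = i" by simp_all
    define f where "f = enumerate H"
    have f: "f m < f n" if "m < n" for m n
      using that enumerate_mono[OF _ H(1)] by (simp add: f_def)
    have fH: "f n \<in> H" for n unfolding f_def by (rule enumerate_in_set[OF H(1)])
    define c0 where "c0 = c (f 0) (f 1)"
    define p q where "p = fst c0" and "q = snd c0"
    have cc: "c (f m) (f (Suc m)) = c0" for m
      unfolding c0_def
    proof (rule inj_onD[OF h(2)])
      have "col {f m, f (Suc m)} = i" "col {f 0, f 1} = i"
        using H(2) fH f[of m "Suc m"] f[of 0 1] by (metis less_irrefl lessI, metis less_irrefl zero_less_one)
      then show "h (c (f m) (f (Suc m))) = h (c (f 0) (f 1))" using col f[of m "Suc m"] f[of 0 1] by simp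
    qed (use c f in auto)
    define a b x where "a m = y (f m) (f (Suc m))" and "b m = t (f m) (f (Suc m))"
      and "x m = w (f m) - w (f (Suc m))" for m
    have ap: "norm (s (a m) - p) \<le> \<eta> / 8" and bq: "norm (b m - q) \<le> \<tau>" for m
      using c[OF f, of m "Suc m"] by (auto simp: cc p_def q_def a_def b_def dist_norm norm_minus_commute)
    have aY: "a m \<in> Y" and abn: "norm (a m + smul (b m) (x m)) \<le> 1" and bn: "norm (b m) \<le> 1"
      and xn: "norm (x m) \<le> 4" for m
      using yY[OF f, of m "Suc m"] yn[OF f, of m "Suc m"] tn[OF f, of m "Suc m"] w4
      by (auto simp: a_def b_def x_def)
    have qn: "norm q \<le> 1 + \<tau>"
    proof -
      have "norm q \<le> norm (b 0) + norm (b 0 - q)"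
        using norm_triangle_ineq4[of "b 0" "b 0 - q"] by simp
      then show ?thesis using bn[of 0] bq[of 0] by simp
    qed
    obtain n :: nat where n: "8 * (1 + \<tau>) / \<delta> < real n" using reals_Archimedean2 by blast
    have n0: "real n > 0" using n \<delta> \<tau> by (smt (verit) divide_nonneg_pos)
    define avg where "avg = (1 / real n) *\<^sub>R (\<Sum>m<n. a m)"
    \<comment> \<open>The sum of the differences along the path has norm at most 4 whatever
      \<open>n\<close> is, so division by \<open>n\<close> makes it negligible.\<close>
    have tel: "(\<Sum>m<n. x m) = w (f 0) - w (f n)"
      unfolding x_def by (rule sum_lessThan_telescope')
    have "(\<Sum>m<n. a m) = (\<Sum>m<n. a m + smul (b m) (x m)) - smul q (w (f 0) - w (f n))
        - (\<Sum>m<n. smul (b m - q) (x m))"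
      unfolding tel[symmetric] scale_sum_right
      by (simp add: scale_left_diff_distrib sum.distrib sum_subtractf)
    moreover have "norm (A - B - D) \<le> norm A + norm B + norm D" for A B D :: 'a
      using norm_triangle_ineq4[of "A - B" D] norm_triangle_ineq4[of A B] by linarith
    ultimately have "norm (\<Sum>m<n. a m) \<le> norm (\<Sum>m<n. a m + smul (b m) (x m)) + norm (smul q (w (f 0) - w (f n)))
        + norm (\<Sum>m<n. smul (b m - q) (x m))"
      by (simp only:)
    also have "norm (\<Sum>m<n. a m + smul (b m) (x m)) \<le> real n"
      using sum_norm_le[of "{..<n}" "\<lambda>m. a m + smul (b m) (x m)" "\<lambda>_. 1"] abn by simp
    also have "norm (smul q (w (f 0) - w (f n))) \<le> (1 + \<tau>) * 4"
      unfolding norm_smul using qn w4 \<tau> by (intro mult_mono) auto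
    also have "norm (\<Sum>m<n. smul (b m - q) (x m)) \<le> (\<Sum>m<n. \<tau> * 4)"
      unfolding norm_smul by (rule sum_norm_le) (use bq xn \<tau> in \<open>auto simp: norm_smul intro!: mult_mono\<close>)
    finally have "norm (\<Sum>m<n. a m) \<le> real n + (1 + \<tau>) * 4 + real n * (\<tau> * 4)" by simp
    also have "(1 + \<tau>) * 4 \<le> real n * (\<delta> / 2)" using n \<delta> by (simp add: divide_less_eq mult.commute)
    finally have "norm (\<Sum>m<n. a m) \<le> real n * (1 + \<delta>)" by (simp add: \<tau>_def algebra_simps)
    then have avgn: "norm avg \<le> 1 + \<delta>" using n0 by (simp add: avg_def divide_le_eq mult.commute)
    have avgY: "avg \<in> Y"
      unfolding avg_def
      by (intro real_vector.subspace_scale real_vector.subspace_sum real_subspace[OF Y(1)] aY)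
    \<comment> \<open>Every \<open>s (a m)\<close> is near \<open>p\<close>, hence so is
      \<open>s avg\<close>, and \<open>s\<close> is small on the difference vectors. Thus
      \<open>avg\<close> matches the vector of index 0 within \<open>3 * \<eta> / 8\<close>, against
      \<open>far\<close>.\<close>
    have "s avg - p = (1 / real n) *\<^sub>R (\<Sum>m<n. s (a m) - p)"
      using n0 by (simp add: avg_def s.scaleR s.sum sum_subtractf scaleR_diff_right sum_constant_scaleR)
    moreover have "norm (\<Sum>m<n. s (a m) - p) \<le> real n * (\<eta> / 8)"
      using sum_norm_le[of "{..<n}" "\<lambda>m. s (a m) - p" "\<lambda>_. \<eta> / 8"] ap by simp
    ultimately have sp: "norm (s avg - p) \<le> \<eta> / 8" using n0 by (simp add: divide_le_eq mult.commute)
    have "norm (s (smul (b 0) (x 0))) \<le> 1 * (\<eta> / 8)"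
      unfolding s(2) norm_smul using bn[of 0] small[of "f 0" "f 1"] by (intro mult_mono) (auto simp: x_def)
    moreover have eq: "s (a 0 + smul (b 0) (x 0)) - s avg = (s (a 0) - p) - (s avg - p) + s (smul (b 0) (x 0))"
      by (simp add: s.add)
    ultimately have "norm (s (a 0 + smul (b 0) (x 0)) - s avg) \<le> \<eta> / 8 + \<eta> / 8 + \<eta> / 8"
      unfolding eq using ap[of 0] sp norm_triangle_ineq[of "(s (a 0) - p) - (s avg - p)" "s (smul (b 0) (x 0))"]
        norm_triangle_ineq4[of "s (a 0) - p" "s avg - p"] by linarith
    moreover have "\<eta> < norm (s (a 0 + smul (b 0) (x 0)) - s avg)"
      unfolding a_def b_def x_def using far[OF f avgY avgn, of 0 "Suc 0"] by simp
    ultimately show False using \<eta> by simp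
  qed
  then obtain k l where kl: "k < l" and *: "\<forall>y\<in>Y. \<forall>t. norm (y + smul t (w k - w l)) \<le> 1 \<longrightarrow>
      (\<exists>y'\<in>Y. norm y' \<le> 1 + \<delta> \<and> norm (s (y + smul t (w k - w l)) - s y') \<le> \<eta>)" by blast
  show ?thesis by (rule that[of "w k - w l"]) (use sep[OF kl] * in blast)+
qed

text \<open>If control failed for every admissible extension, a vector could be adjoined again and
  again with summable losses, and \<open>s\<close> would be compact on the union too. Essential
  maximality makes the union finite-dimensional over \<open>M\<close>, so it is exhausted at a
  finite stage, although every stage is extended strictly.\<close>

lemma exists_compactly_controlling_extension:
  fixes s :: "'a \<Rightarrow> 'a"
  assumes s: "bounded_linear s" "\<And>c x. s (smul c x) = smul c (s x)"
    and max: "essentially_maximal_subspace smul (compact_on s) M"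
  obtains Y where "subspace Y" "M \<subseteq> Y" "compact_on s Y" "compactly_controls s Y"
proof (rule ccontr)
  note extension = that
  assume no: "\<not> thesis"
  interpret s: bounded_linear s by (rule s)
  define good where "good Y \<longleftrightarrow> subspace Y \<and> M \<subseteq> Y \<and> compact_on s Y" for Y
  have neg: "\<not> compactly_controls s Y" if "good Y" for Y
  proof
    assume "compactly_controls s Y"
    with that have thesis by (intro extension) (auto simp: good_def)
    with no show False ..
  qed
  \<comment> \<open>Stage \<open>n\<close> may cost a factor \<open>1 + 2^-n / 4\<close> in norm and
    an error \<open>2^-n\<close> in the image; with these values the bounds in \<open>down\<close>
    are stable under induction.\<close>
  define step where "step n Y Y' \<longleftrightarrow> Y \<subseteq> Y' \<and> \<not> Y' \<subseteq> Y \<and>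
    (\<forall>z\<in>Y'. norm z \<le> 1 \<longrightarrow> (\<exists>y\<in>Y. norm y \<le> 1 + (1/2)^n / 4 \<and> norm (s z - s y) \<le> (1/2)^n))" for n :: nat and Y Y'
  have ex: "\<exists>Y'. good Y' \<and> step n Y Y'" if Y: "good Y" for n Y
  proof -
    have sY: "subspace Y" and MY: "M \<subseteq> Y" and cY: "compact_on s Y" using Y by (auto simp: good_def)
    obtain x where x: "\<And>y. y \<in> Y \<Longrightarrow> 1 < norm (x - y)"
      "\<And>y t. y \<in> Y \<Longrightarrow> norm (y + smul t x) \<le> 1 \<Longrightarrow>
        \<exists>y'\<in>Y. norm y' \<le> 1 + (1/2)^n / 4 \<and> norm (s (y + smul t x) - s y') \<le> (1/2)^n"
      using exists_almost_norm_preserving_extension[OF s sY cY neg[OF Y], of "(1/2)^n / 4" "(1/2)^n"]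
      by (metis divide_pos_pos zero_less_divide_1_iff zero_less_numeral zero_less_power)
    define Y' where "Y' = {y + smul t x | y t. y \<in> Y}"
    have in_Y': "y + smul t x \<in> Y'" if "y \<in> Y" for y t using that by (auto simp: Y'_def)
    have "subspace Y'"
      unfolding subspace_def
    proof (intro conjI ballI allI)
      show "0 \<in> Y'" using in_Y'[OF subspace_0[OF sY], of 0] by simp
      fix a assume "a \<in> Y'"
      then obtain y t where a: "a = y + smul t x" "y \<in> Y" by (auto simp: Y'_def)
      have "smul c y + smul (c * t) x \<in> Y'" for c by (intro in_Y' subspace_scale sY a)
      then show "smul c a \<in> Y'" for c by (simp add: a scale_right_distrib)
      fix b assume "b \<in> Y'"
      then obtain y' t' where b: "b = y' + smul t' x" "y' \<in> Y" by (auto simp: Y'_def)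
      have "(y + y') + smul (t + t') x \<in> Y'" by (intro in_Y' subspace_add sY a b)
      then show "a + b \<in> Y'" by (simp add: a b scale_left_distrib algebra_simps)
    qed
    moreover have YY: "Y \<subseteq> Y'" using in_Y'[of _ 0] by auto
    moreover have "compact_on s Y'" unfolding Y'_def by (rule compact_on_extend_line[OF s sY cY x(1)])
    moreover have "x \<in> Y'" using in_Y'[OF subspace_0[OF sY], of 1] by simp
    moreover have "x \<notin> Y" using x(1)[of x] by auto
    ultimately have "good Y'" "\<not> Y' \<subseteq> Y" using MY by (auto simp: good_def)
    moreover have "\<forall>z\<in>Y'. norm z \<le> 1 \<longrightarrow>
        (\<exists>y\<in>Y. norm y \<le> 1 + (1/2)^n / 4 \<and> norm (s z - s y) \<le> (1/2)^n)"
      unfolding Y'_def using x(2) by blast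
    ultimately show ?thesis using YY unfolding step_def by blast
  qed
  have M: "good M" using max by (auto simp: good_def essentially_maximal_subspace_def)
  obtain Y where Y: "\<And>n. good (Y n)" "\<And>n. step n (Y n) (Y (Suc n))"
    using dependent_nat_choice[of "\<lambda>_. good" step] M ex by blast
  have "Y n \<subseteq> Y (Suc n)" for n using Y(2)[of n] by (simp add: step_def)
  then have mono: "Y i \<subseteq> Y j" if "i \<le> j" for i j using that by (rule lift_Suc_mono_le)
  have sub: "subspace (Y n)" for n using Y(1) by (simp add: good_def)
  define U where "U = (\<Union>n. Y n)"
  have subU: "subspace U"
    unfolding subspace_def
  proof (intro conjI ballI allI)
    show "0 \<in> U" using subspace_0[OF sub] by (auto simp: U_def)
    fix x assume "x \<in> U"
    then obtain i where i: "x \<in> Y i" by (auto simp: U_def)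
    then show "smul c x \<in> U" for c using subspace_scale[OF sub] by (auto simp: U_def)
    fix y assume "y \<in> U"
    then obtain j where "y \<in> Y j" by (auto simp: U_def)
    then have "x + y \<in> Y (max i j)" using i mono[of i "max i j"] mono[of j "max i j"]
      by (intro subspace_add sub) auto
    then show "x + y \<in> U" by (auto simp: U_def)
  qed
  have MU: "M \<subseteq> U" using Y(1)[of 0] by (auto simp: good_def U_def)
  have step': "\<exists>y\<in>Y n. norm y \<le> (1 + (1/2)^n / 4) * c \<and> norm (s z - s y) \<le> (1/2)^n * c"
    if z: "z \<in> Y (Suc n)" "norm z \<le> c" "c > 0" for n z c
  proof -
    have "(1/c) *\<^sub>R z \<in> Y (Suc n)" using real_subspace[OF sub] z(1) by (rule real_vector.subspace_scale)
    moreover have "norm ((1/c) *\<^sub>R z) \<le> 1" using z by simp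
    ultimately obtain y where y: "y \<in> Y n" "norm y \<le> 1 + (1/2)^n / 4" "norm (s ((1/c) *\<^sub>R z) - s y) \<le> (1/2)^n"
      using Y(2)[of n] unfolding step_def by blast
    have "s z - s (c *\<^sub>R y) = c *\<^sub>R (s ((1/c) *\<^sub>R z) - s y)" using z by (simp add: s.scaleR scaleR_diff_right)
    moreover have "c * norm (s ((1/c) *\<^sub>R z) - s y) \<le> c * (1/2)^n" using y z by (intro mult_left_mono) auto
    moreover have "c * norm y \<le> c * (1 + (1/2)^n / 4)" using y z by (intro mult_left_mono) auto
    moreover have "c *\<^sub>R y \<in> Y n" using real_subspace[OF sub] y(1) by (rule real_vector.subspace_scale)
    ultimately show ?thesis using z by (intro bexI[of _ "c *\<^sub>R y"]) (auto simp: mult.commute)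
  qed
  \<comment> \<open>Descent from stage \<open>n + k\<close> to stage \<open>n\<close>. The induction
    rests on \<open>(1 + q/4) (1 + q/2) <= 1 + q\<close> and \<open>q (1 + q/2) <= 2 q\<close> for
    \<open>q = 2^-n <= 1\<close>; the image errors form a geometric sum.\<close>
  have down: "\<exists>y\<in>Y n. norm y \<le> (1 + (1/2)^n) \<and> norm (s z - s y) \<le> 4 * ((1/2)^n - (1/2)^(n + k))"
    if "z \<in> Y (n + k)" "norm z \<le> 1" for n k z
    using that
  proof (induction k arbitrary: n)
    case 0
    then show ?case using zero_le_power[of "1/2::real" n] by (intro bexI[of _ z]) (auto simp del: zero_le_power)
  next
    case (Suc k)
    then obtain y where y: "y \<in> Y (Suc n)" "norm y \<le> 1 + (1/2)^Suc n"
      "norm (s z - s y) \<le> 4 * ((1/2)^Suc n - (1/2)^(Suc n + k))" using Suc.IH[of "Suc n"] by auto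
    define q :: real where "q = (1/2)^n"
    have q: "0 < q" "q \<le> 1" by (auto simp: q_def power_le_one)
    have qS: "(1/2)^Suc n = q / 2" by (simp add: q_def)
    obtain y' where y': "y' \<in> Y n" "norm y' \<le> (1 + q / 4) * (1 + q / 2)" "norm (s y - s y') \<le> q * (1 + q / 2)"
      using step'[OF y(1,2)] unfolding qS q_def[symmetric] using q by (auto intro: add_pos_pos)
    have qq: "q * q \<le> q" using mult_left_le[of q q] q by simp
    have "(1 + q / 4) * (1 + q / 2) = 1 + 3 / 4 * q + q * q / 8" by (simp add: algebra_simps)
    then have "(1 + q / 4) * (1 + q / 2) \<le> 1 + q" using qq q by linarith
    moreover have "q * (1 + q / 2) = q + q * q / 2" by (simp add: algebra_simps)
    then have "q * (1 + q / 2) \<le> 2 * q" using qq q by linarith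
    moreover have "norm (s z - s y') \<le> norm (s z - s y) + norm (s y - s y')"
      using norm_triangle_ineq[of "s z - s y" "s y - s y'"] by simp
    ultimately show ?case
      using y y' unfolding qS by (intro bexI[of _ y']) (auto simp flip: q_def)
  qed
  have "compact_on s U"
    unfolding compact_on_iff
  proof (intro allI impI)
    fix B assume B: "B \<subseteq> U" "bounded B"
    obtain R where R: "R > 0" "\<And>z. z \<in> B \<Longrightarrow> norm z \<le> R" using B(2) by (auto simp: bounded_pos)
    show "precompact (s ` B)"
    proof (rule precompact_near)
      fix e :: real assume e: "e > 0"
      then obtain n where n: "(1/2)^n < e / (4 * R)"
        using real_arch_pow_inv[of "e / (4 * R)" "1/2"] R(1) by auto
      let ?A = "s ` (Y n \<inter> cball 0 (2 * R))"
      have "precompact ?A" using Y(1)[of n] by (intro compact_onD[of s "Y n"]) (auto simp: good_def)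
      moreover have "\<exists>a\<in>?A. dist a (s z) \<le> e" if z: "z \<in> B" for z
      proof -
        obtain i where "z \<in> Y i" using B(1) z by (auto simp: U_def)
        then have zY: "z \<in> Y (n + i)" using mono[of i "n + i"] by auto
        have "(1/R) *\<^sub>R z \<in> Y (n + i)" using real_subspace[OF sub] zY by (rule real_vector.subspace_scale)
        moreover have "norm ((1/R) *\<^sub>R z) \<le> 1" using R z by simp
        ultimately obtain y where y: "y \<in> Y n" "norm y \<le> 1 + (1/2)^n"
          "norm (s ((1/R) *\<^sub>R z) - s y) \<le> 4 * ((1/2)^n - (1/2)^(n + i))" using down by blast
        have "(1/2::real)^n \<le> 1" by (simp add: power_le_one)
        then have "norm (R *\<^sub>R y) \<le> 2 * R" using y(2) R(1) by simp
        moreover have "R *\<^sub>R y \<in> Y n" using real_subspace[OF sub] y(1) by (rule real_vector.subspace_scale)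
        moreover have "dist (s (R *\<^sub>R y)) (s z) \<le> e"
        proof -
          have "s z - s (R *\<^sub>R y) = R *\<^sub>R (s ((1/R) *\<^sub>R z) - s y)"
            using R(1) by (simp add: s.scaleR scaleR_diff_right)
          then have "norm (s z - s (R *\<^sub>R y)) = R * norm (s ((1/R) *\<^sub>R z) - s y)" using R(1) by simp
          also have "\<dots> \<le> R * (4 * (1/2)^n)"
          proof (rule mult_left_mono)
            have "4 * ((1/2)^n - (1/2)^(n + i)) \<le> 4 * (1/2::real)^n" by simp
            with y(3) show "norm (s ((1/R) *\<^sub>R z) - s y) \<le> 4 * (1/2)^n" by (rule order_trans)
          qed (use R in simp)
          also have "\<dots> \<le> e" using n R(1) by (simp add: field_simps)
          finally show ?thesis by (simp add: dist_norm norm_minus_commute)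
        qed
        ultimately show ?thesis by (intro bexI[of _ "s (R *\<^sub>R y)"]) auto
      qed
      ultimately show "\<exists>A. covered e A \<and> (\<forall>b\<in>s ` B. \<exists>a\<in>A. dist a b \<le> e)"
        using e by (intro exI[of _ ?A]) (auto intro: precompactD)
    qed
  qed
  then have "finite_dim_quotient smul U M"
    using max subU MU unfolding essentially_maximal_subspace_def by blast
  then obtain B where B: "finite B" "B \<subseteq> U" "U \<subseteq> span (M \<union> B)"
    unfolding finite_dim_quotient_def by blast
  \<comment> \<open>Finitely many generators of \<open>U\<close> over \<open>M\<close> lie in one
    stage, which then contains the next one.\<close>
  have "\<exists>n. B \<subseteq> Y n"
    using B(1,2)
  proof (induction B)
    case (insert b B)
    then obtain i j where "B \<subseteq> Y i" "b \<in> Y j" by (auto simp: U_def)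
    then have "insert b B \<subseteq> Y (max i j)" using mono[of i "max i j"] mono[of j "max i j"] by auto
    then show ?case by blast
  qed simp
  then obtain n where "B \<subseteq> Y n" by blast
  moreover have "M \<subseteq> Y n" using Y(1) by (auto simp: good_def)
  ultimately have "U \<subseteq> Y n" using B(3) span_minimal[OF _ sub, of "M \<union> B" n] by blast
  then have "Y (Suc n) \<subseteq> Y n" by (auto simp: U_def)
  then show False using Y(2)[of n] by (simp add: step_def)
qed

end

section \<open>The Hausdorff noncompactness seminorm\<close>

definition hnorm :: "('a::real_normed_vector \<Rightarrow> 'b::real_normed_vector) \<Rightarrow> real"
  where "hnorm f = Inf {e. covered e (f ` cball 0 1)}"

lemma covered_nonneg: "covered e A \<Longrightarrow> A \<noteq> {} \<Longrightarrow> 0 \<le> e"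
proof -
  assume "covered e A" "A \<noteq> {}"
  then obtain F a where "a \<in> A" "A \<subseteq> (\<Union>x\<in>F. cball x e)" unfolding covered_def by blast
  then obtain x where "dist x a \<le> e" by auto
  then show "0 \<le> e" using zero_le_dist[of x a] by linarith
qed

lemma hnorm_le: "covered e (f ` cball 0 1) \<Longrightarrow> hnorm f \<le> e"
  unfolding hnorm_def
  by (rule cInf_lower) (auto intro!: bdd_belowI[of _ 0] dest: covered_nonneg)

lemma covered_norm:
  assumes "\<And>x. norm x \<le> 1 \<Longrightarrow> norm (f x) \<le> e"
  shows "covered e (f ` cball 0 1)"
  by (rule covered_cball[of _ 0]) (use assms in auto)

lemma ex_covered:
  assumes "bounded_linear f"
  shows "\<exists>e. covered e (f ` cball 0 1)"
proof -
  obtain K where K: "\<And>x. norm (f x) \<le> norm x * K" "K > 0" using bounded_linear.pos_bounded[OF assms] by blast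
  have "norm (f x) \<le> K" if "norm x \<le> 1" for x
    using order_trans[OF K(1) mult_right_mono[OF that]] K(2) by simp
  then show ?thesis by (intro exI covered_norm)
qed

lemma hnorm_nonneg: "bounded_linear f \<Longrightarrow> 0 \<le> hnorm f"
  unfolding hnorm_def using ex_covered[of f] by (intro cInf_greatest) (auto dest: covered_nonneg)

lemma covered_if_hnorm_less:
  assumes "bounded_linear f" "hnorm f < e"
  shows "covered e (f ` cball 0 1)"
proof -
  obtain d where "covered d (f ` cball 0 1)" "d < e"
    using assms(2) ex_covered[OF assms(1)] unfolding hnorm_def
    by (metis (no_types, lifting) cInf_lessD empty_iff mem_Collect_eq)
  then show ?thesis by (auto intro: covered_mono)
qed

lemma hnorm_leI:
  assumes "\<And>e. e > c \<Longrightarrow> covered e (f ` cball 0 1)"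
  shows "hnorm f \<le> c"
  by (rule dense_ge) (blast intro: assms hnorm_le)

lemma hnorm_le_bound:
  assumes "\<And>x. norm x \<le> 1 \<Longrightarrow> norm (f x) \<le> e"
  shows "hnorm f \<le> e"
  by (intro hnorm_le covered_norm assms)

lemma hnorm_add:
  assumes "bounded_linear f" "bounded_linear g"
  shows "hnorm (\<lambda>x. f x + g x) \<le> hnorm f + hnorm g"
proof (rule hnorm_leI)
  fix e assume e: "e > hnorm f + hnorm g"
  define d where "d = (e - (hnorm f + hnorm g)) / 2"
  have "covered (hnorm f + d) (f ` cball 0 1)" "covered (hnorm g + d) (g ` cball 0 1)"
    using e by (auto intro!: covered_if_hnorm_less assms simp: d_def)
  then have "covered ((hnorm f + d) + (hnorm g + d)) ((\<lambda>x. f x + g x) ` cball 0 1)"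
  proof (rule covered_sum)
    fix c assume "c \<in> (\<lambda>x. f x + g x) ` cball 0 1"
    then obtain x where "x \<in> cball 0 1" "c = f x + g x" by blast
    then show "\<exists>a\<in>f ` cball 0 1. \<exists>b\<in>g ` cball 0 1. c = a + b" by blast
  qed
  moreover have "(hnorm f + d) + (hnorm g + d) = e" by (simp add: d_def field_simps)
  ultimately show "covered e ((\<lambda>x. f x + g x) ` cball 0 1)" by simp
qed

lemma hnorm_comp_left:
  assumes f: "bounded_linear f" and g: "bounded_linear g" and K: "\<And>x. norm (f x) \<le> K * norm x" "0 \<le> K"
  shows "hnorm (\<lambda>x. f (g x)) \<le> K * hnorm g"
proof -
  interpret f: bounded_linear f by (rule f)
  have "hnorm (\<lambda>x. f (g x)) \<le> K * e" if "e > hnorm g" for e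
  proof (rule hnorm_le)
    have "covered (K * e) (f ` g ` cball 0 1)"
      by (rule covered_image[OF covered_if_hnorm_less[OF g that]])
        (use K in \<open>auto simp: dist_norm f.diff[symmetric]\<close>)
    then show "covered (K * e) ((\<lambda>x. f (g x)) ` cball 0 1)" by (simp add: image_image)
  qed
  then have "\<forall>\<^sub>F e in at_right (hnorm g). hnorm (\<lambda>x. f (g x)) \<le> K * e"
    by (auto simp: eventually_at_right_field intro!: exI[of _ "hnorm g + 1"])
  moreover have "((\<lambda>e. K * e) \<longlongrightarrow> K * hnorm g) (at_right (hnorm g))" by (intro tendsto_intros)
  ultimately show ?thesis by (intro tendsto_lowerbound) auto
qed

lemma hnorm_scaleR: "bounded_linear f \<Longrightarrow> hnorm (\<lambda>x. c *\<^sub>R f x) \<le> \<bar>c\<bar> * hnorm f"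
  by (rule hnorm_comp_left[OF bounded_linear_scaleR_right]) auto

lemma hnorm_minus:
  assumes "bounded_linear f"
  shows "hnorm (\<lambda>x. - f x) \<le> hnorm f"
  using hnorm_scaleR[OF assms, of "-1"] by simp

lemma hnorm_diff:
  assumes "bounded_linear f" "bounded_linear g"
  shows "hnorm (\<lambda>x. f x - g x) \<le> hnorm f + hnorm g"
  using hnorm_add[OF assms(1) bounded_linear_minus[OF assms(2)]] hnorm_minus[OF assms(2)] by simp

lemma covered_bounded_image:
  assumes f: "bounded_linear f" and "hnorm f < e" and R: "R > 0" "\<And>x. x \<in> E \<Longrightarrow> norm x \<le> R"
  shows "covered (R * e) (f ` E)"
proof -
  interpret f: bounded_linear f by (rule f)
  have "covered (R * e) (scaleR R ` f ` cball 0 1)"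
    by (rule covered_image[OF covered_if_hnorm_less[OF assms(1,2)]])
      (use R in \<open>auto simp: dist_norm scaleR_diff_right[symmetric]\<close>)
  moreover have "f ` E \<subseteq> scaleR R ` f ` cball 0 1"
  proof
    fix z assume "z \<in> f ` E"
    then obtain x where x: "x \<in> E" "z = f x" by blast
    then have "(1/R) *\<^sub>R x \<in> cball 0 1" using R by auto
    moreover have "z = R *\<^sub>R f ((1/R) *\<^sub>R x)" using x R by (simp add: f.scaleR)
    ultimately show "z \<in> scaleR R ` f ` cball 0 1" by blast
  qed
  ultimately show ?thesis by (rule covered_mono[OF _ order_refl])
qed

lemma hnorm_comp_right:
  assumes f: "bounded_linear f" and g: "bounded_linear g" and K: "\<And>x. norm (g x) \<le> K * norm x" "0 < K"
  shows "hnorm (\<lambda>x. f (g x)) \<le> K * hnorm f"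
proof -
  have "hnorm (\<lambda>x. f (g x)) \<le> K * e" if "e > hnorm f" for e
  proof (rule hnorm_le)
    have "norm x \<le> K" if x: "x \<in> g ` cball 0 1" for x
    proof -
      from x obtain y where y: "x = g y" "norm y \<le> 1" by auto
      then show ?thesis using order_trans[OF K(1) mult_left_mono[of "norm y" 1 K]] K(2) by simp
    qed
    then have "covered (K * e) (f ` g ` cball 0 1)" by (intro covered_bounded_image f that K(2))
    then show "covered (K * e) ((\<lambda>x. f (g x)) ` cball 0 1)" by (simp add: image_image)
  qed
  then have "\<forall>\<^sub>F e in at_right (hnorm f). hnorm (\<lambda>x. f (g x)) \<le> K * e"
    by (auto simp: eventually_at_right_field intro!: exI[of _ "hnorm f + 1"])
  moreover have "((\<lambda>e. K * e) \<longlongrightarrow> K * hnorm f) (at_right (hnorm f))" by (intro tendsto_intros)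
  ultimately show ?thesis by (intro tendsto_lowerbound) auto
qed

lemma precompact_image_if_hnorm_zero:
  assumes f: "bounded_linear f" and "hnorm f \<le> 0" and "bounded B"
  shows "precompact (f ` B)"
  unfolding precompact_def
proof (intro allI impI)
  fix e :: real assume e: "e > 0"
  obtain R where R: "R > 0" "\<And>x. x \<in> B \<Longrightarrow> norm x \<le> R" using assms(3) by (auto simp: bounded_pos)
  have "covered (R * (e / R)) (f ` B)"
    by (intro covered_bounded_image f R) (use assms(2) e R in \<open>auto intro: le_less_trans\<close>)
  then show "covered e (f ` B)" using R by simp
qed

lemma hnorm_zero_if_precompact:
  assumes "precompact (f ` cball 0 1)"
  shows "hnorm f \<le> 0"
  by (rule hnorm_leI) (use assms in \<open>auto intro: precompactD\<close>)

lemma precompact_if_hnorm_approx: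
  fixes f :: "'a::real_normed_vector \<Rightarrow> 'b::real_normed_vector"
  assumes g: "\<And>n. bounded_linear (g n)" and lim: "(\<lambda>n::nat. hnorm (g n)) \<longlonglongrightarrow> 0"
    and pre: "\<And>n. precompact ((\<lambda>x. f x - g n x) ` B)" and B: "bounded B"
  shows "precompact (f ` B)"
  unfolding precompact_def
proof (intro allI impI)
  fix e :: real assume e: "e > 0"
  obtain R where R: "R > 0" "\<And>x. x \<in> B \<Longrightarrow> norm x \<le> R" using B by (auto simp: bounded_pos)
  have "\<forall>\<^sub>F n in sequentially. hnorm (g n) < e / (2 * R)" using lim e R by (intro order_tendstoD) auto
  then obtain n where "hnorm (g n) < e / (2 * R)" using eventually_happens'[OF sequentially_bot] by blast
  then have g: "covered (R * (e / (2 * R))) (g n ` B)" by (intro covered_bounded_image g R)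
  have "covered (e/2) ((\<lambda>x. f x - g n x) ` B)" using e by (intro precompactD[OF pre]) auto
  from this g have "covered (e/2 + R * (e / (2 * R))) (f ` B)"
  proof (rule covered_sum)
    fix c assume "c \<in> f ` B"
    then obtain x where x: "x \<in> B" "c = f x" by blast
    have "f x = (f x - g n x) + g n x" by simp
    then show "\<exists>a\<in>(\<lambda>x. f x - g n x) ` B. \<exists>b\<in>g n ` B. c = a + b" using x by blast
  qed
  then show "covered e (f ` B)" using R by simp
qed

section \<open>Essentially sublinear powers\<close>

locale essentially_sublinear = bounded_linear t for t :: "'a::banach \<Rightarrow> 'a" +
  assumes sublinear: "(\<lambda>n. hnorm (t ^^ n) / real n) \<longlonglongrightarrow> 0"
begin

definition D :: "'a \<Rightarrow> 'a" where "D x = x - t x"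

definition part_sum :: "nat \<Rightarrow> 'a \<Rightarrow> 'a" where "part_sum n x = (\<Sum>i<n. (t ^^ i) x)"

definition mean :: "nat \<Rightarrow> 'a \<Rightarrow> 'a" where "mean n x = (1 / (real n + 1)) *\<^sub>R (\<Sum>i\<le>n. (t ^^ i) x)"

text \<open>The quotient of \<open>I - mean n\<close> by \<open>D\<close>, obtained by averaging
  \<open>I - t^i = part_sum i D\<close> over \<open>i <= n\<close>. Its own norm may grow with
  \<open>n\<close>; what is controlled is its product with \<open>D\<close>.\<close>

definition mean_quot :: "nat \<Rightarrow> 'a \<Rightarrow> 'a"
  where "mean_quot n x = (1 / (real n + 1)) *\<^sub>R (\<Sum>i\<le>n. part_sum i x)"

lemma bl_t: "bounded_linear t" ..

lemma bl_pow: "bounded_linear (t ^^ n)" by (rule bounded_linear_funpow[OF bl_t])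

lemma bl_D: "bounded_linear D"
  unfolding D_def[abs_def] by (intro bounded_linear_sub bounded_linear_ident bl_t)

lemma bl_Dpow: "bounded_linear (D ^^ n)" by (rule bounded_linear_funpow[OF bl_D])

lemma bl_part_sum: "bounded_linear (part_sum n)"
  unfolding part_sum_def[abs_def] by (intro bounded_linear_sum bl_pow)

lemma bl_mean: "bounded_linear (mean n)"
  unfolding mean_def[abs_def]
  by (intro bounded_linear_compose[OF bounded_linear_scaleR_right] bounded_linear_sum bl_pow)

lemma bl_mean_quot: "bounded_linear (mean_quot n)"
  unfolding mean_quot_def[abs_def]
  by (intro bounded_linear_compose[OF bounded_linear_scaleR_right] bounded_linear_sum bl_part_sum)

lemma pow_commute_D: "(t ^^ n) (D x) = D ((t ^^ n) x)"
proof -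
  interpret P: bounded_linear "t ^^ n" by (rule bl_pow)
  show ?thesis by (simp add: D_def P.diff funpow_swap1)
qed

lemma part_sum_D: "part_sum n (D x) = x - (t ^^ n) x"
proof (induction n)
  case (Suc n)
  have "part_sum (Suc n) (D x) = part_sum n (D x) + (t ^^ n) (D x)" by (simp add: part_sum_def)
  also have "(t ^^ n) (D x) = (t ^^ n) x - (t ^^ Suc n) x"
    unfolding pow_commute_D by (simp add: D_def)
  finally show ?case unfolding Suc by simp
qed (simp add: part_sum_def)

lemma D_part_sum: "D (part_sum n x) = part_sum n (D x)"
proof -
  interpret D: bounded_linear D by (rule bl_D)
  show ?thesis by (simp add: part_sum_def D.sum pow_commute_D)
qed

lemma mean_D: "mean n (D x) = (1 / (real n + 1)) *\<^sub>R (x - (t ^^ Suc n) x)"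
proof -
  have "(\<Sum>i\<le>n. (t ^^ i) (D x)) = part_sum (Suc n) (D x)" by (simp add: part_sum_def lessThan_Suc_atMost)
  then show ?thesis by (simp only: mean_def part_sum_D)
qed

lemma D_mean: "D (mean n x) = mean n (D x)"
proof -
  interpret D: bounded_linear D by (rule bl_D)
  show ?thesis by (simp add: mean_def D.sum D.scaleR pow_commute_D)
qed

lemma mean_quot_D: "mean_quot n (D x) = x - mean n x"
proof -
  have "(\<Sum>i\<le>n. part_sum i (D x)) = (real n + 1) *\<^sub>R x - (\<Sum>i\<le>n. (t ^^ i) x)"
    by (simp add: part_sum_D sum_subtractf sum_constant_scaleR del: sum_constant)
  then show ?thesis by (simp add: mean_quot_def mean_def scaleR_diff_right)
qed

lemma D_mean_quot: "D (mean_quot n x) = x - mean n x"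
proof -
  interpret D: bounded_linear D by (rule bl_D)
  show ?thesis unfolding mean_quot_D[symmetric] by (simp add: mean_quot_def D.sum D.scaleR D_part_sum)
qed

lemma sublinear': "(\<lambda>n. (c + hnorm (t ^^ Suc n)) / (real n + 1)) \<longlonglongrightarrow> 0"
proof -
  have "(\<lambda>n. c / (real n + 1)) \<longlonglongrightarrow> 0" by real_asymp
  moreover have "(\<lambda>n. hnorm (t ^^ Suc n) / real (Suc n)) \<longlonglongrightarrow> 0"
    by (rule LIMSEQ_Suc[OF sublinear])
  ultimately have "(\<lambda>n. c / (real n + 1) + hnorm (t ^^ Suc n) / real (Suc n)) \<longlonglongrightarrow> 0 + 0"
    by (rule tendsto_add)
  then show ?thesis by (simp add: add_divide_distrib add.commute)
qed

lemma hnorm_id: "hnorm (\<lambda>x::'a. x) \<le> 1"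
  by (rule hnorm_le_bound)

lemma hnorm_mean_D: "hnorm (\<lambda>x. mean n (D x)) \<le> (1 + hnorm (t ^^ Suc n)) / (real n + 1)"
proof -
  have "hnorm (\<lambda>x. x - (t ^^ Suc n) x) \<le> 1 + hnorm (t ^^ Suc n)"
    using hnorm_diff[OF bounded_linear_ident bl_pow, of "Suc n"] hnorm_id by linarith
  moreover have "hnorm (\<lambda>x. mean n (D x)) \<le> \<bar>1 / (real n + 1)\<bar> * hnorm (\<lambda>x. x - (t ^^ Suc n) x)"
    unfolding mean_D by (intro hnorm_scaleR bounded_linear_sub bounded_linear_ident bl_pow)
  ultimately show ?thesis by (simp add: divide_simps mult.commute del: funpow.simps)
qed

lemma mean_D_tendsto: "(\<lambda>n. hnorm (\<lambda>x. mean n (D x))) \<longlonglongrightarrow> 0"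
proof (rule tendsto_sandwich[OF _ _ tendsto_const sublinear'[of 1]])
  show "\<forall>\<^sub>F n in sequentially. 0 \<le> hnorm (\<lambda>x. mean n (D x))"
    by (intro always_eventually allI hnorm_nonneg bounded_linear_compose[OF bl_mean bl_D, unfolded o_def])
  show "\<forall>\<^sub>F n in sequentially. hnorm (\<lambda>x. mean n (D x)) \<le> (1 + hnorm (t ^^ Suc n)) / (real n + 1)"
    by (intro always_eventually allI hnorm_mean_D)
qed

text \<open>
  Modulo compact operators \<open>1\<close> has ascent at most one: in \<open>D x = mean n (D x) + mean_quot n (D (D x))\<close>
  the first term is negligible for large \<open>n\<close>.
\<close>

lemma compact_on_D_if_pow:
  assumes "compact_on (D ^^ m) Y" "m \<ge> 1"
  shows "compact_on D Y"
proof -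
  have "compact_on (D ^^ Suc k) Y \<Longrightarrow> compact_on D Y" for k
  proof (induction k)
    case 0
    then show ?case by (simp add: o_def)
  next
    case (Suc k)
    have "compact_on (D ^^ Suc k) Y"
      unfolding compact_on_iff
    proof (intro allI impI)
      fix B assume B: "B \<subseteq> Y" "bounded B"
      \<comment> \<open>The exponent drops by one at a time: on \<open>W\<close> the operator
        \<open>D^2\<close> has precompact image, and the same is to be shown for
        \<open>D\<close>.\<close>
      define W where "W = (D ^^ k) ` B"
      have W: "bounded W" unfolding W_def by (rule bounded_linear_image[OF B(2) bl_Dpow])
      have "(D ^^ Suc (Suc k)) ` B = (\<lambda>x. D (D x)) ` W" by (simp add: W_def image_image)
      then have DD: "precompact ((\<lambda>x. D (D x)) ` W)" using compact_onD[OF Suc.prems B] by simp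
      have eq: "D x - mean n (D x) = mean_quot n (D (D x))" for n x by (simp add: mean_quot_D)
      have "precompact (D ` W)"
      proof (rule precompact_if_hnorm_approx[OF _ mean_D_tendsto _ W])
        show "bounded_linear (\<lambda>x. mean n (D x))" for n
          by (rule bounded_linear_compose[OF bl_mean bl_D])
        show "precompact ((\<lambda>x. D x - mean n (D x)) ` W)" for n
          using precompact_image[OF DD bl_mean_quot, of n] by (simp add: eq image_image)
      qed
      then show "precompact ((D ^^ Suc k) ` B)" by (simp add: W_def image_image)
    qed
    then show ?case by (rule Suc.IH)
  qed
  then show ?thesis using assms by (cases m) auto
qed

text \<open>As \<open>mean n\<close> commutes with \<open>D\<close>, \<open>D L\<close> is the limit
  of \<open>mean n D\<close>, which tends to 0. The rest comes from
  \<open>I - mean n = mean_quot n D\<close>: it is compact after composition with \<open>L\<close>,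
  and on any set where \<open>D\<close> is; in the limit \<open>mean n\<close> becomes
  \<open>L\<close>.\<close>

lemma limit_properties:
  assumes L: "bounded_linear L" and lim: "(\<lambda>n. hnorm (\<lambda>x. mean n x - L x)) \<longlonglongrightarrow> 0" and B: "bounded B"
  shows "precompact ((\<lambda>x. D (L x)) ` B)"
    and "precompact ((\<lambda>x. L x - L (L x)) ` B)"
    and "precompact (D ` B) \<Longrightarrow> precompact ((\<lambda>x. x - L x) ` B)"
proof -
  interpret D: bounded_linear D by (rule bl_D)
  interpret L: bounded_linear L by (rule L)
  have blml: "bounded_linear (\<lambda>x. mean n x - L x)" for n by (intro bounded_linear_sub bl_mean L)
  have DL: "precompact ((\<lambda>x. D (L x)) ` B)" if B: "bounded B" for B
  proof -
    obtain K where K: "K > 0" "\<And>x. norm (D x) \<le> norm x * K" using D.pos_bounded by blast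
    have "(\<lambda>n. hnorm (\<lambda>x. mean n (D x)) + K * hnorm (\<lambda>x. mean n x - L x)) \<longlonglongrightarrow> 0 + K * 0"
      by (intro tendsto_intros mean_D_tendsto lim)
    moreover have "hnorm (\<lambda>x. D (L x)) \<le> hnorm (\<lambda>x. mean n (D x)) + K * hnorm (\<lambda>x. mean n x - L x)" for n
    proof -
      have "hnorm (\<lambda>x. D (mean n x - L x)) \<le> K * hnorm (\<lambda>x. mean n x - L x)"
        by (rule hnorm_comp_left[OF bl_D blml]) (use K in \<open>auto simp: mult.commute\<close>)
      moreover have "(\<lambda>x. D (L x)) = (\<lambda>x. mean n (D x) - D (mean n x - L x))"
        by (simp add: D.diff D_mean)
      then have "hnorm (\<lambda>x. D (L x)) \<le> hnorm (\<lambda>x. mean n (D x)) + hnorm (\<lambda>x. D (mean n x - L x))"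
        using hnorm_diff[OF bounded_linear_compose[OF bl_mean bl_D] bounded_linear_compose[OF bl_D blml], of n n]
        by simp
      ultimately show ?thesis by linarith
    qed
    ultimately have "hnorm (\<lambda>x. D (L x)) \<le> 0" by (intro tendsto_lowerbound[of _ 0 sequentially]) auto
    then show ?thesis by (intro precompact_image_if_hnorm_zero bounded_linear_compose[OF bl_D L] B)
  qed
  show "precompact ((\<lambda>x. D (L x)) ` B)" by (rule DL[OF B])
  show "precompact ((\<lambda>x. L x - L (L x)) ` B)"
  proof (rule precompact_if_hnorm_approx[OF _ _ _ B])
    obtain K where K: "K > 0" "\<And>x. norm (L x) \<le> norm x * K" using L.pos_bounded by blast
    show blc: "bounded_linear (\<lambda>x. mean n (L x) - L (L x))" for n
      by (rule bounded_linear_compose[OF blml L])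
    show "(\<lambda>n. hnorm (\<lambda>x. mean n (L x) - L (L x))) \<longlonglongrightarrow> 0"
    proof (rule tendsto_sandwich[OF _ _ tendsto_const])
      show "(\<lambda>n. K * hnorm (\<lambda>x. mean n x - L x)) \<longlonglongrightarrow> 0"
        using tendsto_mult_left[OF lim, of K] by simp
      show "\<forall>\<^sub>F n in sequentially. hnorm (\<lambda>x. mean n (L x) - L (L x)) \<le> K * hnorm (\<lambda>x. mean n x - L x)"
        by (intro always_eventually allI hnorm_comp_right[OF blml L]) (use K in \<open>auto simp: mult.commute\<close>)
      show "\<forall>\<^sub>F n in sequentially. 0 \<le> hnorm (\<lambda>x. mean n (L x) - L (L x))"
        by (intro always_eventually allI hnorm_nonneg blc)
    qed
    show "precompact ((\<lambda>x. L x - L (L x) - (mean n (L x) - L (L x))) ` B)" for n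
      using precompact_image[OF DL[OF B] bl_mean_quot, of n] by (simp add: image_image mean_quot_D)
  qed
  show "precompact ((\<lambda>x. x - L x) ` B)" if DB: "precompact (D ` B)"
  proof (rule precompact_if_hnorm_approx[OF blml lim _ B])
    show "precompact ((\<lambda>x. x - L x - (mean n x - L x)) ` B)" for n
      using precompact_image[OF DB bl_mean_quot, of n] by (simp add: image_image mean_quot_D)
  qed
qed

text \<open>The bound is in terms of \<open>D A\<close>, which stays moderate for
  \<open>A = mean_quot l\<close> while \<open>A\<close> itself may be large. Control places the
  image of the unit ball within a multiple of \<open>hnorm (D A)\<close> of finitely many translates
  of \<open>Y\<close>. On \<open>Y\<close> the operator \<open>G = I - t^(k+1)\<close> is compact,
  so only the remainder contributes.\<close>

lemma hnorm_mean_D_comp: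
  assumes Y: "compact_on D Y" and ctrl: "compactly_controls (D ^^ Suc m) Y"
  obtains C where "C > 0" "\<And>(A :: 'a \<Rightarrow> 'a) k. bounded_linear A \<Longrightarrow>
    hnorm (\<lambda>x. mean k (D (A x))) \<le> C * (2 + hnorm (t ^^ Suc k)) / (real k + 1) * hnorm (\<lambda>x. D (A x))"
proof -
  interpret Dm: bounded_linear "D ^^ m" by (rule bl_Dpow)
  obtain K where K: "K > 0" "\<And>x. norm ((D ^^ m) x) \<le> norm x * K" using Dm.pos_bounded by blast
  obtain c where c: "c > 0"
    "\<And>E e. bounded E \<Longrightarrow> 0 < e \<Longrightarrow> covered e ((D ^^ Suc m) ` E) \<Longrightarrow> near_covered (c * e) Y E"
    using ctrl unfolding compactly_controls_def by blast
  define C where "C = c * K"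
  have main: "hnorm (\<lambda>x. mean k (D (A x))) \<le> C * (2 + hnorm (t ^^ Suc k)) / (real k + 1) * e"
    if A: "bounded_linear A" and e: "hnorm (\<lambda>x. D (A x)) < e" for A :: "'a \<Rightarrow> 'a" and k e
  proof -
    have e0: "e > 0"
      using hnorm_nonneg[OF bounded_linear_compose[OF bl_D A]] e by linarith
    define E where "E = A ` cball 0 1"
    have bE: "bounded E" unfolding E_def by (rule bounded_linear_image[OF bounded_cball A])
    then obtain R where R: "R > 0" "\<And>x. x \<in> E \<Longrightarrow> norm x \<le> R" by (auto simp: bounded_pos)
    have "covered e ((\<lambda>x. D (A x)) ` cball 0 1)"
      by (rule covered_if_hnorm_less[OF bounded_linear_compose[OF bl_D A] e])
    then have "covered (K * e) ((D ^^ m) ` (\<lambda>x. D (A x)) ` cball 0 1)"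
      by (rule covered_image) (use K in \<open>auto simp: dist_norm Dm.diff[symmetric] mult.commute\<close>)
    moreover have "(D ^^ m) ` (\<lambda>x. D (A x)) ` cball 0 1 = (D ^^ Suc m) ` E"
      by (simp add: E_def image_image funpow_swap1)
    ultimately have "near_covered (c * (K * e)) Y E"
      using K(1) e0 by (intro c(2) bE) auto
    then obtain F where F: "finite F" "\<And>z. z \<in> E \<Longrightarrow> \<exists>x\<in>F. \<exists>y\<in>Y. norm (z - x - y) \<le> c * (K * e)"
      unfolding near_covered_def by blast
    define \<rho> where "\<rho> = c * (K * e)"
    have \<rho>: "\<rho> > 0" using c(1) K(1) e0 by (simp add: \<rho>_def)
    obtain b where b: "b > 0" "\<And>x. x \<in> F \<Longrightarrow> norm x \<le> b"
      using finite_imp_bounded[OF F(1)] unfolding bounded_pos by blast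
    define G where "G x = x - (t ^^ Suc k) x" for x
    have blG: "bounded_linear G"
      unfolding G_def[abs_def] by (intro bounded_linear_sub bounded_linear_ident bl_pow)
    interpret G: bounded_linear G by (rule blG)
    \<comment> \<open>The components in \<open>Y\<close> are bounded by a constant that depends on
      \<open>A\<close>. This is harmless, since only the precompactness of their image enters the
      estimate.\<close>
    define YB where "YB = Y \<inter> cball 0 (R + b + \<rho>)"
    have "precompact (D ` YB)" unfolding YB_def by (rule compact_onD[OF Y]) auto
    then have "precompact (part_sum (Suc k) ` D ` YB)" by (rule precompact_image[OF _ bl_part_sum])
    then have GY: "precompact (G ` YB)" by (simp add: G_def[abs_def] image_image part_sum_D)
    define S where "S = (\<Union>x\<in>F. (\<lambda>g. G x + g) ` G ` YB)"
    have preS: "precompact S"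
      unfolding S_def
    proof (rule precompact_pieces[of F "\<lambda>x. (\<lambda>g. G x + g) ` G ` YB", OF F(1)])
      show "precompact ((\<lambda>g. G x + g) ` G ` YB)" for x
        by (rule precompact_sum[OF precompact_finite[of "{G x}"] GY]) auto
    qed simp
    \<comment> \<open>2 in place of 1 makes the inequality strict, as passing to a covering at that
      radius requires.\<close>
    have Gh: "hnorm G < 2 + hnorm (t ^^ Suc k)"
      using hnorm_diff[OF bounded_linear_ident bl_pow, of "Suc k"] hnorm_id unfolding G_def[abs_def] by linarith
    have covW: "covered (\<rho> * (2 + hnorm (t ^^ Suc k))) (G ` cball 0 \<rho>)"
      by (rule covered_bounded_image[OF blG Gh \<rho>]) auto
    have "hnorm (\<lambda>x. mean k (D (A x))) \<le> (1 / (real k + 1)) * (\<gamma> + \<rho> * (2 + hnorm (t ^^ Suc k)))"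
      if \<gamma>: "\<gamma> > 0" for \<gamma>
    proof (rule hnorm_le)
      have "covered (\<gamma> + \<rho> * (2 + hnorm (t ^^ Suc k))) (G ` E)"
      proof (rule covered_sum[OF precompactD[OF preS \<gamma>] covW])
        fix g assume "g \<in> G ` E"
        then obtain z where z: "z \<in> E" "g = G z" by blast
        then obtain x y where xy: "x \<in> F" "y \<in> Y" "norm (z - x - y) \<le> \<rho>" using F(2)[OF z(1)] unfolding \<rho>_def by blast
        have "norm y = norm (z - x - (z - x - y))" by simp
        also have "\<dots> \<le> norm z + norm x + norm (z - x - y)"
          using norm_triangle_ineq4[of "z - x" "z - x - y"] norm_triangle_ineq4[of z x] by linarith
        finally have "norm y \<le> R + b + \<rho>" using R(2)[OF z(1)] b(2)[OF xy(1)] xy(3) by linarith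
        then have "G x + G y \<in> S"
          unfolding S_def YB_def using xy by (intro UN_I[OF xy(1)] imageI) auto
        moreover have "G (z - x - y) \<in> G ` cball 0 \<rho>" using xy(3) by auto
        moreover have "g = (G x + G y) + G (z - x - y)" by (simp add: z(2) G.diff)
        ultimately show "\<exists>a\<in>S. \<exists>b\<in>G ` cball 0 \<rho>. g = a + b" by blast
      qed
      then have "covered ((1 / (real k + 1)) * (\<gamma> + \<rho> * (2 + hnorm (t ^^ Suc k)))) (scaleR (1 / (real k + 1)) ` G ` E)"
        by (rule covered_image) (auto simp: dist_norm scaleR_diff_right[symmetric])
      moreover have "scaleR (1 / (real k + 1)) ` G ` E = (\<lambda>x. mean k (D (A x))) ` cball 0 1"
        by (simp add: E_def G_def mean_D image_image)
      ultimately show "covered ((1 / (real k + 1)) * (\<gamma> + \<rho> * (2 + hnorm (t ^^ Suc k))))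
          ((\<lambda>x. mean k (D (A x))) ` cball 0 1)" by simp
    qed
    then have "\<forall>\<^sub>F \<gamma> in at_right 0. hnorm (\<lambda>x. mean k (D (A x)))
        \<le> (1 / (real k + 1)) * (\<gamma> + \<rho> * (2 + hnorm (t ^^ Suc k)))"
      by (auto simp: eventually_at_right_field intro!: exI[of _ 1])
    moreover have "((\<lambda>\<gamma>. (1 / (real k + 1)) * (\<gamma> + \<rho> * (2 + hnorm (t ^^ Suc k))))
        \<longlongrightarrow> (1 / (real k + 1)) * (0 + \<rho> * (2 + hnorm (t ^^ Suc k)))) (at_right 0)"
      by (intro tendsto_intros)
    ultimately have "hnorm (\<lambda>x. mean k (D (A x))) \<le> (1 / (real k + 1)) * (0 + \<rho> * (2 + hnorm (t ^^ Suc k)))"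
      by (intro tendsto_lowerbound) auto
    then show ?thesis by (simp add: \<rho>_def C_def mult_ac del: funpow.simps)
  qed
  have "hnorm (\<lambda>x. mean k (D (A x))) \<le> C * (2 + hnorm (t ^^ Suc k)) / (real k + 1) * hnorm (\<lambda>x. D (A x))"
    if A: "bounded_linear A" for A :: "'a \<Rightarrow> 'a" and k
  proof (rule tendsto_lowerbound)
    let ?h = "hnorm (\<lambda>x. D (A x))" and ?c = "C * (2 + hnorm (t ^^ Suc k)) / (real k + 1)"
    show "((\<lambda>e. ?c * e) \<longlongrightarrow> ?c * ?h) (at_right ?h)" by (intro tendsto_intros)
    show "\<forall>\<^sub>F e in at_right ?h. hnorm (\<lambda>x. mean k (D (A x))) \<le> ?c * e"
      using main[OF A] by (auto simp: eventually_at_right_field intro!: exI[of _ "?h + 1"])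
  qed simp
  moreover have "C > 0" using c K by (simp add: C_def)
  ultimately show ?thesis using that by blast
qed

lemma means_Cauchy:
  assumes Y: "compact_on D Y" and ctrl: "compactly_controls (D ^^ Suc m) Y" and \<epsilon>: "\<epsilon> > 0"
  shows "\<exists>N. \<forall>k\<ge>N. \<forall>l\<ge>N. hnorm (\<lambda>x. mean k x - mean l x) < \<epsilon>"
proof -
  obtain C where C: "C > 0" "\<And>(A :: 'a \<Rightarrow> 'a) k. bounded_linear A \<Longrightarrow>
    hnorm (\<lambda>x. mean k (D (A x))) \<le> C * (2 + hnorm (t ^^ Suc k)) / (real k + 1) * hnorm (\<lambda>x. D (A x))"
    using hnorm_mean_D_comp[OF Y ctrl] by blast
  define d where "d k = C * (2 + hnorm (t ^^ Suc k)) / (real k + 1)" for k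
  define H where "H k = hnorm (mean k)" for k
  have H0: "0 \<le> H k" for k unfolding H_def by (rule hnorm_nonneg[OF bl_mean])
  have d0: "0 \<le> d k" for k
    unfolding d_def using C(1) hnorm_nonneg[OF bl_pow, of "Suc k"]
    by (intro divide_nonneg_nonneg mult_nonneg_nonneg) auto
  have dlim: "d \<longlonglongrightarrow> 0"
    using tendsto_mult_left[OF sublinear'[of 2], of C] by (simp add: d_def[abs_def])
  have bl_mD: "bounded_linear (\<lambda>x. mean k (D (mean_quot l x)))" for k l
    by (rule bounded_linear_compose[OF bl_mean bounded_linear_compose[OF bl_D bl_mean_quot]])
  have half: "hnorm (\<lambda>x. mean k (D (mean_quot l x))) \<le> d k * (1 + H l)" for k l
  proof -
    have "hnorm (\<lambda>x. mean k (D (mean_quot l x))) \<le> d k * hnorm (\<lambda>x. D (mean_quot l x))"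
      unfolding d_def by (rule C(2)[OF bl_mean_quot])
    also have "hnorm (\<lambda>x. D (mean_quot l x)) \<le> 1 + H l"
      unfolding D_mean_quot H_def using hnorm_diff[OF bounded_linear_ident bl_mean, of l] hnorm_id by linarith
    finally show ?thesis using d0 by (simp add: mult_left_mono)
  qed
  have diff: "hnorm (\<lambda>x. mean k x - mean l x) \<le> d k * (1 + H l) + d l * (1 + H k)" for k l
  proof -
    have comm: "mean k (mean l x) = mean l (mean k x)" for x
    proof -
      interpret k: bounded_linear "mean k" by (rule bl_mean)
      interpret l: bounded_linear "mean l" by (rule bl_mean)
      have pow: "(t ^^ i) (mean l y) = mean l ((t ^^ i) y)" for i y
      proof -
        interpret P: bounded_linear "t ^^ i" by (rule bl_pow)
        have "(t ^^ i) ((t ^^ j) y) = (t ^^ j) ((t ^^ i) y)" for j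
          by (metis add.commute comp_apply funpow_add)
        then show ?thesis by (simp add: mean_def P.scaleR P.sum)
      qed
      show ?thesis by (simp add: mean_def[of k] pow l.scaleR l.sum)
    qed
    interpret k: bounded_linear "mean k" by (rule bl_mean)
    interpret l: bounded_linear "mean l" by (rule bl_mean)
    have "(\<lambda>x. mean k x - mean l x) = (\<lambda>x. mean k (D (mean_quot l x)) - mean l (D (mean_quot k x)))"
      by (simp add: D_mean_quot k.diff l.diff comm)
    then show ?thesis
      using hnorm_diff[OF bl_mD bl_mD, of k l l k] half[of k l] half[of l k] by simp
  qed
  have "\<forall>\<^sub>F k in sequentially. d k < 1/2" by (rule order_tendstoD(2)[OF dlim]) simp
  then obtain l0 where l0: "\<And>k. k \<ge> l0 \<Longrightarrow> d k < 1/2" unfolding eventually_sequentially by blast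
  \<comment> \<open>The estimate \<open>diff\<close> involves \<open>H\<close>, so the means must be
    bounded first: with both factors \<open>d\<close> below 1/2, the term with \<open>H k\<close> is
    absorbed into the left side.\<close>
  define B where "B = 4 * H l0 + 4"
  have HB: "H k \<le> B" if "k \<ge> l0" for k
  proof -
    have "H k \<le> hnorm (\<lambda>x. mean k x - mean l0 x) + H l0"
      using hnorm_add[OF bounded_linear_sub[OF bl_mean bl_mean] bl_mean, of k l0 l0] by (simp add: H_def)
    also have "hnorm (\<lambda>x. mean k x - mean l0 x) \<le> d k * (1 + H l0) + d l0 * (1 + H k)" by (rule diff)
    also have "d k * (1 + H l0) \<le> 1/2 * (1 + H l0)"
      using l0[OF that] H0[of l0] by (intro mult_right_mono) auto
    also have "d l0 * (1 + H k) \<le> 1/2 * (1 + H k)"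
      using l0[of l0] H0[of k] by (intro mult_right_mono) auto
    finally have "H k \<le> 1/2 * (1 + H l0) + 1/2 * (1 + H k) + H l0" by simp
    then show ?thesis unfolding B_def using H0[of l0] by (simp add: field_simps)
  qed
  have B0: "B > 0" using H0[of l0] by (simp add: B_def)
  have "\<forall>\<^sub>F k in sequentially. d k < \<epsilon> / (4 * (1 + B))"
    by (rule order_tendstoD(2)[OF dlim]) (use \<epsilon> B0 in simp)
  then obtain N where N: "\<And>k. k \<ge> N \<Longrightarrow> d k < \<epsilon> / (4 * (1 + B))" unfolding eventually_sequentially by blast
  have "hnorm (\<lambda>x. mean k x - mean l x) < \<epsilon>" if "k \<ge> max N l0" "l \<ge> max N l0" for k l
  proof -
    have b: "d i * (1 + H j) \<le> \<epsilon> / 4" if "i \<ge> max N l0" "j \<ge> max N l0" for i j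
    proof -
      have "d i * (1 + H j) \<le> \<epsilon> / (4 * (1 + B)) * (1 + B)"
        using N[of i] HB[of j] H0[of j] d0[of i] \<epsilon> B0 that by (intro mult_mono) auto
      also have "\<dots> = \<epsilon> / 4" using B0 by (simp add: field_simps)
      finally show ?thesis .
    qed
    show ?thesis using diff[of k l] b[of k l] b[of l k] that \<epsilon> by simp
  qed
  then show ?thesis by blast
qed

end

section \<open>The Calkin algebra\<close>

context banach_over
begin

abbreviation "BX \<equiv> bounded_operators smul"
abbreviation "KX \<equiv> compact_operators smul"

lemma BX_simps: "\<zero>\<^bsub>BX\<^esub> = 0" "\<one>\<^bsub>BX\<^esub> = id_blinfun" "A \<oplus>\<^bsub>BX\<^esub> B = A + B" "A \<otimes>\<^bsub>BX\<^esub> B = A o\<^sub>L B"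
  by (simp_all add: bounded_operators_def)

lemma BX_closed:
  "0 \<in> carrier BX" "id_blinfun \<in> carrier BX"
  "A \<in> carrier BX \<Longrightarrow> B \<in> carrier BX \<Longrightarrow> A + B \<in> carrier BX"
  "A \<in> carrier BX \<Longrightarrow> B \<in> carrier BX \<Longrightarrow> A - B \<in> carrier BX"
  "A \<in> carrier BX \<Longrightarrow> - A \<in> carrier BX"
  "A \<in> carrier BX \<Longrightarrow> r *\<^sub>R A \<in> carrier BX"
  "A \<in> carrier BX \<Longrightarrow> B \<in> carrier BX \<Longrightarrow> A o\<^sub>L B \<in> carrier BX"
  by (simp_all add: mem_bounded_operators_iff blinfun.add_left blinfun.diff_left blinfun.minus_left
      blinfun.scaleR_left scale_right_distrib scale_right_diff_distrib smul_scaleR)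

lemma KX_iff: "A \<in> KX \<longleftrightarrow> A \<in> carrier BX \<and> (\<forall>B. bounded B \<longrightarrow> precompact (blinfun_apply A ` B))"
  by (auto simp: compact_operators_def compact_on_iff)

lemma KX_carrier: "A \<in> KX \<Longrightarrow> A \<in> carrier BX" by (simp add: KX_iff)

lemma KX_closed:
  "0 \<in> KX" "A \<in> KX \<Longrightarrow> B \<in> KX \<Longrightarrow> A + B \<in> KX" "A \<in> KX \<Longrightarrow> - A \<in> KX"
  "A \<in> KX \<Longrightarrow> B \<in> KX \<Longrightarrow> A - B \<in> KX" "A \<in> KX \<Longrightarrow> r *\<^sub>R A \<in> KX"
  "A \<in> KX \<Longrightarrow> B \<in> carrier BX \<Longrightarrow> A o\<^sub>L B \<in> KX"
proof -
  interpret I: ideal KX BX by (rule ideal_compact_operators)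
  show zero: "0 \<in> KX" using additive_subgroup.zero_closed[OF I.is_additive_subgroup] by (simp add: BX_simps)
  show add: "A + B \<in> KX" if "A \<in> KX" "B \<in> KX" for A B using additive_subgroup.a_closed[OF I.is_additive_subgroup that] by (simp add: BX_simps)
  show scale: "r *\<^sub>R A \<in> KX" if A: "A \<in> KX" for r A
  proof -
    have "r *\<^sub>R id_blinfun \<in> carrier BX" by (intro BX_closed)
    from I.I_l_closed[OF A this] have "(r *\<^sub>R id_blinfun) o\<^sub>L A \<in> KX" by (simp add: BX_simps)
    moreover have "(r *\<^sub>R id_blinfun) o\<^sub>L A = r *\<^sub>R A" by (rule blinfun_eqI) (simp add: blinfun.scaleR_left)
    ultimately show ?thesis by simp
  qed
  show neg: "- A \<in> KX" if "A \<in> KX" for A using scale[OF that, of "-1"] by simp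
  show "A - B \<in> KX" if "A \<in> KX" "B \<in> KX" for A B using add[OF that(1) neg[OF that(2)]] by simp
  show "A o\<^sub>L B \<in> KX" if "A \<in> KX" "B \<in> carrier BX" for A B
    using I.I_r_closed[OF that] by (simp add: BX_simps)
qed

lemma calkin_class_eq: "calkin_class smul A = {K + A | K. K \<in> KX}"
  by (auto simp: calkin_class_def a_r_coset_def' BX_simps)

lemma calkin_class_eqI:
  assumes "A - B \<in> KX"
  shows "calkin_class smul A = calkin_class smul B"
proof -
  have sub: "{K + A | K. K \<in> KX} \<subseteq> {K + B | K. K \<in> KX}" if "A - B \<in> KX" for A B
  proof
    fix S assume "S \<in> {K + A | K. K \<in> KX}"
    then obtain K where "K \<in> KX" "S = K + A" by blast
    then have "K + (A - B) \<in> KX" "S = (K + (A - B)) + B" using that by (auto intro: KX_closed)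
    then show "S \<in> {K + B | K. K \<in> KX}" by blast
  qed
  have "B - A \<in> KX" using KX_closed(3)[OF assms] by simp
  from sub[OF assms] sub[OF this] show ?thesis unfolding calkin_class_eq by (rule subset_antisym)
qed

section \<open>Essential norm against noncompactness, and completeness\<close>

abbreviation "enorm \<equiv> essential_norm smul"

lemma enorm_le: "K \<in> KX \<Longrightarrow> enorm A \<le> norm (A + K)"
  unfolding essential_norm_def quotient_norm_def calkin_class_eq
  by (rule cINF_lower2[of _ _ "K + A"]) (auto intro!: bdd_belowI[of _ 0] simp: add.commute)

lemma enorm_nonneg: "0 \<le> enorm A"
  unfolding essential_norm_def quotient_norm_def calkin_class_eq
  by (rule cINF_greatest) (use KX_closed(1) in auto)

lemma enorm_lessE:
  assumes "enorm A < e"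
  obtains K where "K \<in> KX" "norm (A + K) < e"
proof -
  have "(INF S\<in>{K + A | K. K \<in> KX}. norm S) < e"
    using assms by (simp add: essential_norm_def quotient_norm_def calkin_class_eq)
  moreover have "{K + A | K. K \<in> KX} \<noteq> {}" using KX_closed(1) by blast
  ultimately obtain S where "S \<in> {K + A | K. K \<in> KX}" "norm S < e"
    by (auto dest!: cInf_lessD[rotated])
  then show ?thesis using that by (auto simp: add.commute)
qed

lemma hnorm_le_enorm: "hnorm (blinfun_apply A) \<le> enorm A"
proof (rule dense_ge)
  fix e assume "enorm A < e"
  then obtain K where K: "K \<in> KX" "norm (A + K) < e" by (rule enorm_lessE)
  have "hnorm (blinfun_apply (A + K)) \<le> e"
  proof (rule hnorm_le_bound)
    fix x :: 'a assume "norm x \<le> 1"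
    then have "norm (A + K) * norm x \<le> norm (A + K) * 1" by (intro mult_left_mono) auto
    then show "norm (blinfun_apply (A + K) x) \<le> e" using norm_blinfun[of "A + K" x] K(2) by linarith
  qed
  moreover have "hnorm (blinfun_apply K) \<le> 0"
    using K(1) by (intro hnorm_zero_if_precompact) (simp add: KX_iff)
  moreover have "blinfun_apply A = (\<lambda>x. blinfun_apply (A + K) x - blinfun_apply K x)"
    by (simp add: blinfun.add_left)
  ultimately show "hnorm (blinfun_apply A) \<le> e"
    using hnorm_diff[OF blinfun.bounded_linear_right[of "A + K"] blinfun.bounded_linear_right[of K]] by simp
qed

text \<open>A compact \<open>S\<close> that nearly fixes a finite net of the image of the unit ball
  makes \<open>A - S A\<close> small, and \<open>S A\<close> is compact. In the constant,
  \<open>I - S\<close> costs \<open>1 + |C|\<close> on the distance to the net, and the error at the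
  points of the net costs 1 more.\<close>

lemma enorm_le_hnorm:
  assumes "bounded_compact_approximation_property smul"
  obtains C where "C > 0"
    "\<And>A e. A \<in> carrier BX \<Longrightarrow> hnorm (blinfun_apply A) < e \<Longrightarrow> enorm A \<le> C * e"
proof -
  obtain F C where F: "F \<noteq> bot" "\<forall>\<^sub>F S in F. S \<in> KX \<and> norm S \<le> C"
    "\<And>x. ((\<lambda>S. blinfun_apply S x) \<longlongrightarrow> x) F"
    using assms unfolding bounded_compact_approximation_property_def by blast
  have "enorm A \<le> (2 + \<bar>C\<bar>) * e" if A: "A \<in> carrier BX" and e: "hnorm (blinfun_apply A) < e" for A e
  proof -
    have e0: "e > 0" using hnorm_nonneg[OF blinfun.bounded_linear_right[of A]] e by linarith
    have "covered e (blinfun_apply A ` cball 0 1)"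
      by (rule covered_if_hnorm_less[OF blinfun.bounded_linear_right e])
    then obtain Y where Y: "finite Y" "\<And>a. a \<in> blinfun_apply A ` cball 0 1 \<Longrightarrow> \<exists>y\<in>Y. dist y a \<le> e"
      by (rule coveredE) blast
    have "\<forall>\<^sub>F S in F. \<forall>y\<in>Y. dist (blinfun_apply S y) y < e"
      using Y(1) e0 by (intro eventually_ball_finite ballI tendstoD[OF F(3)])
    with F(2) have "\<forall>\<^sub>F S in F. (S \<in> KX \<and> norm S \<le> C) \<and> (\<forall>y\<in>Y. dist (blinfun_apply S y) y < e)"
      by (rule eventually_conj)
    then obtain S where S: "S \<in> KX" "norm S \<le> C" "\<And>y. y \<in> Y \<Longrightarrow> norm (blinfun_apply S y - y) < e"
      using eventually_happens'[OF F(1)] unfolding dist_norm by blast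
    have "- (S o\<^sub>L A) \<in> KX" by (intro KX_closed S A)
    then have "enorm A \<le> norm (A + - (S o\<^sub>L A))" by (rule enorm_le)
    also have "\<dots> \<le> (2 + \<bar>C\<bar>) * e"
    proof (rule norm_blinfun_bound)
      show "0 \<le> (2 + \<bar>C\<bar>) * e" using e0 by simp
      have unit: "norm (blinfun_apply (A + - (S o\<^sub>L A)) x) \<le> (2 + \<bar>C\<bar>) * e" if x: "norm x \<le> 1" for x
      proof -
        have "blinfun_apply A x \<in> blinfun_apply A ` cball 0 1" using x by simp
        then obtain y where y: "y \<in> Y" "norm (y - blinfun_apply A x) \<le> e" using Y(2) by (auto simp: dist_norm)
        define d where "d = blinfun_apply A x - y"
        have d: "norm d \<le> e" using y(2) by (simp add: d_def norm_minus_commute)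
        have "norm (blinfun_apply S d) \<le> \<bar>C\<bar> * e"
          using norm_blinfun[of S d] S(2) mult_mono[of "norm S" "\<bar>C\<bar>" "norm d" e] d e0 by fastforce
        moreover have eq: "blinfun_apply (A + - (S o\<^sub>L A)) x = (d - blinfun_apply S d) - (blinfun_apply S y - y)"
          by (simp add: d_def blinfun.add_left blinfun.diff_left blinfun.minus_left blinfun.diff_right)
        ultimately show ?thesis
          unfolding eq
          using norm_triangle_ineq4[of "d - blinfun_apply S d" "blinfun_apply S y - y"]
            norm_triangle_ineq4[of d "blinfun_apply S d"] d S(3)[OF y(1)]
          unfolding distrib_right by linarith
      qed
      show "norm (blinfun_apply (A + - (S o\<^sub>L A)) x) \<le> (2 + \<bar>C\<bar>) * e * norm x" for x
      proof (cases "x = 0")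
        case False
        have "norm (blinfun_apply (A + - (S o\<^sub>L A)) ((1 / norm x) *\<^sub>R x)) \<le> (2 + \<bar>C\<bar>) * e"
          by (rule unit) (use False in simp)
        then show ?thesis using False by (simp add: blinfun.scaleR_right divide_le_eq)
      qed simp
    qed
    finally show ?thesis .
  qed
  then show ?thesis by (intro that[of "2 + \<bar>C\<bar>"]) auto
qed

lemma BX_closed_limit:
  assumes "\<And>n. A n \<in> carrier BX" "A \<longlonglongrightarrow> L"
  shows "L \<in> carrier BX"
  unfolding mem_bounded_operators_iff
proof (intro allI)
  fix c x
  have lim: "(\<lambda>n. blinfun_apply (A n) y) \<longlonglongrightarrow> blinfun_apply L y" for y
    by (intro blinfun.tendsto assms(2) tendsto_const)
  from bounded_linear.tendsto[OF bounded_linear_smul lim[of x]]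
  have "(\<lambda>n. blinfun_apply (A n) (smul c x)) \<longlonglongrightarrow> smul c (blinfun_apply L x)"
    using assms(1) by (simp add: mem_bounded_operators_iff)
  then show "blinfun_apply L (smul c x) = smul c (blinfun_apply L x)" using lim LIMSEQ_unique by blast
qed

text \<open>Completeness of the quotient by lifting: along a fast Cauchy subsequence compact
  corrections \<open>K\<close> make the increments summable in norm, so the corrected sequence
  \<open>B\<close> converges in the operator norm.\<close>

lemma calkin_complete:
  assumes A: "\<And>n::nat. A n \<in> carrier BX"
    and Cauchy: "\<And>e. e > 0 \<Longrightarrow> \<exists>N. \<forall>k\<ge>N. \<forall>l\<ge>N. enorm (A k - A l) < e"
  obtains L where "L \<in> carrier BX" "(\<lambda>n. enorm (A n - L)) \<longlonglongrightarrow> 0"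
proof -
  have "\<forall>j. \<exists>N. \<forall>k\<ge>N. \<forall>l\<ge>N. enorm (A k - A l) < (1/2)^j" by (intro allI Cauchy) simp
  then obtain N where N: "\<And>j k l. k \<ge> N j \<Longrightarrow> l \<ge> N j \<Longrightarrow> enorm (A k - A l) < (1/2)^j" by metis
  \<comment> \<open>Summing the indices makes \<open>f\<close> nondecreasing while
    \<open>N j <= f j\<close>.\<close>
  define f where "f j = (\<Sum>i\<le>j. N i)" for j
  have fN: "N j \<le> f j" for j unfolding f_def by (rule member_le_sum) auto
  have fS: "f j \<le> f (Suc j)" for j by (simp add: f_def)
  have "\<exists>K. K \<in> KX \<and> norm (A (f (Suc j)) - A (f j) + K) < (1/2)^j" for j
  proof -
    have "enorm (A (f (Suc j)) - A (f j)) < (1/2)^j"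
      using fN[of j] fS[of j] by (intro N) auto
    then show ?thesis by (elim enorm_lessE) blast
  qed
  then obtain K where K: "\<And>j. K j \<in> KX" "\<And>j. norm (A (f (Suc j)) - A (f j) + K j) < (1/2)^j" by metis
  define S where "S j = (\<Sum>i<j. K i)" for j
  have S: "S j \<in> KX" for j by (induction j) (auto simp: S_def intro: KX_closed K)
  define B where "B j = A (f j) + S j" for j
  have BS: "B (Suc j) - B j = A (f (Suc j)) - A (f j) + K j" for j by (simp add: B_def S_def)
  have "summable (\<lambda>j. B (Suc j) - B j)"
    by (rule summable_comparison_test'[of "\<lambda>j. (1/2::real)^j"])
      (use K(2) in \<open>auto simp: BS intro: less_imp_le summable_geometric\<close>)
  then have "convergent (\<lambda>n. \<Sum>j<n. B (Suc j) - B j)" by (simp add: summable_iff_convergent)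
  then have "convergent (\<lambda>n. B n - B 0)" by (simp add: sum_lessThan_telescope)
  then obtain L0 where "(\<lambda>n. B n - B 0) \<longlonglongrightarrow> L0" by (auto simp: convergent_def)
  then have "(\<lambda>n. (B n - B 0) + B 0) \<longlonglongrightarrow> L0 + B 0" by (intro tendsto_intros)
  then obtain L where L: "B \<longlonglongrightarrow> L" by auto
  have "L \<in> carrier BX"
    by (rule BX_closed_limit[OF _ L]) (auto simp: B_def intro: BX_closed A KX_carrier S)
  moreover have "(\<lambda>n. enorm (A n - L)) \<longlonglongrightarrow> 0"
  proof (rule LIMSEQ_I)
    fix e :: real assume e: "e > 0"
    have "(\<lambda>j. (1/2)^j + norm (B j - L)) \<longlonglongrightarrow> 0 + norm (L - L)"
      by (intro tendsto_intros L LIMSEQ_power_zero) auto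
    then have "\<forall>\<^sub>F j in sequentially. (1/2)^j + norm (B j - L) < e"
      using e by (intro order_tendstoD) auto
    then obtain j where j: "(1/2)^j + norm (B j - L) < e" using eventually_happens'[OF sequentially_bot] by blast
    have "norm (enorm (A n - L) - 0) < e" if n: "n \<ge> f j" for n
    proof -
      have "enorm (A n - A (f j)) < (1/2)^j" using fN[of j] n by (intro N) auto
      then obtain K' where K': "K' \<in> KX" "norm (A n - A (f j) + K') < (1/2)^j" by (rule enorm_lessE)
      have "enorm (A n - L) \<le> norm (A n - L + (K' + S j))" by (intro enorm_le KX_closed K' S)
      also have "A n - L + (K' + S j) = (A n - A (f j) + K') + (B j - L)"
        by (simp add: B_def)
      finally show ?thesis using K'(2) j enorm_nonneg[of "A n - L"] norm_triangle_ineq[of "A n - A (f j) + K'" "B j - L"] by simp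
    qed
    then show "\<exists>N. \<forall>n\<ge>N. norm (enorm (A n - L) - 0) < e" by blast
  qed
  ultimately show ?thesis by (rule that)
qed

section \<open>Powers and means of cosets\<close>

lemma BX_pow_apply: "blinfun_apply (A [^]\<^bsub>BX\<^esub> (n::nat)) = blinfun_apply A ^^ n"
proof (induction n)
  case 0
  show ?case by (auto simp: BX_simps)
next
  case (Suc n)
  then show ?case by (auto simp: BX_simps funpow_swap1)
qed

lemma BX_pow_closed: "A \<in> carrier BX \<Longrightarrow> A [^]\<^bsub>BX\<^esub> (n::nat) \<in> carrier BX"
  by (rule monoid.nat_pow_closed[OF ring.is_monoid[OF ring_bounded_operators]])

lemma BX_sum_closed: "(\<And>i. i \<in> I \<Longrightarrow> f i \<in> carrier BX) \<Longrightarrow> (\<Sum>i\<in>I. f i) \<in> carrier BX"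
  by (induction I rule: infinite_finite_induct) (auto intro: BX_closed)

definition cesaro_mean :: "('a \<Rightarrow>\<^sub>L 'a) \<Rightarrow> nat \<Rightarrow> 'a \<Rightarrow>\<^sub>L 'a"
  where "cesaro_mean T n = (1 / (real n + 1)) *\<^sub>R (\<Sum>i\<le>n. T [^]\<^bsub>BX\<^esub> i)"

lemma cesaro_mean_closed: "T \<in> carrier BX \<Longrightarrow> cesaro_mean T n \<in> carrier BX"
  unfolding cesaro_mean_def by (intro BX_closed BX_sum_closed BX_pow_closed)

lemma calkin_scaleR_class: "calkin_scaleR smul r (calkin_class smul A) = calkin_class smul (r *\<^sub>R A)"
proof -
  have "calkin_class smul (r *\<^sub>R S) = calkin_class smul (r *\<^sub>R A)" if "S \<in> calkin_class smul A" for S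
  proof (rule calkin_class_eqI)
    from that obtain K where "K \<in> KX" "S = K + A" by (auto simp: calkin_class_eq)
    then show "r *\<^sub>R S - r *\<^sub>R A \<in> KX" by (simp add: scaleR_add_right KX_closed)
  qed
  moreover have "A \<in> calkin_class smul A" using KX_closed(1) by (force simp: calkin_class_eq)
  ultimately show ?thesis unfolding calkin_scaleR_def by blast
qed

lemma ring_hom_calkin_class: "ring_hom_ring BX (calkin_algebra smul) (calkin_class smul)"
proof -
  have "calkin_class smul = (+>\<^bsub>BX\<^esub>) KX" by (rule ext) (simp add: calkin_class_def)
  then show ?thesis
    unfolding calkin_algebra_def using ideal.rcos_ring_hom_ring[OF ideal_compact_operators] by simp
qed

lemma calkin_mean_class:
  assumes T: "T \<in> carrier BX"
  shows "calkin_mean smul n (calkin_class smul T) = calkin_class smul (cesaro_mean T n)"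
proof -
  interpret h: ring_hom_ring BX "calkin_algebra smul" "calkin_class smul" by (rule ring_hom_calkin_class)
  have "(\<Oplus>\<^bsub>calkin_algebra smul\<^esub>i\<in>{..n}. calkin_class smul T [^]\<^bsub>calkin_algebra smul\<^esub> i)
      = calkin_class smul (\<Sum>i\<le>n. T [^]\<^bsub>BX\<^esub> i)"
  proof (induction n)
    case 0
    show ?case using T h.hom_nat_pow[OF T, of 0] by (simp add: BX_simps)
  next
    case (Suc n)
    have "(\<Oplus>\<^bsub>calkin_algebra smul\<^esub>i\<in>{..Suc n}. calkin_class smul T [^]\<^bsub>calkin_algebra smul\<^esub> i)
        = calkin_class smul T [^]\<^bsub>calkin_algebra smul\<^esub> Suc n \<oplus>\<^bsub>calkin_algebra smul\<^esub>
          (\<Oplus>\<^bsub>calkin_algebra smul\<^esub>i\<in>{..n}. calkin_class smul T [^]\<^bsub>calkin_algebra smul\<^esub> i)"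
      by (rule h.S.finsum_Suc) (use T in \<open>auto intro: h.S.nat_pow_closed\<close>)
    also have "\<dots> = calkin_class smul (T [^]\<^bsub>BX\<^esub> Suc n) \<oplus>\<^bsub>calkin_algebra smul\<^esub>
          calkin_class smul (\<Sum>i\<le>n. T [^]\<^bsub>BX\<^esub> i)"
      unfolding Suc using h.hom_nat_pow[OF T, of "Suc n"] by (simp only:)
    also have "\<dots> = calkin_class smul (T [^]\<^bsub>BX\<^esub> Suc n \<oplus>\<^bsub>BX\<^esub> (\<Sum>i\<le>n. T [^]\<^bsub>BX\<^esub> i))"
      by (rule h.hom_add[symmetric]) (intro BX_pow_closed BX_sum_closed T)+
    also have "\<dots> = calkin_class smul (\<Sum>i\<le>Suc n. T [^]\<^bsub>BX\<^esub> i)"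
      by (simp only: BX_simps sum.atMost_Suc add.commute)
    finally show ?case .
  qed
  then show ?thesis
    unfolding calkin_mean_def atLeast0AtMost by (simp add: calkin_scaleR_class cesaro_mean_def)
qed

lemma calkin_convergent_iff:
  assumes T: "T \<in> carrier BX"
  shows "calkin_convergent smul (\<lambda>n. calkin_mean smul n (calkin_class smul T)) \<longleftrightarrow>
    (\<exists>L\<in>carrier BX. (\<lambda>n. enorm (cesaro_mean T n - L)) \<longlonglongrightarrow> 0)"
proof -
  interpret h: ring_hom_ring BX "calkin_algebra smul" "calkin_class smul" by (rule ring_hom_calkin_class)
  have diff: "calkin_class smul A \<ominus>\<^bsub>calkin_algebra smul\<^esub> calkin_class smul L = calkin_class smul (A - L)"
    if "A \<in> carrier BX" "L \<in> carrier BX" for A L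
  proof -
    have "\<ominus>\<^bsub>BX\<^esub> L = - L"
      by (rule h.R.minus_equality) (use that BX_closed in \<open>simp_all add: BX_simps\<close>)
    then show ?thesis
      using that h.hom_add[of A "- L"] h.hom_a_inv[of L] BX_closed(5)[of L]
      by (simp add: a_minus_def BX_simps)
  qed
  have car: "carrier (calkin_algebra smul) = calkin_class smul ` carrier BX"
    by (auto simp: calkin_algebra_def FactRing_def A_RCOSETS_def' calkin_class_def)
  show ?thesis
    unfolding calkin_convergent_def car essential_norm_def
    using diff[OF cesaro_mean_closed[OF T]] by (simp add: calkin_mean_class[OF T] Bex_def image_iff ex_simps cong: conj_cong) auto
qed

lemma calkin_means_converge_iff:
  fixes m :: nat
  assumes m: "m \<ge> 1" and bcap: "bounded_compact_approximation_property smul" and T: "T \<in> carrier BX"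
    and sub: "(\<lambda>n. enorm (T [^]\<^bsub>BX\<^esub> n) / real n) \<longlonglongrightarrow> 0"
  shows "calkin_convergent smul (\<lambda>n. calkin_mean smul n (calkin_class smul T)) \<longleftrightarrow>
    (\<exists>M. essentially_maximal_subspace smul
       (compact_on (blinfun_apply ((id_blinfun - T) [^]\<^bsub>BX\<^esub> m))) M)"
proof -
  interpret essentially_sublinear "blinfun_apply T"
  proof (intro essentially_sublinear.intro essentially_sublinear_axioms.intro)
    show "bounded_linear (blinfun_apply T)" by (rule blinfun.bounded_linear_right)
    show "(\<lambda>n. hnorm (blinfun_apply T ^^ n) / real n) \<longlonglongrightarrow> 0"
    proof (rule tendsto_sandwich[OF _ _ tendsto_const sub])
      show "\<forall>\<^sub>F n in sequentially. 0 \<le> hnorm (blinfun_apply T ^^ n) / real n"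
        by (intro always_eventually allI divide_nonneg_nonneg hnorm_nonneg bounded_linear_funpow
            blinfun.bounded_linear_right) simp
      show "\<forall>\<^sub>F n in sequentially. hnorm (blinfun_apply T ^^ n) / real n \<le> enorm (T [^]\<^bsub>BX\<^esub> n) / real n"
        by (intro always_eventually allI divide_right_mono) (simp_all add: hnorm_le_enorm flip: BX_pow_apply)
    qed
  qed
  have D_eq: "blinfun_apply (id_blinfun - T) = D" by (auto simp: D_def blinfun.diff_left)
  have Dm_eq: "blinfun_apply ((id_blinfun - T) [^]\<^bsub>BX\<^esub> m) = D ^^ m" by (simp add: BX_pow_apply D_eq)
  have mean_eq: "blinfun_apply (cesaro_mean T n) = mean n" for n
    by (auto simp: cesaro_mean_def mean_def blinfun.scaleR_left blinfun.sum_left BX_pow_apply)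
  obtain m' where m': "m = Suc m'" using m by (cases m) auto
  have Dm_smul: "(D ^^ m) (smul c x) = smul c ((D ^^ m) x)" for c x
    using BX_pow_closed[OF BX_closed(4)[OF BX_closed(2) T], of m]
    unfolding Dm_eq[symmetric] by (simp add: mem_bounded_operators_iff)
  show ?thesis
    unfolding calkin_convergent_iff[OF T] Dm_eq
  proof
    assume "\<exists>L\<in>carrier BX. (\<lambda>n. enorm (cesaro_mean T n - L)) \<longlonglongrightarrow> 0"
    then obtain L where L: "L \<in> carrier BX" and lim: "(\<lambda>n. enorm (cesaro_mean T n - L)) \<longlonglongrightarrow> 0" by blast
    have blL: "bounded_linear (blinfun_apply L)" by (rule blinfun.bounded_linear_right)
    have "(\<lambda>n. hnorm (\<lambda>x. mean n x - blinfun_apply L x)) \<longlonglongrightarrow> 0"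
    proof (rule tendsto_sandwich[OF _ _ tendsto_const lim])
      have eq: "(\<lambda>x. mean n x - blinfun_apply L x) = blinfun_apply (cesaro_mean T n - L)" for n
        by (simp add: mean_eq blinfun.diff_left fun_eq_iff)
      show "\<forall>\<^sub>F n in sequentially. 0 \<le> hnorm (\<lambda>x. mean n x - blinfun_apply L x)"
        unfolding eq by (intro always_eventually allI hnorm_nonneg blinfun.bounded_linear_right)
      show "\<forall>\<^sub>F n in sequentially. hnorm (\<lambda>x. mean n x - blinfun_apply L x) \<le> enorm (cesaro_mean T n - L)"
        unfolding eq by (intro always_eventually allI hnorm_le_enorm)
    qed
    note props = limit_properties[OF blL this]
    define U where "U x = x - blinfun_apply L x" for x
    have blU: "bounded_linear U"
      unfolding U_def[abs_def] by (intro bounded_linear_sub bounded_linear_ident blL)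
    interpret U: almost_idempotent U
    proof (intro almost_idempotent.intro almost_idempotent_axioms.intro blU)
      fix B :: "'a set" assume "bounded B"
      then show "precompact ((\<lambda>x. U x - U (U x)) ` B)"
        using props(2)[of B] by (simp add: U_def blinfun.diff_right)
    qed
    obtain r M C where M: "M = {x. (\<lambda>n. U.scaled_power r n x) \<longlonglongrightarrow> 0}" "closed M" "compact_on U M"
      and C: "\<And>y. \<exists>e\<in>M. norm (y - e) \<le> C * norm (U y)" "C > 0"
      by (rule U.exists_small_part) blast
    \<comment> \<open>\<open>M\<close> has to be a subspace over the full scalar field:
      \<open>U\<close> commutes with \<open>smul\<close>, hence so do its scaled powers.\<close>
    have U_smul: "U (smul c x) = smul c (U x)" for c x
      using L by (simp add: U_def mem_bounded_operators_iff scale_right_diff_distrib)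
    have Upow_smul: "(U ^^ n) (smul c x) = smul c ((U ^^ n) x)" for n c x
      by (induction n) (simp_all add: U_smul)
    have subM: "subspace M"
      unfolding subspace_def
    proof (intro conjI ballI allI)
      show "0 \<in> M" by (simp add: M(1) linear_0[OF bounded_linear.linear[OF U.bl_scaled_power]])
      fix x assume x: "x \<in> M"
      show "x + y \<in> M" if "y \<in> M" for y
        using tendsto_add[of "\<lambda>n. U.scaled_power r n x" 0 sequentially "\<lambda>n. U.scaled_power r n y" 0] x that
        by (simp add: M(1) linear_add[OF bounded_linear.linear[OF U.bl_scaled_power]])
      show "smul c x \<in> M" for c
      proof -
        have "U.scaled_power r n (smul c x) = smul c (U.scaled_power r n x)" for n
          by (simp add: U.scaled_power_def Upow_smul smul_scaleR)
        then show ?thesis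
          using bounded_linear.tendsto[OF bounded_linear_smul, of "\<lambda>n. U.scaled_power r n x" 0 sequentially c] x
          by (simp add: M(1))
      qed
    qed
    \<comment> \<open>From \<open>I = U + L\<close>: \<open>D^m = D^m U + D^(m-1) (D L)\<close>,
      where \<open>U\<close> is compact on \<open>M\<close> and \<open>D L\<close> is compact on the
      whole space.\<close>
    have "compact_on (D ^^ m) M"
      unfolding compact_on_iff
    proof (intro allI impI)
      fix B assume B: "B \<subseteq> M" "bounded B"
      have "precompact ((D ^^ m) ` U ` B)" by (rule precompact_image[OF compact_onD[OF M(3) B] bl_Dpow])
      moreover have "precompact ((D ^^ m') ` (\<lambda>x. D (blinfun_apply L x)) ` B)"
        by (rule precompact_image[OF props(1)[OF B(2)] bl_Dpow])
      ultimately have "precompact ((\<lambda>x. (D ^^ m) (U x) + (D ^^ m') (D (blinfun_apply L x))) ` B)"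
        by (intro precompact_image_add) (simp_all add: image_image)
      moreover have "(D ^^ m) (U x) + (D ^^ m') (D (blinfun_apply L x)) = (D ^^ m) x" for x
      proof -
        have "(D ^^ m') (D (blinfun_apply L x)) = (D ^^ m) (blinfun_apply L x)" by (simp add: m' funpow_swap1)
        then show ?thesis
          by (simp add: U_def linear_diff[OF bounded_linear.linear[OF bl_Dpow]])
      qed
      ultimately show "precompact ((D ^^ m) ` B)" by simp
    qed
    \<comment> \<open>On \<open>M0\<close> compactness passes from \<open>D^m\<close> to
      \<open>D\<close> and from there to \<open>U = I - L\<close>, so the distance estimate for
      \<open>M\<close> applies.\<close>
    moreover have "finite_dim_quotient smul M0 M"
      if M0: "subspace M0" "M \<subseteq> M0" "compact_on (D ^^ m) M0" for M0
    proof (rule finite_dim_quotient_if_compact_on[OF blU subM M(2) M0(1,2) _ C(2,1)])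
      have "compact_on D M0" by (rule compact_on_D_if_pow[OF M0(3) m])
      then show "compact_on U M0"
        using props(3) unfolding compact_on_iff U_def[abs_def] by blast
    qed
    ultimately show "\<exists>M. essentially_maximal_subspace smul (compact_on (D ^^ m)) M"
      unfolding essentially_maximal_subspace_def using subM by blast
  next
    assume "\<exists>M. essentially_maximal_subspace smul (compact_on (D ^^ m)) M"
    then obtain M where M: "essentially_maximal_subspace smul (compact_on (D ^^ m)) M" by blast
    obtain Y where Y: "compact_on (D ^^ m) Y" "compactly_controls (D ^^ m) Y"
      using exists_compactly_controlling_extension[OF bl_Dpow Dm_smul M] by blast
    have DY: "compact_on D Y" by (rule compact_on_D_if_pow[OF Y(1) m])
    obtain C where C: "C > 0"
      "\<And>A e. A \<in> carrier BX \<Longrightarrow> hnorm (blinfun_apply A) < e \<Longrightarrow> enorm A \<le> C * e"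
      using enorm_le_hnorm[OF bcap] by blast
    have "\<exists>N. \<forall>k\<ge>N. \<forall>l\<ge>N. enorm (cesaro_mean T k - cesaro_mean T l) < e" if e: "e > 0" for e
    proof -
      have "e / (2 * C) > 0" using e C(1) by simp
      then obtain N where N: "\<And>k l. k \<ge> N \<Longrightarrow> l \<ge> N \<Longrightarrow> hnorm (\<lambda>x. mean k x - mean l x) < e / (2 * C)"
        using means_Cauchy[OF DY Y(2)[unfolded m']] by blast
      have "enorm (cesaro_mean T k - cesaro_mean T l) < e" if "k \<ge> N" "l \<ge> N" for k l
      proof -
        have "blinfun_apply (cesaro_mean T k - cesaro_mean T l) = (\<lambda>x. mean k x - mean l x)"
          by (simp add: mean_eq blinfun.diff_left fun_eq_iff)
        then have "enorm (cesaro_mean T k - cesaro_mean T l) \<le> C * (e / (2 * C))"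
          using N[OF that] by (intro C(2) BX_closed cesaro_mean_closed T) simp
        also have "\<dots> < e" using C(1) e by simp
        finally show ?thesis .
      qed
      then show ?thesis by blast
    qed
    then show "\<exists>L\<in>carrier BX. (\<lambda>n. enorm (cesaro_mean T n - L)) \<longlonglongrightarrow> 0"
      using calkin_complete[of "cesaro_mean T", OF cesaro_mean_closed[OF T]] by blast
  qed
qed

end

theorem theorem1p3:
  fixes smul :: "'k::real_or_complex \<Rightarrow> 'a::banach \<Rightarrow> 'a"
    and T :: "'a \<Rightarrow>\<^sub>L 'a" and m :: nat
  assumes "m \<ge> 1"
    and "banach_over smul"
    and "bounded_compact_approximation_property smul"
    and "T \<in> carrier (bounded_operators smul)"
    and "(\<lambda>n. essential_norm smul (T [^]\<^bsub>bounded_operators smul\<^esub> n) / real n) \<longlonglongrightarrow> 0"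
  shows "calkin_convergent smul (\<lambda>n. calkin_mean smul n (calkin_class smul T)) \<longleftrightarrow>
    (\<exists>M. essentially_maximal_subspace smul
       (compact_on (blinfun_apply ((id_blinfun - T) [^]\<^bsub>bounded_operators smul\<^esub> m))) M)"
  by (rule banach_over.calkin_means_converge_iff[OF assms(2,1,3,4,5)])

end
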